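(* There is a polynomial-time algorithm that, given an optimal solution $\big(\{\boldsymbol{\ell}^h\}_{h\in E},\{\mathbf{v}_i\}_{i\in V}\big)$ of the program RC-Metric for $G$ with objective value $\mathrm{opt}=\sum_{h\in E}w_h\|\boldsymbol{\ell}^h\|_{F_h}$, returns a cut $S\subseteq V$ with $\Psi_G(S)\le\mathrm{opt}\cdot O(\sqrt{\log n})$.
   Context: $G=(V,E,\mathbf{w},\boldsymbol{\mu})$ is a weighted hypergraph ($\mathbf{w}>0$, $\boldsymbol{\mu}\ge0$, $n=|V|$) with monotone submodular cut functions $\delta_h(S)=\min\{F_h(S),F_h(h\setminus S)\}$, each $F_h:2^h\to\mathbb{R}$ non-decreasing submodular with $F_h(\emptyset)=0$ and $F_h(\{i\})>0$. $\|\mathbf{x}\|_{F_h}=\bar F_h(|\mathbf{x}|)$ with $\bar F_h$ the Lovász extension. $\Psi_G(S)=\frac{\sum_hw_h\delta_h(S\cap h)}{\min\{\boldsymbol{\mu}(S),\boldsymbol{\mu}(V\setminus S)\}}$. The factor graph of $G$ is the bipartite graph on $V\cup E$ with edge $\{i,h\}$ iff $i\in h$. RC-Metric: variables $\mathbf{v}_i\in\mathbb{R}^n$, $\boldsymbol{\ell}^h\in\mathbb{R}^h$; minimize $\sum_hw_h\|\boldsymbol{\ell}^h\|_{F_h}$ subject to (a) $\sum_{\{i,j\}\subseteq V}\frac{\mu_i\mu_j}{\boldsymbol{\mu}(V)}\|\mathbf{v}_i-\mathbf{v}_j\|_2^2\ge1$; (b) for every pair $\{i,j\}$ and every factor-graph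 path $i=u_0,h_1,u_1,\dots,h_k,u_k=j$, $\|\mathbf{v}_i-\mathbf{v}_j\|_2^2\le\sum_{m=1}^k(\ell^{h_m}_{u_{m-1}}+\ell^{h_m}_{u_m})$; (c) triangle inequalities $\|\mathbf{v}_i-\mathbf{v}_j\|_2^2\le\|\mathbf{v}_i-\mathbf{v}_k\|_2^2+\|\mathbf{v}_k-\mathbf{v}_j\|_2^2$ for all $i,j,k$. *)

theory Defs
  imports
    "HOL-Analysis.Analysis"
    "HOL-Computational_Algebra.Polynomial"
    "HOL-Library.Landau_Symbols"
begin

section \<open>Weighted submodular hypergraphs\<close>

record 'a hypergraph =
  verts  :: "'a set"
  hedges :: "'a set set"
  weight :: "'a set \<Rightarrow> real"
  meas   :: "'a \<Rightarrow> real"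
  subf   :: "'a set \<Rightarrow> 'a set \<Rightarrow> real"

definition nondecreasing_on :: "'a set \<Rightarrow> ('a set \<Rightarrow> real) \<Rightarrow> bool" where
  "nondecreasing_on h F \<longleftrightarrow> (\<forall>A B. A \<subseteq> B \<and> B \<subseteq> h \<longrightarrow> F A \<le> F B)"

definition submodular_on :: "'a set \<Rightarrow> ('a set \<Rightarrow> real) \<Rightarrow> bool" where
  "submodular_on h F \<longleftrightarrow>
     (\<forall>A B. A \<subseteq> h \<and> B \<subseteq> h \<longrightarrow> F (A \<union> B) + F (A \<inter> B) \<le> F A + F B)"

definition submodular_hypergraph :: "'a hypergraph \<Rightarrow> bool" where
  "submodular_hypergraph G \<longleftrightarrow>
     finite (verts G) \<and>
     (\<forall>h\<in>hedges G. h \<subseteq> verts G) \<and>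
     (\<forall>h\<in>hedges G. weight G h > 0) \<and>
     (\<forall>i\<in>verts G. meas G i \<ge> 0) \<and>
     (\<forall>h\<in>hedges G.
        nondecreasing_on h (subf G h) \<and> submodular_on h (subf G h) \<and>
        subf G h {} = 0 \<and> (\<forall>i\<in>h. subf G h {i} > 0))"

definition cut_function :: "'a hypergraph \<Rightarrow> 'a set \<Rightarrow> 'a set \<Rightarrow> real" where
  "cut_function G h S = min (subf G h S) (subf G h (h - S))"

definition total_meas :: "'a hypergraph \<Rightarrow> 'a set \<Rightarrow> real" where
  "total_meas G S = (\<Sum>i\<in>S. meas G i)"

definition balance :: "'a hypergraph \<Rightarrow> 'a set \<Rightarrow> real" where
  "balance G S = min (total_meas G S) (total_meas G (verts G - S))"

(* Meaningful only if balance G S > 0: as division by zero yields zero in HOL, statements about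
   this ratio must assert positivity of the denominator separately. *)
definition Psi :: "'a hypergraph \<Rightarrow> 'a set \<Rightarrow> real" where
  "Psi G S = (\<Sum>h\<in>hedges G. weight G h * cut_function G h (S \<inter> h)) / balance G S"

(* Level-set (Choquet) form of the Lovasz extension of F : 2^h \<rightarrow> R with F {} = 0,
   valid for x \<in> R^h of arbitrary sign. The integrands are step functions of bounded support. *)
definition lovasz_ext :: "'a set \<Rightarrow> ('a set \<Rightarrow> real) \<Rightarrow> ('a \<Rightarrow> real) \<Rightarrow> real" where
  "lovasz_ext h F x =
     (LBINT t:{0<..}. F {i\<in>h. x i \<ge> t}) + (LBINT t:{..0}. F {i\<in>h. x i \<ge> t} - F h)"

definition F_norm :: "'a set \<Rightarrow> ('a set \<Rightarrow> real) \<Rightarrow> ('a \<Rightarrow> real) \<Rightarrow> real" where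
  "F_norm h F x = lovasz_ext h F (\<lambda>i. \<bar>x i\<bar>)"


section \<open>The program RC-Metric\<close>

definition factor_graph :: "'a hypergraph \<Rightarrow> ('a + 'a set) set set" where
  "factor_graph G = {{Inl i, Inr h} | i h. i \<in> verts G \<and> h \<in> hedges G \<and> i \<in> h}"

(* The path us!0, hs!0, us!1, hs!1, ..., us!k with k = length hs; no node is repeated. *)
definition factor_path :: "'a hypergraph \<Rightarrow> 'a list \<Rightarrow> 'a set list \<Rightarrow> bool" where
  "factor_path G us hs \<longleftrightarrow>
     length us = length hs + 1 \<and> distinct us \<and> distinct hs \<and>
     set us \<subseteq> verts G \<and> set hs \<subseteq> hedges G \<and>
     (\<forall>m<length hs. {Inl (us ! m), Inr (hs ! m)} \<in> factor_graph G \<and>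
                    {Inr (hs ! m), Inl (us ! Suc m)} \<in> factor_graph G)"

(* Vectors of R^n, n = card (verts G), are functions nat \<Rightarrow> real of which only the coordinates
   below n matter; likewise only the entries l h i with i \<in> h matter. *)
definition sqdist :: "'a hypergraph \<Rightarrow> ('a \<Rightarrow> nat \<Rightarrow> real) \<Rightarrow> 'a \<Rightarrow> 'a \<Rightarrow> real" where
  "sqdist G v i j = (\<Sum>k<card (verts G). (v i k - v j k)\<^sup>2)"

definition rc_objective :: "'a hypergraph \<Rightarrow> ('a set \<Rightarrow> 'a \<Rightarrow> real) \<Rightarrow> real" where
  "rc_objective G l = (\<Sum>h\<in>hedges G. weight G h * F_norm h (subf G h) (l h))"

definition rc_feasible ::
  "('a::linorder) hypergraph \<Rightarrow> ('a set \<Rightarrow> 'a \<Rightarrow> real) \<Rightarrow> ('a \<Rightarrow> nat \<Rightarrow> real) \<Rightarrow> bool" where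
  "rc_feasible G l v \<longleftrightarrow>
     (\<Sum>(i, j)\<in>{(i, j). i \<in> verts G \<and> j \<in> verts G \<and> i < j}.
        meas G i * meas G j / total_meas G (verts G) * sqdist G v i j) \<ge> 1 \<and>
     (\<forall>us hs. factor_path G us hs \<longrightarrow>
        sqdist G v (hd us) (last us)
          \<le> (\<Sum>m<length hs. l (hs ! m) (us ! m) + l (hs ! m) (us ! Suc m))) \<and>
     (\<forall>i\<in>verts G. \<forall>j\<in>verts G. \<forall>k\<in>verts G.
        sqdist G v i j \<le> sqdist G v i k + sqdist G v k j)"

definition rc_optimal ::
  "('a::linorder) hypergraph \<Rightarrow> ('a set \<Rightarrow> 'a \<Rightarrow> real) \<Rightarrow> ('a \<Rightarrow> nat \<Rightarrow> real) \<Rightarrow> bool" where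
  "rc_optimal G l v \<longleftrightarrow>
     rc_feasible G l v \<and>
     (\<forall>l' v'. rc_feasible G l' v' \<longrightarrow> rc_objective G l \<le> rc_objective G l')"


section \<open>Algorithms: a deterministic real RAM with a value oracle\<close>

text \<open>
  An optimal solution of RC-Metric is in general irrational, so algorithms are programs over the
  reals in the sense of Blum, Shub and Smale: exact field operations and comparisons at unit cost,
  no rounding and no roots. A store consists of two-dimensional arrays of naturals and of reals;
  arrays are named by the constants occurring in the program, and a scalar is an array used at one
  position only. To keep the unit-cost measure honest, naturals (used for indices and flags) admit
  only addition and truncated subtraction, and the constants of a program are natural numbers
  rather than arbitrary reals. Real division by zero yields zero.
\<close>

datatype nexp =
    NConst nat
  | NGet nat nexp nexp
  | NPlus nexp nexp
  | NMinus nexp nexp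

datatype rexp =
    ROfNat nexp
  | RGet nat nexp nexp
  | RPlus rexp rexp
  | RMinus rexp rexp
  | RTimes rexp rexp
  | RDivide rexp rexp

datatype bexp =
    NLess nexp nexp
  | RLess rexp rexp
  | BNot bexp
  | BAnd bexp bexp

datatype prog =
    Skip
  | NSet nat nexp nexp nexp
  | RSet nat nexp nexp rexp
  | Query nat nexp nat
  | Seq prog prog
  | Cond bexp prog prog
  | While bexp prog

record store =
  nats  :: "nat \<Rightarrow> nat \<Rightarrow> nat \<Rightarrow> nat"
  reals :: "nat \<Rightarrow> nat \<Rightarrow> nat \<Rightarrow> real"

definition set_cell :: "(nat \<Rightarrow> nat \<Rightarrow> nat \<Rightarrow> 'b) \<Rightarrow> nat \<Rightarrow> nat \<Rightarrow> nat \<Rightarrow> 'b \<Rightarrow> (nat \<Rightarrow> nat \<Rightarrow> nat \<Rightarrow> 'b)" where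
  "set_cell M a i j x = M(a := (M a)(i := (M a i)(j := x)))"

fun nval :: "nexp \<Rightarrow> store \<Rightarrow> nat" where
  "nval (NConst c) s = c"
| "nval (NGet a i j) s = nats s a (nval i s) (nval j s)"
| "nval (NPlus e f) s = nval e s + nval f s"
| "nval (NMinus e f) s = nval e s - nval f s"

fun rval :: "rexp \<Rightarrow> store \<Rightarrow> real" where
  "rval (ROfNat e) s = real (nval e s)"
| "rval (RGet a i j) s = reals s a (nval i s) (nval j s)"
| "rval (RPlus e f) s = rval e s + rval f s"
| "rval (RMinus e f) s = rval e s - rval f s"
| "rval (RTimes e f) s = rval e s * rval f s"
| "rval (RDivide e f) s = rval e s / rval f s"

fun bval :: "bexp \<Rightarrow> store \<Rightarrow> bool" where
  "bval (NLess e f) s = (nval e s < nval f s)"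
| "bval (RLess e f) s = (rval e s < rval f s)"
| "bval (BNot b) s = (\<not> bval b s)"
| "bval (BAnd b c) s = (bval b s \<and> bval c s)"

(* run Q c s t s': with oracle Q, program c started in s halts in s' after t steps. Expressions
   are of constant size for a fixed program and are not charged separately. Query d e a asks the
   oracle for the value of hyperedge number e at the set whose flags are in column 0 of the
   natural array a, and stores the answer at position (0, 0) of the real array d. *)
inductive run ::
  "(nat \<Rightarrow> nat set \<Rightarrow> real) \<Rightarrow> prog \<Rightarrow> store \<Rightarrow> nat \<Rightarrow> store \<Rightarrow> bool"
  for Q :: "nat \<Rightarrow> nat set \<Rightarrow> real" where
  run_Skip: "run Q Skip s 1 s"
| run_NSet: "run Q (NSet a i j e) s 1
    (s\<lparr>nats := set_cell (nats s) a (nval i s) (nval j s) (nval e s)\<rparr>)"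
| run_RSet: "run Q (RSet a i j e) s 1
    (s\<lparr>reals := set_cell (reals s) a (nval i s) (nval j s) (rval e s)\<rparr>)"
| run_Query: "run Q (Query d e a) s 1
    (s\<lparr>reals := set_cell (reals s) d 0 0 (Q (nval e s) {i. nats s a i 0 \<noteq> 0})\<rparr>)"
| run_Seq: "run Q c s t s' \<Longrightarrow> run Q c' s' t' s'' \<Longrightarrow> run Q (Seq c c') s (t + t') s''"
| run_CondT: "bval b s \<Longrightarrow> run Q c s t s' \<Longrightarrow> run Q (Cond b c c') s (t + 1) s'"
| run_CondF: "\<not> bval b s \<Longrightarrow> run Q c' s t s' \<Longrightarrow> run Q (Cond b c c') s (t + 1) s'"
| run_WhileF: "\<not> bval b s \<Longrightarrow> run Q (While b c) s 1 s"
| run_WhileT: "bval b s \<Longrightarrow> run Q c s t s' \<Longrightarrow> run Q (While b c) s' t' s'' \<Longrightarrow>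
    run Q (While b c) s (t + t' + 1) s''"


section \<open>Input and output of a rounding algorithm\<close>

(* An instance is presented with vertices numbered 0, ..., n - 1 and the hyperedges listed without
   repetition in es. The functions subf G h are accessible through the value oracle only. *)
definition enumerated :: "nat hypergraph \<Rightarrow> nat set list \<Rightarrow> bool" where
  "enumerated G es \<longleftrightarrow>
     verts G = {..<card (verts G)} \<and> distinct es \<and> set es = hedges G"

definition value_oracle :: "nat hypergraph \<Rightarrow> nat set list \<Rightarrow> nat \<Rightarrow> nat set \<Rightarrow> real" where
  "value_oracle G es e S = (if e < length es then subf G (es ! e) (S \<inter> es ! e) else 0)"

(* Naturals: array 0 holds n and m = |E|, array 1 the incidence matrix. Reals: arrays 0 and 1 hold
   the weights and the measure, arrays 2 and 3 the vectors v and l. Everything else is zero. *)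
definition input_store ::
  "nat hypergraph \<Rightarrow> nat set list \<Rightarrow> (nat set \<Rightarrow> nat \<Rightarrow> real) \<Rightarrow> (nat \<Rightarrow> nat \<Rightarrow> real) \<Rightarrow> store" where
  "input_store G es l v =
     (let n = card (verts G); m = length es in
      \<lparr>nats = (\<lambda>a i j.
         if a = 0 \<and> i = 0 \<and> j = 0 then n
         else if a = 0 \<and> i = 0 \<and> j = 1 then m
         else if a = 1 \<and> i < m \<and> j \<in> es ! i then 1
         else 0),
       reals = (\<lambda>a i j.
         if a = 0 \<and> i < m \<and> j = 0 then weight G (es ! i)
         else if a = 1 \<and> i < n \<and> j = 0 then meas G i
         else if a = 2 \<and> i < n \<and> j < n then v i j
         else if a = 3 \<and> i < m \<and> j \<in> es ! i then l (es ! i) j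
         else 0)\<rparr>)"

(* The returned cut is read off the flags in column 0 of natural array 2. *)
definition output_cut :: "nat hypergraph \<Rightarrow> store \<Rightarrow> nat set" where
  "output_cut G s = {i \<in> verts G. nats s 2 i 0 \<noteq> 0}"

end

(*
  Write d(i, j) for the squared distance of the vectors. Cutting along the level sets of a function f
  that is 1-Lipschitz for d costs at most 2 opt in total: within a hyperedge h the intervals of radius
  l^h_i around f(i) have a common point, so that every level set of f or its complement is contained in
  a level set of l^h. Hence it suffices to find f whose average spread is at least c / sqrt (log n) times the
  average of d. As in Arora-Rao-Vazirani, f is the distance from a set A. First map the vectors
  to R^m with m = O(log n) and constant distortion, choosing m rows of signs greedily by the method of
  conditional expectations. The cube {-1, 1}^m of directions then has polynomial size. If no
  set A (of a polynomial list computed from these directions) worked, every large set A on the list would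
  have almost all points within a small distance D of A. For a direction e let G_r(x, e) be the largest
  increase of the projection to e among the points within distance r of x. It has variance O(r) by the
  Poincare inequality, so a
  point with large mean reach has large reach in most directions. Two applications of the expansion
  then show that the mean reach grows by a constant when r grows by 2 D, for most points x. But G_r is at
  most sqrt (r m), which bounds D from below by c / sqrt m.
*)
theory Submission
  imports
    Defs
    "HOL-Library.Nat_Bijection"
begin

section \<open>Functions on the discrete cube\<close>

text \<open>Squared distances form a metric here, so radii along a chain add up: order
  \<open>sqrt m\<close> steps of length of order \<open>1 / sqrt m\<close> stay in a ball of
  constant radius. This is why second moments suffice. At radius below \<open>10^-9\<close> the
  variance of the reach is so small that Chebyshev's inequality, with constant failure probability,
  already converts mean reach into typical reach and back; no Gaussian tails are called for.
  Reducing the dimension serves two ends: averages over all directions become computable exactly,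
  which replaces random sampling, and the Cauchy-Schwarz bound on the reach becomes strong enough to
  end the growth. A second obstacle is the machine, which has neither roots nor exponentials.
  Therefore every radius is given as a distance of two input points and every threshold as a value
  at a point, which makes the search invariant under scaling, and the potential that selects the
  signs is evaluated through a rational approximation of the exponential, whose relative errors over
  all choices multiply to at most \<open>exp 1\<close>.\<close>

definition cube_avg :: "nat \<Rightarrow> (nat set \<Rightarrow> real) \<Rightarrow> real" where
  "cube_avg m f = (\<Sum>A\<in>Pow {..<m}. f A) / 2 ^ m"

text \<open>A vertex of the cube is the set of its negative coordinates, so that
  \<open>Pow {..<m}\<close> is the sample space and the binary digits of a number can later name a
  direction.\<close>

definition sg :: "nat set \<Rightarrow> nat \<Rightarrow> real" where
  "sg A k = (if k \<in> A then -1 else 1)"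

lemma sg_square [simp]: "(sg A k)\<^sup>2 = 1"
  by (simp add: sg_def)

definition flip :: "nat \<Rightarrow> nat set \<Rightarrow> nat set" where
  "flip k A = (if k \<in> A then A - {k} else insert k A)"

lemma cube_avg_0 [simp]: "cube_avg 0 f = f {}"
  by (simp add: cube_avg_def)

lemma cube_avg_Suc:
  "cube_avg (Suc m) f = (cube_avg m f + cube_avg m (\<lambda>A. f (insert m A))) / 2"
proof -
  have inj: "inj_on (insert m) (Pow {..<m})"
    by (auto simp: inj_on_def) 
  have "Pow {..<Suc m} = Pow {..<m} \<union> insert m ` Pow {..<m}"
    by (simp add: lessThan_Suc Pow_insert)
  moreover have "Pow {..<m} \<inter> insert m ` Pow {..<m} = {}"
    by auto
  ultimately have "(\<Sum>A\<in>Pow {..<Suc m}. f A) =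
      (\<Sum>A\<in>Pow {..<m}. f A) + (\<Sum>A\<in>insert m ` Pow {..<m}. f A)"
    by (simp add: sum.union_disjoint)
  also have "(\<Sum>A\<in>insert m ` Pow {..<m}. f A) = (\<Sum>A\<in>Pow {..<m}. f (insert m A))"
    by (simp add: sum.reindex[OF inj])
  finally show ?thesis
    by (simp add: cube_avg_def field_simps)
qed

lemma cube_avg_const [simp]: "cube_avg m (\<lambda>_. c) = c"
  by (simp add: cube_avg_def card_Pow)

lemma cube_avg_add: "cube_avg m (\<lambda>A. f A + g A) = cube_avg m f + cube_avg m g"
  by (simp add: cube_avg_def sum.distrib add_divide_distrib)

lemma cube_avg_diff: "cube_avg m (\<lambda>A. f A - g A) = cube_avg m f - cube_avg m g"
  by (simp add: cube_avg_def sum_subtractf diff_divide_distrib)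

lemma cube_avg_cmult: "cube_avg m (\<lambda>A. c * f A) = c * cube_avg m f"
  by (simp add: cube_avg_def sum_distrib_left)

lemma cube_avg_sum: "cube_avg m (\<lambda>A. \<Sum>x\<in>X. f x A) = (\<Sum>x\<in>X. cube_avg m (f x))"
  by (simp add: cube_avg_def sum_divide_distrib) (rule sum.swap)

lemma cube_avg_mono:
  "(\<And>A. A \<subseteq> {..<m} \<Longrightarrow> f A \<le> g A) \<Longrightarrow> cube_avg m f \<le> cube_avg m g"
  by (auto simp: cube_avg_def intro!: divide_right_mono sum_mono)

lemma cube_avg_cong:
  "(\<And>A. A \<subseteq> {..<m} \<Longrightarrow> f A = g A) \<Longrightarrow> cube_avg m f = cube_avg m g"
  by (intro antisym cube_avg_mono) auto

lemma cube_avg_flip: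
  assumes "k < m"
  shows "cube_avg m (\<lambda>A. f (flip k A)) = cube_avg m f"
proof -
  have "(\<Sum>A\<in>Pow {..<m}. f (flip k A)) = (\<Sum>A\<in>Pow {..<m}. f A)"
    by (rule sum.reindex_bij_witness[of _ "flip k" "flip k"])
       (use assms in \<open>auto simp: flip_def split: if_splits\<close>)
  then show ?thesis by (simp add: cube_avg_def)
qed

lemma flip_flip [simp]: "flip k (flip k A) = A"
  by (auto simp: flip_def)

text \<open>Induction on the dimension by conditioning on the last coordinate. With \<open>g\<close>
  the average of \<open>f\<close> over that coordinate, the variance of \<open>f\<close> is the
  variance of \<open>g\<close> plus the mean of the squared half differences, and the latter is
  exactly the contribution of the last coordinate on the right.\<close>

theorem cube_poincare:
  "cube_avg m (\<lambda>A. (f A)\<^sup>2) - (cube_avg m f)\<^sup>2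
     \<le> (\<Sum>k<m. cube_avg m (\<lambda>A. (f A - f (flip k A))\<^sup>2)) / 4"
proof (induction m arbitrary: f)
  case 0
  then show ?case by simp
next
  case (Suc m)
  define f1 where "f1 A = f (insert m A)" for A
  define g where "g A = (f A + f1 A) / 2" for A
  have fl: "f1 (flip k A) = f (flip k (insert m A))" if "k < m" for k A
    using that by (auto simp: f1_def flip_def insert_commute insert_Diff_if)
  have avg_f: "cube_avg (Suc m) f = cube_avg m g"
    unfolding cube_avg_Suc g_def f1_def
    using cube_avg_cmult[of m "1/2" "\<lambda>A. f A + f (insert m A)"]
    by (simp add: cube_avg_add mult.commute)
  have avg_f2: "cube_avg (Suc m) (\<lambda>A. (f A)\<^sup>2) =
      cube_avg m (\<lambda>A. (g A)\<^sup>2) + cube_avg m (\<lambda>A. (f A - f1 A)\<^sup>2) / 4"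
  proof -
    have "cube_avg (Suc m) (\<lambda>A. (f A)\<^sup>2) = cube_avg m (\<lambda>A. 1/2 * ((f A)\<^sup>2 + (f1 A)\<^sup>2))"
      unfolding cube_avg_cmult by (simp add: cube_avg_Suc f1_def cube_avg_add)
    also have "\<dots> = cube_avg m (\<lambda>A. (g A)\<^sup>2 + 1/4 * (f A - f1 A)\<^sup>2)"
      by (rule cube_avg_cong) (simp add: g_def power2_eq_square field_simps)
    also have "\<dots> = cube_avg m (\<lambda>A. (g A)\<^sup>2) + 1/4 * cube_avg m (\<lambda>A. (f A - f1 A)\<^sup>2)"
      unfolding cube_avg_add cube_avg_cmult ..
    finally show ?thesis by simp
  qed
  have last: "cube_avg (Suc m) (\<lambda>A. (f A - f (flip m A))\<^sup>2) = cube_avg m (\<lambda>A. (f A - f1 A)\<^sup>2)"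
  proof -
    have 1: "cube_avg m (\<lambda>A. (f A - f (flip m A))\<^sup>2) = cube_avg m (\<lambda>A. (f A - f1 A)\<^sup>2)"
    proof (rule cube_avg_cong)
      fix A assume "A \<subseteq> {..<m}"
      then have "m \<notin> A" by auto
      then show "(f A - f (flip m A))\<^sup>2 = (f A - f1 A)\<^sup>2"
        by (simp add: f1_def flip_def)
    qed
    have 2: "cube_avg m (\<lambda>A. (f (insert m A) - f (flip m (insert m A)))\<^sup>2) = cube_avg m (\<lambda>A. (f A - f1 A)\<^sup>2)"
    proof (rule cube_avg_cong)
      fix A assume "A \<subseteq> {..<m}"
      then have "m \<notin> A" by auto
      then have "flip m (insert m A) = A" by (auto simp: flip_def)
      then show "(f (insert m A) - f (flip m (insert m A)))\<^sup>2 = (f A - f1 A)\<^sup>2"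
        by (simp add: f1_def power2_commute)
    qed
    show ?thesis unfolding cube_avg_Suc 1 2 by simp
  qed
  \<comment> \<open>Averaging over the last coordinate can only lower the influence of coordinate
    \<open>k\<close>, by convexity of the square.\<close>
  have step: "cube_avg m (\<lambda>A. (g A - g (flip k A))\<^sup>2) \<le> cube_avg (Suc m) (\<lambda>A. (f A - f (flip k A))\<^sup>2)"
    if "k < m" for k
  proof -
    have "cube_avg m (\<lambda>A. (g A - g (flip k A))\<^sup>2) \<le>
        cube_avg m (\<lambda>A. 1/2 * ((f A - f (flip k A))\<^sup>2 + (f1 A - f1 (flip k A))\<^sup>2))"
    proof (rule cube_avg_mono)
      fix A
      have "((x + y) / 2)\<^sup>2 \<le> 1/2 * (x\<^sup>2 + y\<^sup>2)" for x y :: real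
        using zero_le_power2[of "x - y"] by (simp add: power2_eq_square field_simps)
      from this[of "f A - f (flip k A)" "f1 A - f1 (flip k A)"]
      show "(g A - g (flip k A))\<^sup>2 \<le> 1/2 * ((f A - f (flip k A))\<^sup>2 + (f1 A - f1 (flip k A))\<^sup>2)"
        by (simp add: g_def diff_divide_distrib[symmetric] add_diff_add)
    qed
    also have "\<dots> = cube_avg (Suc m) (\<lambda>A. (f A - f (flip k A))\<^sup>2)"
      unfolding cube_avg_cmult cube_avg_add cube_avg_Suc fl[OF that] by (simp add: f1_def)
    finally show ?thesis .
  qed
  have "cube_avg (Suc m) (\<lambda>A. (f A)\<^sup>2) - (cube_avg (Suc m) f)\<^sup>2
      \<le> (\<Sum>k<m. cube_avg m (\<lambda>A. (g A - g (flip k A))\<^sup>2)) / 4 + cube_avg m (\<lambda>A. (f A - f1 A)\<^sup>2) / 4"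
    unfolding avg_f avg_f2 using Suc.IH[of g] by simp
  also have "\<dots> \<le> (\<Sum>k<m. cube_avg (Suc m) (\<lambda>A. (f A - f (flip k A))\<^sup>2)) / 4
      + cube_avg (Suc m) (\<lambda>A. (f A - f (flip m A))\<^sup>2) / 4"
    unfolding last using sum_mono[of "{..<m}", OF step] by simp
  finally show ?case by simp
qed

section \<open>Moments and maxima of signed sums\<close>

definition signed_sum :: "nat \<Rightarrow> (nat \<Rightarrow> real) \<Rightarrow> nat set \<Rightarrow> real" where
  "signed_sum m a A = (\<Sum>k<m. sg A k * a k)"

lemma signed_sum_Suc: "signed_sum (Suc m) a A = signed_sum m a A + sg A m * a m"
  by (simp add: signed_sum_def)

lemma signed_sum_insert: "signed_sum m a (insert m A) = signed_sum m a A"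
  by (simp add: signed_sum_def sg_def)

text \<open>Stated for an arbitrary \<open>F\<close> so that one recursion yields the first, second
  and fourth moments.\<close>

lemma cube_avg_signed_sum_Suc:
  "cube_avg (Suc m) (\<lambda>A. F (signed_sum (Suc m) a A)) =
     cube_avg m (\<lambda>A. (F (signed_sum m a A + a m) + F (signed_sum m a A - a m)) / 2)"
proof -
  have "cube_avg m (\<lambda>A. F (signed_sum (Suc m) a A)) = cube_avg m (\<lambda>A. F (signed_sum m a A + a m))"
    by (rule cube_avg_cong) (auto simp: signed_sum_Suc sg_def)
  moreover have "cube_avg m (\<lambda>A. F (signed_sum (Suc m) a (insert m A))) =
      cube_avg m (\<lambda>A. F (signed_sum m a A - a m))"
    by (rule cube_avg_cong) (auto simp: signed_sum_Suc signed_sum_insert, simp add: sg_def)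
  moreover have "cube_avg m (\<lambda>A. (F (signed_sum m a A + a m) + F (signed_sum m a A - a m)) / 2) =
      (cube_avg m (\<lambda>A. F (signed_sum m a A + a m)) + cube_avg m (\<lambda>A. F (signed_sum m a A - a m))) / 2"
    using cube_avg_cmult[of m "1/2" "\<lambda>A. F (signed_sum m a A + a m) + F (signed_sum m a A - a m)"]
    by (simp add: cube_avg_add)
  ultimately show ?thesis by (simp add: cube_avg_Suc)
qed

lemma cube_avg_signed_sum: "cube_avg m (signed_sum m a) = 0"
proof (induction m)
  case 0
  then show ?case by (simp add: signed_sum_def)
next
  case (Suc m)
  then show ?case
    using cube_avg_signed_sum_Suc[of m "\<lambda>x. x" a] by simp
qed

lemma cube_avg_signed_sum_sq: "cube_avg m (\<lambda>A. (signed_sum m a A)\<^sup>2) = (\<Sum>k<m. (a k)\<^sup>2)"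
proof (induction m)
  case 0
  then show ?case by (simp add: signed_sum_def)
next
  case (Suc m)
  have "cube_avg (Suc m) (\<lambda>A. (signed_sum (Suc m) a A)\<^sup>2) = cube_avg m (\<lambda>A. (signed_sum m a A)\<^sup>2 + (a m)\<^sup>2)"
    unfolding cube_avg_signed_sum_Suc[of m "\<lambda>x. x\<^sup>2"]
    by (rule cube_avg_cong) (simp add: power2_eq_square field_simps)
  then show ?case by (simp add: cube_avg_add Suc.IH)
qed

text \<open>Khintchine's inequality for the fourth moment: the odd powers of the new term cancel
  between its two signs, and the remaining \<open>6 * a^2 * q + a^4\<close> is at most the increment
  of \<open>3 * q^2\<close>.\<close>

lemma cube_avg_signed_sum_pow4:
  "cube_avg m (\<lambda>A. (signed_sum m a A) ^ 4) \<le> 3 * (\<Sum>k<m. (a k)\<^sup>2)\<^sup>2"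
proof (induction m)
  case 0
  then show ?case by (simp add: signed_sum_def)
next
  case (Suc m)
  let ?q = "\<Sum>k<m. (a k)\<^sup>2"
  have "cube_avg (Suc m) (\<lambda>A. (signed_sum (Suc m) a A) ^ 4) =
      cube_avg m (\<lambda>A. (signed_sum m a A) ^ 4 + ((6 * (a m)\<^sup>2) * (signed_sum m a A)\<^sup>2 + (a m) ^ 4))"
    unfolding cube_avg_signed_sum_Suc[of m "\<lambda>x. x ^ 4"]
    by (rule cube_avg_cong) (simp add: power2_eq_square power4_eq_xxxx field_simps)
  also have "\<dots> = cube_avg m (\<lambda>A. (signed_sum m a A) ^ 4) + (6 * (a m)\<^sup>2 * ?q + (a m) ^ 4)"
    by (simp add: cube_avg_add cube_avg_cmult cube_avg_signed_sum_sq)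
  also have "\<dots> \<le> 3 * ?q\<^sup>2 + (6 * (a m)\<^sup>2 * ?q + (a m) ^ 4)"
    using Suc.IH by simp
  also have "\<dots> \<le> 3 * (?q + (a m)\<^sup>2)\<^sup>2"
  proof -
    have "(a m) ^ 4 = ((a m)\<^sup>2)\<^sup>2" by simp
    then show ?thesis using zero_le_power2[of "(a m)\<^sup>2"]
      by (simp add: power2_sum algebra_simps del: zero_le_power2)
  qed
  finally show ?case by simp
qed

text \<open>Paley-Zygmund with the quadratic minorant \<open>2/5 (u - 1/2) - u^2/30\<close> of the indicator of \<open>u \<ge> 1/2\<close>,
  where u is the square of the normalised signed sum.\<close>

lemma signed_sum_anticoncentration:
  assumes q: "0 < q" "q \<le> (\<Sum>k<m. (a k)\<^sup>2)"
  shows "cube_avg m (\<lambda>A. of_bool (q / 2 \<le> (signed_sum m a A)\<^sup>2)) \<ge> 1/10"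
proof -
  define Q where "Q = (\<Sum>k<m. (a k)\<^sup>2)"
  have Q: "Q > 0" using q by (simp add: Q_def)
  define h where "h A = (2 / (5 * Q)) * (signed_sum m a A)\<^sup>2 + (- 1/5) + (- 1 / (30 * Q\<^sup>2)) * (signed_sum m a A) ^ 4" for A
  have "h A \<le> of_bool (q / 2 \<le> (signed_sum m a A)\<^sup>2)" for A
  proof -
    define u where "u = (signed_sum m a A)\<^sup>2 / Q"
    have u0: "u \<ge> 0" using Q by (simp add: u_def)
    have hu: "h A = 2/5 * u - 1/5 - u\<^sup>2 / 30"
      using Q by (simp add: h_def u_def power2_eq_square power4_eq_xxxx field_simps)
    show ?thesis
    proof (cases "q / 2 \<le> (signed_sum m a A)\<^sup>2")
      case True
      then show ?thesis
        \<comment> \<open>\<open>1 - (2/5 * u - 1/5 - u^2 / 30) = (u - 6)^2 / 30\<close>, so the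
          minorant never exceeds 1.\<close>
        using zero_le_power2[of "u - 6"] unfolding hu by (simp add: power2_eq_square algebra_simps)
    next
      case False
      then have "(signed_sum m a A)\<^sup>2 < Q / 2" using q by (simp add: Q_def)
      then have "u < 1/2" using Q by (simp add: u_def field_simps)
      then have "h A \<le> 0" using zero_le_power2[of u] unfolding hu by linarith
      then show ?thesis by (smt (verit) of_bool_eq_0_iff of_bool_eq_1_iff)
    qed
  qed
  then have "cube_avg m h \<le> cube_avg m (\<lambda>A. of_bool (q / 2 \<le> (signed_sum m a A)\<^sup>2))"
    by (rule cube_avg_mono)
  moreover have "cube_avg m h = 2/5 - 1/5 - cube_avg m (\<lambda>A. (signed_sum m a A) ^ 4) / (30 * Q\<^sup>2)"
    unfolding h_def cube_avg_add cube_avg_cmult cube_avg_signed_sum_sq Q_def[symmetric] using Q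
    by (simp add: field_simps)
  moreover have "cube_avg m (\<lambda>A. (signed_sum m a A) ^ 4) / (30 * Q\<^sup>2) \<le> 1/10"
    using cube_avg_signed_sum_pow4[of m a] Q by (simp add: Q_def[symmetric] field_simps)
  ultimately show ?thesis by linarith
qed

text \<open>Cauchy-Schwarz against a sign vector of squared length \<open>m\<close>. This crude
  bound finally stops the growth of the reach, and through it the dimension enters the approximation
  ratio.\<close>

lemma signed_sum_le:
  assumes "(\<Sum>k<m. (a k)\<^sup>2) \<le> r"
  shows "signed_sum m a A \<le> sqrt (r * real m)"
proof -
  have "(signed_sum m a A)\<^sup>2 \<le> (\<Sum>k<m. (sg A k)\<^sup>2) * (\<Sum>k<m. (a k)\<^sup>2)"
    unfolding signed_sum_def by (rule Cauchy_Schwarz_ineq_sum)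
  also have "(\<Sum>k<m. (sg A k)\<^sup>2) = real m"
    by simp
  finally have "(signed_sum m a A)\<^sup>2 \<le> r * real m"
    using mult_left_mono[OF assms, of "real m"] by (simp add: mult.commute)
  then show ?thesis by (rule real_le_rsqrt)
qed

lemma sg_flip: "sg (flip k A) i = (if i = k then - sg A i else sg A i)"
  by (cases "k \<in> A"; cases "i = k") (simp_all add: sg_def flip_def)

lemma signed_sum_flip:
  assumes "k < m"
  shows "signed_sum m a (flip k A) = signed_sum m a A - 2 * sg A k * a k"
proof -
  have "signed_sum m a (flip k A) = (\<Sum>i<m. sg A i * a i - (if i = k then 2 * sg A k * a k else 0))"
    unfolding signed_sum_def by (rule sum.cong) (simp_all add: sg_flip)
  then show ?thesis
    using assms by (simp add: sum_subtractf signed_sum_def)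
qed

text \<open>A coordinate flip lowers a maximum of signed sums by at most twice the
  corresponding coefficient of a maximiser, so the Poincare inequality applies.\<close>

lemma cube_variance_Max:
  assumes Z: "finite Z" "Z \<noteq> {}" and r: "\<And>z. z \<in> Z \<Longrightarrow> (\<Sum>k<m. (a z k)\<^sup>2) \<le> r"
  defines "f \<equiv> \<lambda>A. Max ((\<lambda>z. signed_sum m (a z) A) ` Z)"
  shows "cube_avg m (\<lambda>A. (f A - cube_avg m f)\<^sup>2) \<le> 2 * r"
proof -
  let ?pp = "\<lambda>k A. (max 0 (f A - f (flip k A)))\<^sup>2"
  \<comment> \<open>Only a decrease of \<open>f\<close> under a flip is controlled by the maximiser.
    An increase at \<open>A\<close> is a decrease at \<open>flip k A\<close>, and flipping preserves
    the average; this is the source of the factor 2 in the conclusion.\<close>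
  have sq: "(f A - f (flip k A))\<^sup>2 = ?pp k A + ?pp k (flip k A)" for k A
    by (auto simp: max_def power2_commute)
  have pp: "(\<Sum>k<m. ?pp k A) \<le> 4 * r" for A
  proof -
    have "f A \<in> (\<lambda>z. signed_sum m (a z) A) ` Z"
      unfolding f_def using Z by (intro Max_in) auto
    then obtain z where z: "z \<in> Z" "f A = signed_sum m (a z) A" by auto
    have "?pp k A \<le> 4 * (a z k)\<^sup>2" if "k < m" for k
    proof -
      have "signed_sum m (a z) (flip k A) \<le> f (flip k A)"
        unfolding f_def using Z z by (intro Max_ge) auto
      then have "f A - f (flip k A) \<le> 2 * sg A k * a z k"
        using z signed_sum_flip[OF that, of "a z" A] by simp
      also have "\<dots> \<le> 2 * \<bar>a z k\<bar>" by (auto simp: sg_def)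
      finally have "max 0 (f A - f (flip k A)) \<le> 2 * \<bar>a z k\<bar>" by simp
      then have "?pp k A \<le> (2 * \<bar>a z k\<bar>)\<^sup>2" by (rule power_mono) simp
      then show ?thesis by simp
    qed
    then have "(\<Sum>k<m. ?pp k A) \<le> (\<Sum>k<m. 4 * (a z k)\<^sup>2)"
      by (intro sum_mono) auto
    also have "\<dots> \<le> 4 * r" using r[OF z(1)] by (simp add: sum_distrib_left[symmetric])
    finally show ?thesis .
  qed
  have "(\<Sum>k<m. cube_avg m (\<lambda>A. (f A - f (flip k A))\<^sup>2)) = (\<Sum>k<m. 2 * cube_avg m (?pp k))"
  proof (rule sum.cong)
    fix k assume "k \<in> {..<m}"
    then have "cube_avg m (\<lambda>A. ?pp k (flip k A)) = cube_avg m (?pp k)"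
      by (intro cube_avg_flip) auto
    then show "cube_avg m (\<lambda>A. (f A - f (flip k A))\<^sup>2) = 2 * cube_avg m (?pp k)"
      unfolding sq cube_avg_add by simp
  qed simp
  also have "\<dots> = 2 * cube_avg m (\<lambda>A. \<Sum>k<m. ?pp k A)"
    by (simp add: cube_avg_sum sum_distrib_left)
  also have "cube_avg m (\<lambda>A. \<Sum>k<m. ?pp k A) \<le> cube_avg m (\<lambda>_. 4 * r)"
    by (rule cube_avg_mono) (rule pp)
  finally have "cube_avg m (\<lambda>A. (f A)\<^sup>2) - (cube_avg m f)\<^sup>2 \<le> 2 * r"
    using cube_poincare[of m f] by simp
  moreover have "cube_avg m (\<lambda>A. (f A - cube_avg m f)\<^sup>2) = cube_avg m (\<lambda>A. (f A)\<^sup>2) - (cube_avg m f)\<^sup>2"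
  proof -
    have "cube_avg m (\<lambda>A. (f A - cube_avg m f)\<^sup>2) =
        cube_avg m (\<lambda>A. (f A)\<^sup>2 + ((- 2 * cube_avg m f) * f A + (cube_avg m f)\<^sup>2))"
      by (rule cube_avg_cong) (simp add: power2_eq_square algebra_simps)
    also have "\<dots> = cube_avg m (\<lambda>A. (f A)\<^sup>2) + (- 2 * cube_avg m f * cube_avg m f + (cube_avg m f)\<^sup>2)"
      unfolding cube_avg_add cube_avg_cmult cube_avg_const ..
    finally show ?thesis by (simp add: power2_eq_square)
  qed
  ultimately show ?thesis by simp
qed

lemma cube_chebyshev:
  assumes "cube_avg m (\<lambda>A. (f A - c)\<^sup>2) \<le> v" "0 < t"
  shows "cube_avg m (\<lambda>A. of_bool (t \<le> \<bar>f A - c\<bar>)) \<le> v / t\<^sup>2"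
proof -
  have "cube_avg m (\<lambda>A. of_bool (t \<le> \<bar>f A - c\<bar>)) \<le> cube_avg m (\<lambda>A. 1 / t\<^sup>2 * (f A - c)\<^sup>2)"
  proof (rule cube_avg_mono)
    fix A
    have "t\<^sup>2 \<le> (f A - c)\<^sup>2" if "t \<le> \<bar>f A - c\<bar>"
      using assms(2) power_mono[OF that, of 2] by simp
    then show "of_bool (t \<le> \<bar>f A - c\<bar>) \<le> 1 / t\<^sup>2 * (f A - c)\<^sup>2"
      using assms(2) by (auto simp: field_simps)
  qed
  also have "\<dots> \<le> v / t\<^sup>2"
    unfolding cube_avg_cmult using assms by (simp add: divide_right_mono)
  finally show ?thesis .
qed

section \<open>Well-spread sets in a measured metric space\<close>

text \<open>To be instantiated with the vertices, their measure divided by its total, and the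
  squared distance scaled to average 1. Distinct points may have distance 0.\<close>

locale metric_probability =
  fixes V :: "'a set" and W :: "'a \<Rightarrow> real" and d :: "'a \<Rightarrow> 'a \<Rightarrow> real"
  assumes fin: "finite V"
    and W_nonneg: "\<And>x. x \<in> V \<Longrightarrow> 0 \<le> W x"
    and W_sum: "sum W V = 1"
    and d_nonneg: "\<And>x y. x \<in> V \<Longrightarrow> y \<in> V \<Longrightarrow> 0 \<le> d x y"
    and d_refl: "\<And>x. x \<in> V \<Longrightarrow> d x x = 0"
    and d_sym: "\<And>x y. x \<in> V \<Longrightarrow> y \<in> V \<Longrightarrow> d x y = d y x"
    and d_triangle: "\<And>x y z. x \<in> V \<Longrightarrow> y \<in> V \<Longrightarrow> z \<in> V \<Longrightarrow> d x z \<le> d x y + d y z"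
begin

definition mass :: "('a \<Rightarrow> bool) \<Rightarrow> real" where
  "mass P = (\<Sum>x\<in>V. W x * of_bool (P x))"

definition avg2 :: "('a \<Rightarrow> 'a \<Rightarrow> real) \<Rightarrow> real" where
  "avg2 f = (\<Sum>x\<in>V. \<Sum>y\<in>V. W x * W y * f x y)"

definition setdist :: "'a set \<Rightarrow> 'a \<Rightarrow> real" where
  "setdist A x = Min (d x ` A)"

lemma mass_mono: "(\<And>x. x \<in> V \<Longrightarrow> P x \<Longrightarrow> Q x) \<Longrightarrow> mass P \<le> mass Q"
  unfolding mass_def by (intro sum_mono mult_left_mono) (auto simp: W_nonneg)

lemma mass_nonneg: "0 \<le> mass P"
  unfolding mass_def by (intro sum_nonneg mult_nonneg_nonneg) (auto simp: W_nonneg)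

lemma mass_neg: "mass (\<lambda>x. \<not> P x) = 1 - mass P"
proof -
  have "mass (\<lambda>x. \<not> P x) + mass P = (\<Sum>x\<in>V. W x)"
    unfolding mass_def sum.distrib[symmetric] by (rule sum.cong) auto
  then show ?thesis using W_sum by simp
qed

lemma mass_Un: "mass (\<lambda>x. P x \<or> Q x) \<le> mass P + mass Q"
  unfolding mass_def sum.distrib[symmetric] by (intro sum_mono) (auto simp: W_nonneg)

lemma mass_pos_ex: "0 < mass P \<Longrightarrow> \<exists>x\<in>V. P x"
  unfolding mass_def by (rule ccontr) (simp add: sum.neutral)

lemma mass_Int: "mass P + mass Q - 1 \<le> mass (\<lambda>x. P x \<and> Q x)"
  using mass_Un[of "\<lambda>x. \<not> P x" "\<lambda>x. \<not> Q x"] mass_neg[of P] mass_neg[of Q]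
    mass_neg[of "\<lambda>x. P x \<and> Q x"] by simp

lemma mass_markov:
  assumes "0 < t" "\<And>x. x \<in> V \<Longrightarrow> 0 \<le> f x"
  shows "mass (\<lambda>x. t \<le> f x) \<le> (\<Sum>x\<in>V. W x * f x) / t"
proof -
  have "mass (\<lambda>x. t \<le> f x) \<le> (\<Sum>x\<in>V. W x * (f x / t))"
    unfolding mass_def using assms by (intro sum_mono mult_left_mono) (auto simp: W_nonneg)
  then show ?thesis by (simp add: sum_divide_distrib)
qed

lemma avg2_mono:
  "(\<And>x y. x \<in> V \<Longrightarrow> y \<in> V \<Longrightarrow> f x y \<le> g x y) \<Longrightarrow> avg2 f \<le> avg2 g"
  unfolding avg2_def by (intro sum_mono mult_left_mono) (auto simp: W_nonneg)

lemma avg2_add: "avg2 (\<lambda>x y. f x y + g x y) = avg2 f + avg2 g"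
  by (simp add: avg2_def sum.distrib distrib_left)

lemma avg2_cmult: "avg2 (\<lambda>x y. c * f x y) = c * avg2 f"
  by (simp add: avg2_def sum_distrib_left mult_ac)

lemma avg2_swap: "avg2 (\<lambda>x y. f y x) = avg2 f"
  unfolding avg2_def by (subst sum.swap) (simp add: mult_ac)

lemma avg2_fst: "avg2 (\<lambda>x y. f x) = (\<Sum>x\<in>V. W x * f x)"
proof -
  have "avg2 (\<lambda>x y. f x) = (\<Sum>x\<in>V. W x * f x * (\<Sum>y\<in>V. W y))"
    by (simp add: avg2_def sum_distrib_left mult_ac)
  then show ?thesis using W_sum by simp
qed

lemma avg2_snd: "avg2 (\<lambda>x y. f y) = (\<Sum>x\<in>V. W x * f x)"
  using avg2_swap[of "\<lambda>x y. f x"] avg2_fst[of f] by simp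

lemma avg2_inner: "avg2 f = (\<Sum>x\<in>V. W x * (\<Sum>y\<in>V. W y * f x y))"
  by (simp add: avg2_def sum_distrib_left mult_ac)

lemma setdist_nonneg: "A \<subseteq> V \<Longrightarrow> A \<noteq> {} \<Longrightarrow> x \<in> V \<Longrightarrow> 0 \<le> setdist A x"
  unfolding setdist_def using finite_subset[OF _ fin] d_nonneg by (subst Min_ge_iff) auto

lemma setdist_zero: "A \<subseteq> V \<Longrightarrow> x \<in> A \<Longrightarrow> setdist A x = 0"
proof (rule antisym)
  assume A: "A \<subseteq> V" "x \<in> A"
  then show "setdist A x \<le> 0"
    unfolding setdist_def using finite_subset[OF _ fin, of A] d_refl[of x]
    by (intro Min_le) (auto simp: image_iff intro!: bexI[of _ x])
  show "0 \<le> setdist A x" using A by (intro setdist_nonneg) auto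
qed

lemma setdist_le_iff:
  "A \<subseteq> V \<Longrightarrow> A \<noteq> {} \<Longrightarrow> setdist A x \<le> t \<longleftrightarrow> (\<exists>y\<in>A. d x y \<le> t)"
  unfolding setdist_def using finite_subset[OF _ fin, of A] by (subst Min_le_iff) auto

lemma setdist_lipschitz:
  assumes "A \<subseteq> V" "A \<noteq> {}" "x \<in> V" "y \<in> V"
  shows "setdist A x \<le> setdist A y + d x y"
proof -
  obtain z where z: "z \<in> A" "d y z \<le> setdist A y"
    using setdist_le_iff[OF assms(1,2), of y "setdist A y"] by auto
  have "d x z \<le> setdist A y + d x y"
    using d_triangle[of x y z] z assms by auto
  then show ?thesis using setdist_le_iff[OF assms(1,2)] z by blast
qed

text \<open>The distance from \<open>A\<close> vanishes on \<open>A\<close>, so the average spread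
  is at least the mass of \<open>A\<close> times the mean distance from \<open>A\<close>. A small
  spread makes that mean at most \<open>\<eta> * \<Delta>\<close>, and Markov's inequality leaves
  mass at most \<open>\<eta>\<close> beyond \<open>\<Delta>\<close>.\<close>

lemma expands_of_small_spread:
  assumes A: "A \<subseteq> V" "\<eta> \<le> mass (\<lambda>x. x \<in> A)" and pos: "0 < \<eta>" "0 < \<Delta>"
    and small: "avg2 (\<lambda>x y. \<bar>setdist A x - setdist A y\<bar>) \<le> \<eta>\<^sup>2 * \<Delta>"
  shows "1 - \<eta> \<le> mass (\<lambda>x. \<exists>y\<in>A. d x y \<le> \<Delta>)"
proof -
  have ne: "A \<noteq> {}" using A pos mass_pos_ex[of "\<lambda>x. x \<in> A"] by auto
  let ?f = "setdist A"
  have "mass (\<lambda>x. x \<in> A) * (\<Sum>y\<in>V. W y * ?f y) = avg2 (\<lambda>x y. of_bool (x \<in> A) * ?f y)"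
    by (simp add: avg2_def mass_def sum_product mult_ac)
  also have "\<dots> \<le> avg2 (\<lambda>x y. \<bar>?f x - ?f y\<bar>)"
    by (rule avg2_mono) (auto simp: setdist_zero[OF A(1)])
  finally have 1: "mass (\<lambda>x. x \<in> A) * (\<Sum>y\<in>V. W y * ?f y) \<le> \<eta>\<^sup>2 * \<Delta>" using small by simp
  have nn: "0 \<le> (\<Sum>y\<in>V. W y * ?f y)"
    by (intro sum_nonneg mult_nonneg_nonneg) (auto simp: W_nonneg setdist_nonneg[OF A(1) ne])
  have "\<eta> * (\<Sum>y\<in>V. W y * ?f y) \<le> \<eta> * (\<eta> * \<Delta>)"
    using 1 mult_right_mono[OF A(2) nn] by (simp add: power2_eq_square)
  then have 2: "(\<Sum>y\<in>V. W y * ?f y) \<le> \<eta> * \<Delta>" using pos by simp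
  have "mass (\<lambda>x. \<not> (\<exists>y\<in>A. d x y \<le> \<Delta>)) \<le> mass (\<lambda>x. \<Delta> \<le> ?f x)"
  proof (rule mass_mono)
    fix x assume "x \<in> V" "\<not> (\<exists>y\<in>A. d x y \<le> \<Delta>)"
    then show "\<Delta> \<le> ?f x" using setdist_le_iff[OF A(1) ne, of x \<Delta>] by auto
  qed
  also have "\<dots> \<le> (\<Sum>y\<in>V. W y * ?f y) / \<Delta>"
    by (rule mass_markov) (auto simp: pos setdist_nonneg[OF A(1) ne])
  also have "\<dots> \<le> \<eta>" using 2 pos by (simp add: field_simps)
  finally show ?thesis unfolding mass_neg by linarith
qed

text \<open>The spread here is that of the seed \<open>{x}\<close>: distances from \<open>x\<close>
  cluster around their mean \<open>\<rho>\<close>, and \<open>\<rho>\<close> is at least 1/2 because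
  the average distance 1 is at most \<open>2 * \<rho>\<close> by the triangle inequality. This
  excludes that most of the mass sits close to one point.\<close>

lemma far_of_small_spread:
  assumes x: "x \<in> V" and avg: "avg2 d = 1"
    and small: "avg2 (\<lambda>y z. \<bar>d y x - d z x\<bar>) \<le> 1/8"
  shows "1/2 \<le> mass (\<lambda>y. 1/4 \<le> d x y)"
proof -
  define \<rho> where "\<rho> = (\<Sum>y\<in>V. W y * d y x)"
  have "avg2 d \<le> avg2 (\<lambda>y z. d y x + d z x)"
    by (rule avg2_mono) (use x d_triangle d_sym in \<open>metis\<close>)
  also have "\<dots> = 2 * \<rho>" unfolding avg2_add avg2_fst avg2_snd \<rho>_def by simp
  finally have \<rho>: "1/2 \<le> \<rho>" using avg by simp
  have "(\<Sum>y\<in>V. W y * \<bar>d y x - \<rho>\<bar>) \<le> avg2 (\<lambda>y z. \<bar>d y x - d z x\<bar>)"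
    unfolding avg2_inner
  proof (intro sum_mono mult_left_mono)
    fix y assume "y \<in> V"
    have "d y x - \<rho> = (\<Sum>z\<in>V. W z * (d y x - d z x))"
      by (simp add: right_diff_distrib sum_subtractf \<rho>_def sum_distrib_right[symmetric] W_sum)
    also have "\<bar>\<dots>\<bar> \<le> (\<Sum>z\<in>V. \<bar>W z * (d y x - d z x)\<bar>)" by (rule sum_abs)
    also have "\<dots> = (\<Sum>z\<in>V. W z * \<bar>d y x - d z x\<bar>)"
      by (rule sum.cong) (auto simp: abs_mult W_nonneg)
    finally show "\<bar>d y x - \<rho>\<bar> \<le> (\<Sum>z\<in>V. W z * \<bar>d y x - d z x\<bar>)" .
  qed (rule W_nonneg)
  then have "(\<Sum>y\<in>V. W y * \<bar>d y x - \<rho>\<bar>) \<le> 1/8" using small by simp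
  moreover have "mass (\<lambda>y. 1/4 \<le> \<bar>d y x - \<rho>\<bar>) \<le> (\<Sum>y\<in>V. W y * \<bar>d y x - \<rho>\<bar>) / (1/4)"
    by (rule mass_markov) auto
  moreover have "mass (\<lambda>y. \<not> 1/4 \<le> d x y) \<le> mass (\<lambda>y. 1/4 \<le> \<bar>d y x - \<rho>\<bar>)"
  proof (rule mass_mono)
    fix y assume "y \<in> V" "\<not> 1/4 \<le> d x y"
    then show "1/4 \<le> \<bar>d y x - \<rho>\<bar>" using \<rho> d_sym[OF x] by force
  qed
  ultimately show ?thesis by (simp add: mass_neg)
qed

text \<open>Turns a statement about pairs into one about a threshold. With \<open>b\<close> the
  largest value whose upper tail has mass at least \<open>c / 2\<close>, a pair with gap
  \<open>\<sigma>\<close> has \<open>p x > b\<close>, which has mass below \<open>c / 2\<close>, or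
  \<open>p y \<le> b - \<sigma>\<close>.\<close>

lemma gap_quantile:
  fixes p :: "'a \<Rightarrow> real"
  assumes c: "0 < c" "c \<le> avg2 (\<lambda>x y. of_bool (\<sigma> \<le> p x - p y))"
  shows "\<exists>b. c / 2 \<le> mass (\<lambda>x. b \<le> p x) \<and> c / 2 \<le> mass (\<lambda>x. p x \<le> b - \<sigma>)"
proof -
  define T where "T = {t \<in> p ` V. c / 2 \<le> mass (\<lambda>x. t \<le> p x)}"
  have "avg2 (\<lambda>x y. of_bool (\<sigma> \<le> p x - p y)) \<le> avg2 (\<lambda>x y. 1)"
    by (rule avg2_mono) simp
  also have "\<dots> = 1" using avg2_fst[of "\<lambda>_. 1"] W_sum by simp
  finally have c1: "c \<le> 1" using c by simp
  have Vne: "V \<noteq> {}" using W_sum by auto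
  have "Min (p ` V) \<in> T"
  proof -
    have "mass (\<lambda>x. Min (p ` V) \<le> p x) = (\<Sum>x\<in>V. W x)"
      unfolding mass_def using fin by (intro sum.cong) auto
    then show ?thesis using c1 fin Vne W_sum by (simp add: T_def)
  qed
  then have Tne: "T \<noteq> {}" by auto
  have Tfin: "finite T" using fin by (simp add: T_def)
  define b where "b = Max T"
  have bT: "b \<in> T" using Tne Tfin by (simp add: b_def)
  have above: "mass (\<lambda>x. b < p x) < c / 2"
  proof (cases "{x \<in> V. b < p x} = {}")
    case True
    then have "mass (\<lambda>x. b < p x) = 0" unfolding mass_def by (intro sum.neutral) auto
    then show ?thesis using c by simp
  next
    case False
    \<comment> \<open>If the strict upper tail had mass at least \<open>c / 2\<close>, the next
      larger value of \<open>p\<close> would belong to \<open>T\<close>, against the choice of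
      \<open>b\<close>.\<close>
    define b' where "b' = Min (p ` {x \<in> V. b < p x})"
    have b'in: "b' \<in> p ` {x \<in> V. b < p x}"
      unfolding b'_def using False fin by (intro Min_in) auto
    have b'le: "b' \<le> p x" if "x \<in> V" "b < p x" for x
      unfolding b'_def using that fin by (intro Min_le) auto
    show ?thesis
    proof (rule ccontr)
      assume "\<not> ?thesis"
      moreover have "mass (\<lambda>x. b < p x) \<le> mass (\<lambda>x. b' \<le> p x)"
        by (rule mass_mono) (rule b'le)
      ultimately have "b' \<in> T" using b'in by (auto simp: T_def)
      then have "b' \<le> b" unfolding b_def using Tfin by simp
      then show False using b'in by auto
    qed
  qed
  have "c \<le> avg2 (\<lambda>x y. of_bool (b < p x) + of_bool (p y \<le> b - \<sigma>))"
    by (rule order_trans[OF c(2)], rule avg2_mono) auto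
  also have "\<dots> = mass (\<lambda>x. b < p x) + mass (\<lambda>x. p x \<le> b - \<sigma>)"
    unfolding avg2_add avg2_fst avg2_snd mass_def ..
  finally have "c / 2 \<le> mass (\<lambda>x. p x \<le> b - \<sigma>)" using above by simp
  then show ?thesis using bT by (auto simp: T_def)
qed

end

section \<open>Chaining in an embedded metric\<close>

locale cube_embedding = metric_probability +
  fixes m :: nat and \<phi> :: "nat \<Rightarrow> 'a \<Rightarrow> real"
  assumes \<phi>_upper: "\<And>x y. x \<in> V \<Longrightarrow> y \<in> V \<Longrightarrow> (\<Sum>k<m. (\<phi> k x - \<phi> k y)\<^sup>2) \<le> d x y"
    and \<phi>_lower: "\<And>x y. x \<in> V \<Longrightarrow> y \<in> V \<Longrightarrow> d x y / 15 \<le> (\<Sum>k<m. (\<phi> k x - \<phi> k y)\<^sup>2)"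
begin

definition proj :: "nat set \<Rightarrow> 'a \<Rightarrow> real" where
  "proj A x = signed_sum m (\<lambda>k. \<phi> k x) A"

definition reach :: "real \<Rightarrow> 'a \<Rightarrow> nat set \<Rightarrow> real" where
  "reach r x A = Max ((\<lambda>z. signed_sum m (\<lambda>k. \<phi> k z - \<phi> k x) A) ` {z \<in> V. d x z \<le> r})"

definition mean_reach :: "real \<Rightarrow> 'a \<Rightarrow> real" where
  "mean_reach r x = cube_avg m (reach r x)"

lemma proj_diff: "signed_sum m (\<lambda>k. \<phi> k z - \<phi> k x) A = proj A z - proj A x"
  by (simp add: proj_def signed_sum_def right_diff_distrib sum_subtractf)

lemma reach_ge: "z \<in> V \<Longrightarrow> d x z \<le> r \<Longrightarrow> proj A z - proj A x \<le> reach r x A"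
  unfolding reach_def proj_diff[symmetric] using fin by (intro Max_ge) auto

lemma reach_attained:
  assumes "x \<in> V" "0 \<le> r"
  obtains z where "z \<in> V" "d x z \<le> r" "reach r x A = proj A z - proj A x"
proof -
  have "reach r x A \<in> (\<lambda>z. signed_sum m (\<lambda>k. \<phi> k z - \<phi> k x) A) ` {z \<in> V. d x z \<le> r}"
    unfolding reach_def using assms fin d_refl[of x] by (intro Max_in) auto
  then show ?thesis using that by (auto simp: proj_diff)
qed

text \<open>Moving the base point from \<open>x\<close> to \<open>y\<close> enlarges the radius by
  \<open>t\<close>, as \<open>d\<close> obeys the triangle inequality, and credits the increase of
  the projection from \<open>x\<close> to \<open>y\<close>.\<close>

lemma reach_shift:
  assumes "x \<in> V" "y \<in> V" "d x y \<le> t" "0 \<le> r"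
  shows "reach r y A + (proj A y - proj A x) \<le> reach (r + t) x A"
proof -
  obtain z where "z \<in> V" "d y z \<le> r" "reach r y A = proj A z - proj A y"
    using reach_attained assms by metis
  then show ?thesis
    using reach_ge[of z x "r + t" A] d_triangle[of x y z] assms by auto
qed

text \<open>The credit of \<open>reach_shift\<close> has mean zero over the cube, so the mean reach
  of a neighbour is inherited at the cost of radius only.\<close>

lemma mean_reach_shift:
  assumes "x \<in> V" "y \<in> V" "d x y \<le> t" "0 \<le> r"
  shows "mean_reach r y \<le> mean_reach (r + t) x"
proof -
  have "cube_avg m (\<lambda>A. reach r y A + signed_sum m (\<lambda>k. \<phi> k y - \<phi> k x) A) \<le> mean_reach (r + t) x"
    unfolding mean_reach_def proj_diff by (intro cube_avg_mono reach_shift assms)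
  then show ?thesis by (simp add: cube_avg_add cube_avg_signed_sum mean_reach_def)
qed

lemma mean_reach_nonneg: "x \<in> V \<Longrightarrow> 0 \<le> r \<Longrightarrow> 0 \<le> mean_reach r x"
  using cube_avg_mono[of m "\<lambda>_. 0" "reach r x"] reach_ge[of x x r] d_refl[of x]
  by (simp add: mean_reach_def)

lemma mean_reach_le:
  assumes "x \<in> V" "0 \<le> r"
  shows "mean_reach r x \<le> sqrt (r * real m)"
proof -
  have "reach r x A \<le> sqrt (r * real m)" for A
  proof -
    obtain z where z: "z \<in> V" "d x z \<le> r" "reach r x A = proj A z - proj A x"
      using reach_attained assms by metis
    then show ?thesis
      unfolding z(3) proj_diff[symmetric] using \<phi>_upper[of z x] d_sym[of z x] assms
      by (intro signed_sum_le) auto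
  qed
  then show ?thesis
    using cube_avg_mono[of m "reach r x" "\<lambda>_. sqrt (r * real m)"] by (simp add: mean_reach_def)
qed

text \<open>Every competitor in the maximum has coefficients of square sum at most \<open>r\<close>,
  hence the maximum has variance at most \<open>2 * r\<close>, whatever the number of
  competitors.\<close>

lemma reach_concentration:
  assumes "x \<in> V" "0 \<le> r" "0 < t"
  shows "cube_avg m (\<lambda>A. of_bool (t \<le> \<bar>reach r x A - mean_reach r x\<bar>)) \<le> 2 * r / t\<^sup>2"
proof (rule cube_chebyshev)
  have "{z \<in> V. d x z \<le> r} \<noteq> {}" using assms d_refl[of x] by auto
  then show "cube_avg m (\<lambda>A. (reach r x A - mean_reach r x)\<^sup>2) \<le> 2 * r"
    unfolding mean_reach_def reach_def[abs_def]
  proof (intro cube_variance_Max)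
    fix z assume z: "z \<in> {z \<in> V. d x z \<le> r}"
    then show "(\<Sum>k<m. (\<phi> k z - \<phi> k x)\<^sup>2) \<le> r"
      using \<phi>_upper[of z x] d_sym[of z x] assms(1) by auto
  qed (use fin in auto)
qed (rule assms(3))

text \<open>Origin of the constants: distance 1/4 leaves embedded squared length 1/60;
  anticoncentration then gives a squared difference of at least 1/120, hence a difference of at
  least 1/11, with probability 1/10; at least half of the pairs are far, so the mean mass of
  separated pairs is at least 1/20, and 1/40 once the order within the pair is fixed.\<close>

lemma many_gaps:
  assumes far: "\<And>x. x \<in> V \<Longrightarrow> 1/2 \<le> mass (\<lambda>y. 1/4 \<le> d x y)"
  shows "1/80 \<le> cube_avg m (\<lambda>A. of_bool (1/80 \<le> avg2 (\<lambda>x y. of_bool (1/11 \<le> proj A x - proj A y))))"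
proof -
  let ?F = "\<lambda>A. avg2 (\<lambda>x y. of_bool (1/11 \<le> proj A x - proj A y))"
  let ?S = "\<lambda>A x y. of_bool (1/11 \<le> \<bar>proj A x - proj A y\<bar>) :: real"
  have pair: "1/10 * of_bool (1/4 \<le> d x y) \<le> cube_avg m (\<lambda>A. ?S A x y)" if xy: "x \<in> V" "y \<in> V" for x y
  proof (cases "1/4 \<le> d x y")
    case True
    then have q: "1/60 \<le> (\<Sum>k<m. (\<phi> k x - \<phi> k y)\<^sup>2)" using \<phi>_lower[OF xy] by simp
    have "1/10 \<le> cube_avg m (\<lambda>A. of_bool (1/60/2 \<le> (signed_sum m (\<lambda>k. \<phi> k x - \<phi> k y) A)\<^sup>2))"
      by (rule signed_sum_anticoncentration) (use q in auto)
    also have "\<dots> \<le> cube_avg m (\<lambda>A. ?S A x y)"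
    proof (rule cube_avg_mono)
      fix A
      have "1/11 \<le> \<bar>u\<bar>" if "1/60/2 \<le> u\<^sup>2" for u :: real
      proof (rule ccontr)
        assume "\<not> ?thesis"
        then have "\<bar>u\<bar>\<^sup>2 \<le> (1/11)\<^sup>2" by (intro power_mono) auto
        then show False using that by (simp add: power2_eq_square)
      qed
      then show "of_bool (1/60/2 \<le> (signed_sum m (\<lambda>k. \<phi> k x - \<phi> k y) A)\<^sup>2) \<le> ?S A x y"
        by (auto simp: proj_diff)
    qed
    finally show ?thesis using True by simp
  next
    case False
    then show ?thesis using cube_avg_mono[of m "\<lambda>_. 0" "\<lambda>A. ?S A x y"] by simp
  qed
  have avg2_cube: "cube_avg m (\<lambda>A. avg2 (f A)) = avg2 (\<lambda>x y. cube_avg m (\<lambda>A. f A x y))" for f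
    by (simp add: avg2_def cube_avg_sum cube_avg_cmult)
  have "1/20 \<le> avg2 (\<lambda>x y. 1/10 * of_bool (1/4 \<le> d x y))"
  proof -
    have "(\<Sum>x\<in>V. W x * (1/2)) \<le> (\<Sum>x\<in>V. W x * mass (\<lambda>y. 1/4 \<le> d x y))"
      by (intro sum_mono mult_left_mono far W_nonneg)
    also have "(\<Sum>x\<in>V. W x * (1/2)) = 1/2"
      using W_sum by (simp add: sum_divide_distrib[symmetric])
    finally show ?thesis unfolding avg2_cmult unfolding avg2_inner mass_def by simp
  qed
  also have "\<dots> \<le> avg2 (\<lambda>x y. cube_avg m (\<lambda>A. ?S A x y))"
    by (rule avg2_mono) (rule pair)
  also have "\<dots> = cube_avg m (\<lambda>A. avg2 (\<lambda>x y. ?S A x y))"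
    by (simp add: avg2_cube)
  also have "\<dots> \<le> cube_avg m (\<lambda>A. 2 * ?F A)"
  proof (rule cube_avg_mono)
    fix A
    have "avg2 (\<lambda>x y. ?S A x y) \<le>
        avg2 (\<lambda>x y. of_bool (1/11 \<le> proj A x - proj A y) + of_bool (1/11 \<le> proj A y - proj A x))"
      by (rule avg2_mono) (auto simp: abs_if split: if_splits)
    also have "\<dots> = 2 * ?F A"
      unfolding avg2_add using avg2_swap[of "\<lambda>x y. of_bool (1/11 \<le> proj A x - proj A y)"] by simp
    finally show "avg2 (\<lambda>x y. ?S A x y) \<le> 2 * ?F A" .
  qed
  finally have F: "1/40 \<le> cube_avg m ?F" by (simp add: cube_avg_cmult)
  have F1: "?F A \<le> 1" for A
  proof -
    have "?F A \<le> avg2 (\<lambda>x y. 1)" by (rule avg2_mono) simp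
    then show ?thesis using avg2_fst[of "\<lambda>_. 1"] W_sum by simp
  qed
  \<comment> \<open>Reverse Markov inequality: a quantity bounded by 1 with mean at least 1/40 is at
    least 1/80 with probability at least 1/80.\<close>
  have "cube_avg m ?F \<le> cube_avg m (\<lambda>A. of_bool (1/80 \<le> ?F A) + 1/80)"
  proof (rule cube_avg_mono)
    fix A
    show "?F A \<le> of_bool (1/80 \<le> ?F A) + 1/80"
      using F1[of A] by (cases "1/80 \<le> ?F A") auto
  qed
  then show ?thesis using F by (simp add: cube_avg_add)
qed

text \<open>One chaining step: the expansion hypothesis is applied to a set of points that are both
  high in direction \<open>A\<close> and have large reach, and then to the set of points with large mean reach.
  Averaging over the cube moves from a point to a neighbour for free.\<close>

lemma chain_step:
  assumes gaps: "1/80 \<le> cube_avg m (\<lambda>A. of_bool (1/80 \<le> avg2 (\<lambda>x y. of_bool (1/11 \<le> proj A x - proj A y))))"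
    and expand1: "\<And>A b. A \<subseteq> {..<m} \<Longrightarrow>
        1/150000 \<le> mass (\<lambda>x. b \<le> proj A x \<and> a - 1/44 \<le> reach r x A) \<Longrightarrow>
        1 - 1/150000 \<le> mass (\<lambda>x. \<exists>y\<in>V. (b \<le> proj A y \<and> a - 1/44 \<le> reach r y A) \<and> d x y \<le> \<Delta>)"
    and expand2: "1/150000 \<le> mass (\<lambda>x. a + 1/22 \<le> mean_reach (r + \<Delta>) x) \<Longrightarrow>
        1 - 1/150000 \<le> mass (\<lambda>x. \<exists>y\<in>V. a + 1/22 \<le> mean_reach (r + \<Delta>) y \<and> d x y \<le> \<Delta>)"
    and r: "0 \<le> r" "0 \<le> \<Delta>" "r + \<Delta> \<le> 1 / 10 ^ 9"
    and prev: "1 - 1/150000 \<le> mass (\<lambda>x. a \<le> mean_reach r x)"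
  shows "1 - 1/150000 \<le> mass (\<lambda>x. a + 1/22 \<le> mean_reach (r + 2 * \<Delta>) x)"
proof -
  \<comment> \<open>The gap 1/11 is four units of 1/44. One unit is lost from mean reach to reach,
    one from reach back to mean reach, and two, that is 1/22, remain as progress.\<close>
  define good where "good A \<longleftrightarrow> 1/80 \<le> avg2 (\<lambda>x y. of_bool (1/11 \<le> proj A x - proj A y))" for A
  define \<beta> where "\<beta> A = mass (\<lambda>x. reach r x A < a - 1/44)" for A
  define H where "H A = mass (\<lambda>y. a + 3/44 \<le> reach (r + \<Delta>) y A)" for A
  define pr where "pr y = cube_avg m (\<lambda>A. of_bool (a + 3/44 \<le> reach (r + \<Delta>) y A))" for y
  have cube_mass: "cube_avg m (\<lambda>A. mass (P A)) = (\<Sum>x\<in>V. W x * cube_avg m (\<lambda>A. of_bool (P A x)))" for P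
    by (simp add: mass_def cube_avg_sum cube_avg_cmult)
  have "cube_avg m \<beta> \<le> cube_avg m (\<lambda>A. mass (\<lambda>x. \<not> a \<le> mean_reach r x) +
      mass (\<lambda>x. a \<le> mean_reach r x \<and> reach r x A < a - 1/44))"
    unfolding \<beta>_def
    by (intro cube_avg_mono order_trans[OF _ mass_Un] mass_mono) auto
  also have "\<dots> \<le> 1/150000 + 1/150000"
  proof -
    have "cube_avg m (\<lambda>A. mass (\<lambda>x. a \<le> mean_reach r x \<and> reach r x A < a - 1/44))
        \<le> (\<Sum>x\<in>V. W x * (1/150000))"
      unfolding cube_mass
    proof (intro sum_mono mult_left_mono W_nonneg)
      fix x assume x: "x \<in> V"
      have "cube_avg m (\<lambda>A. of_bool (a \<le> mean_reach r x \<and> reach r x A < a - 1/44)) \<le>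
          cube_avg m (\<lambda>A. of_bool (1/44 \<le> \<bar>reach r x A - mean_reach r x\<bar>))"
        by (rule cube_avg_mono) auto
      also have "\<dots> \<le> 2 * r / (1/44)\<^sup>2" by (rule reach_concentration) (use x r in auto)
      \<comment> \<open>Here the cap \<open>1 / 10^9\<close> on the radius is spent:
        \<open>2 * 44^2 / 10^9\<close> is below 1/150000 and, further down, below 1/102400.\<close>
      also have "\<dots> \<le> 1/150000" using r by (simp add: power2_eq_square)
      finally show "cube_avg m (\<lambda>A. of_bool (a \<le> mean_reach r x \<and> reach r x A < a - 1/44)) \<le> 1/150000" .
    qed
    then show ?thesis
      using prev W_sum by (simp add: cube_avg_add mass_neg sum_divide_distrib[symmetric])
  qed
  finally have \<beta>: "cube_avg m \<beta> \<le> 1/75000" by simp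
  \<comment> \<open>An affine lower bound that holds for every \<open>A\<close>, the left side being
    at most 0 in the bad cases, and can therefore be averaged over the cube. The quantile mass 1/160
    is halved to absorb \<open>\<beta> A\<close>.\<close>
  have H_ge: "1/320 * (of_bool (good A) - 320 * \<beta> A) \<le> H A" if A: "A \<subseteq> {..<m}" for A
  proof (cases "good A \<and> \<beta> A \<le> 1/320")
    case True
    then obtain b where b: "1/160 \<le> mass (\<lambda>x. b \<le> proj A x)" "1/160 \<le> mass (\<lambda>x. proj A x \<le> b - 1/11)"
      using gap_quantile[of "1/80" "1/11" "proj A"] by (auto simp: good_def)
    have "mass (\<lambda>x. b \<le> proj A x) \<le> mass (\<lambda>x. b \<le> proj A x \<and> a - 1/44 \<le> reach r x A) + \<beta> A"
      unfolding \<beta>_def by (intro order_trans[OF _ mass_Un] mass_mono) auto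
    then have "1/320 \<le> mass (\<lambda>x. b \<le> proj A x \<and> a - 1/44 \<le> reach r x A)"
      using b True by simp
    then have "1 - 1/150000 \<le> mass (\<lambda>x. \<exists>y\<in>V. (b \<le> proj A y \<and> a - 1/44 \<le> reach r y A) \<and> d x y \<le> \<Delta>)"
      by (intro expand1 A) simp
    then have "1/320 \<le> mass (\<lambda>x. proj A x \<le> b - 1/11 \<and>
        (\<exists>y\<in>V. (b \<le> proj A y \<and> a - 1/44 \<le> reach r y A) \<and> d x y \<le> \<Delta>))"
      using b mass_Int[of "\<lambda>x. proj A x \<le> b - 1/11"
        "\<lambda>x. \<exists>y\<in>V. (b \<le> proj A y \<and> a - 1/44 \<le> reach r y A) \<and> d x y \<le> \<Delta>"] by simp
    also have "\<dots> \<le> H A"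
      unfolding H_def
    proof (rule mass_mono)
      fix x assume x: "x \<in> V" "proj A x \<le> b - 1/11 \<and>
        (\<exists>y\<in>V. (b \<le> proj A y \<and> a - 1/44 \<le> reach r y A) \<and> d x y \<le> \<Delta>)"
      then obtain y where y: "y \<in> V" "b \<le> proj A y" "a - 1/44 \<le> reach r y A" "d x y \<le> \<Delta>"
        by auto
      have "reach r y A + (proj A y - proj A x) \<le> reach (r + \<Delta>) x A"
        by (rule reach_shift) (use x y r in auto)
      then show "a + 3/44 \<le> reach (r + \<Delta>) x A" using x(2) y by linarith
    qed
    finally have "1/320 \<le> H A" .
    moreover have "0 \<le> \<beta> A" unfolding \<beta>_def by (rule mass_nonneg)
    ultimately show ?thesis using True by simp
  next
    case False
    have "0 \<le> H A" "0 \<le> \<beta> A" unfolding H_def \<beta>_def by (rule mass_nonneg)+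
    then show ?thesis using False by (auto simp: not_le)
  qed
  \<comment> \<open>\<open>1/25600 - 1/75000\<close> exceeds \<open>1/102400 + 1/150000\<close>. The
    first summand on the right is the probability below which a point is ignored, the second the
    mass that \<open>expand2\<close> asks for.\<close>
  have "1/320 * (1/80 - 320 * (1/75000)) \<le>
      1/320 * (cube_avg m (\<lambda>A. of_bool (good A)) - 320 * cube_avg m \<beta>)"
    using gaps \<beta> unfolding good_def by simp
  also have "\<dots> = cube_avg m (\<lambda>A. 1/320 * (of_bool (good A) - 320 * \<beta> A))"
    unfolding cube_avg_cmult cube_avg_diff ..
  also have "\<dots> \<le> cube_avg m H" by (rule cube_avg_mono) (rule H_ge)
  also have "\<dots> = (\<Sum>y\<in>V. W y * pr y)"
    unfolding H_def cube_mass pr_def ..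
  also have "\<dots> \<le> (\<Sum>y\<in>V. W y * (1/102400 + of_bool (1/102400 \<le> pr y)))"
  proof (intro sum_mono mult_left_mono W_nonneg)
    fix y
    have "pr y \<le> 1" unfolding pr_def using cube_avg_mono[of m _ "\<lambda>_. 1"] by simp
    then show "pr y \<le> 1/102400 + of_bool (1/102400 \<le> pr y)" by auto
  qed
  also have "\<dots> = 1/102400 + mass (\<lambda>y. 1/102400 \<le> pr y)"
    using W_sum by (simp add: mass_def distrib_left sum.distrib sum_divide_distrib[symmetric])
  finally have "1/150000 \<le> mass (\<lambda>y. 1/102400 \<le> pr y)" by simp
  also have "\<dots> \<le> mass (\<lambda>x. a + 1/22 \<le> mean_reach (r + \<Delta>) x)"
  proof (rule mass_mono)
    fix y assume y: "y \<in> V" "1/102400 \<le> pr y"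
    show "a + 1/22 \<le> mean_reach (r + \<Delta>) y"
    proof (rule ccontr)
      \<comment> \<open>A reach of at least \<open>a + 3/44\<close> would then be a deviation of
        1/44 from the mean, with a probability too large for Chebyshev's inequality.\<close>
      assume neg: "\<not> ?thesis"
      have "pr y \<le> cube_avg m (\<lambda>A. of_bool (1/44 \<le> \<bar>reach (r + \<Delta>) y A - mean_reach (r + \<Delta>) y\<bar>))"
        unfolding pr_def by (rule cube_avg_mono) (use neg in auto)
      also have "\<dots> \<le> 2 * (r + \<Delta>) / (1/44)\<^sup>2" by (rule reach_concentration) (use y r in auto)
      also have "\<dots> < 1/102400" using r by (simp add: power2_eq_square)
      finally show False using y by simp
    qed
  qed
  finally have "1 - 1/150000 \<le> mass (\<lambda>x. \<exists>y\<in>V. a + 1/22 \<le> mean_reach (r + \<Delta>) y \<and> d x y \<le> \<Delta>)"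
    by (rule expand2)
  also have "\<dots> \<le> mass (\<lambda>x. a + 1/22 \<le> mean_reach (r + 2 * \<Delta>) x)"
  proof (rule mass_mono)
    fix x assume "x \<in> V" "\<exists>y\<in>V. a + 1/22 \<le> mean_reach (r + \<Delta>) y \<and> d x y \<le> \<Delta>"
    then obtain y where y: "y \<in> V" "a + 1/22 \<le> mean_reach (r + \<Delta>) y" "d x y \<le> \<Delta>" by auto
    have "mean_reach (r + \<Delta>) y \<le> mean_reach (r + \<Delta> + \<Delta>) x"
      by (rule mean_reach_shift) (use \<open>x \<in> V\<close> y r in auto)
    then show "a + 1/22 \<le> mean_reach (r + 2 * \<Delta>) x" using y by (simp add: add.assoc)
  qed
  finally show ?thesis .
qed

text \<open>The sets whose expansion the argument invokes: points for
  \<open>far_of_small_spread\<close>, and the two families of \<open>chain_step\<close>. As the list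
  depends only on the metric and the embedding, and not on the course of the argument, it can be
  searched.\<close>

definition seed :: "'a set \<Rightarrow> bool" where
  "seed A \<longleftrightarrow> (\<exists>x. A = {x}) \<or>
     (\<exists>C r a b. C \<subseteq> {..<m} \<and> 0 \<le> r \<and> A = {x \<in> V. b \<le> proj C x \<and> a \<le> reach r x C}) \<or>
     (\<exists>r a. 0 \<le> r \<and> A = {x \<in> V. a \<le> mean_reach r x})"

lemma seed_reach:
  "C \<subseteq> {..<m} \<Longrightarrow> 0 \<le> r \<Longrightarrow> seed {x \<in> V. b \<le> proj C x \<and> a \<le> reach r x C}"
  unfolding seed_def by blast

lemma seed_mean_reach: "0 \<le> r \<Longrightarrow> seed {x \<in> V. a \<le> mean_reach r x}"
  unfolding seed_def by blast

text \<open>Iterating the chaining step makes the mean reach grow linearly with the radius, whereas it is at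
  most \<open>sqrt (r * m)\<close>.\<close>

theorem large_spread_seed:
  assumes m: "0 < m" and avg: "avg2 d = 1"
    and \<kappa>: "\<kappa> * (10 ^ 22 * sqrt (real m)) \<le> 1"
  shows "\<exists>A\<subseteq>V. A \<noteq> {} \<and> \<kappa> \<le> avg2 (\<lambda>x y. \<bar>setdist A x - setdist A y\<bar>) \<and> seed A"
proof (rule ccontr)
  assume "\<not> ?thesis"
  then have none: "\<not> \<kappa> \<le> avg2 (\<lambda>x y. \<bar>setdist A x - setdist A y\<bar>)"
    if "A \<subseteq> V" "A \<noteq> {}" "seed A" for A
    using that by blast
  let ?\<eta> = "1/150000 :: real"
  \<comment> \<open>With \<open>10^10\<close> here, \<open>5 * sqrt m\<close> steps of radius
    \<open>2 * \<Delta>\<close> stay within \<open>1 / 10^9\<close>. The factor \<open>10^22\<close>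
    in the assumption on \<open>\<kappa>\<close> dominates
    \<open>150000^2 * 10^10 = 2.25 * 10^20\<close>.\<close>
  define \<Delta> where "\<Delta> = 1 / (10 ^ 10 * sqrt (real m))"
  have sm: "1 \<le> sqrt (real m)" using m by simp
  have \<Delta>0: "0 < \<Delta>" using sm by (simp add: \<Delta>_def)
  have \<kappa>\<Delta>: "\<kappa> \<le> ?\<eta>\<^sup>2 * \<Delta>"
  proof -
    have "\<kappa> \<le> 1 / (10 ^ 22 * sqrt (real m))" using \<kappa> sm by (simp add: field_simps)
    also have "\<dots> \<le> ?\<eta>\<^sup>2 * \<Delta>" using sm by (simp add: \<Delta>_def field_simps)
    finally show ?thesis .
  qed
  have "\<kappa> \<le> 1/8"
  proof -
    have "1 * 1 \<le> 10 ^ 10 * sqrt (real m)" using sm by (intro mult_mono) auto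
    then have "\<Delta> \<le> 1" unfolding \<Delta>_def by (subst divide_le_eq_1_pos) linarith+
    then show ?thesis using \<kappa>\<Delta> by (simp add: power2_eq_square)
  qed
  have "1/2 \<le> mass (\<lambda>y. 1/4 \<le> d x y)" if x: "x \<in> V" for x
  proof (rule far_of_small_spread[OF x avg])
    have setdist_single: "setdist {x} y = d y x" for y by (simp add: setdist_def)
    have "\<not> \<kappa> \<le> avg2 (\<lambda>y z. \<bar>setdist {x} y - setdist {x} z\<bar>)"
      using x by (intro none) (auto simp: seed_def)
    then have "\<not> \<kappa> \<le> avg2 (\<lambda>y z. \<bar>d y x - d z x\<bar>)"
      unfolding setdist_single .
    then show "avg2 (\<lambda>y z. \<bar>d y x - d z x\<bar>) \<le> 1/8" using \<open>\<kappa> \<le> 1/8\<close> by simp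
  qed
  then have gaps: "1/80 \<le> cube_avg m (\<lambda>A. of_bool (1/80 \<le> avg2 (\<lambda>x y. of_bool (1/11 \<le> proj A x - proj A y))))"
    by (rule many_gaps)
  have expand: "1 - ?\<eta> \<le> mass (\<lambda>x. \<exists>y\<in>V. P y \<and> d x y \<le> \<Delta>)"
    if P: "?\<eta> \<le> mass P" and seed: "seed {x \<in> V. P x}" for P
  proof -
    have ne: "{x \<in> V. P x} \<noteq> {}" using P mass_pos_ex[of P] by auto
    have mP: "mass (\<lambda>x. x \<in> {x \<in> V. P x}) = mass P"
      unfolding mass_def by (rule sum.cong) auto
    have "\<not> \<kappa> \<le> avg2 (\<lambda>x y. \<bar>setdist {x \<in> V. P x} x - setdist {x \<in> V. P x} y\<bar>)"
      using ne seed by (intro none) auto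
    then have "1 - ?\<eta> \<le> mass (\<lambda>x. \<exists>y\<in>{x \<in> V. P x}. d x y \<le> \<Delta>)"
      by (intro expands_of_small_spread) (use \<kappa>\<Delta> P mP \<Delta>0 in auto)
    also have "\<dots> \<le> mass (\<lambda>x. \<exists>y\<in>V. P y \<and> d x y \<le> \<Delta>)"
      by (rule mass_mono) auto
    finally show ?thesis .
  qed
  have grow: "1 - ?\<eta> \<le> mass (\<lambda>x. real k / 22 \<le> mean_reach (2 * real k * \<Delta>) x)"
    if "2 * real k * \<Delta> \<le> 1 / 10 ^ 9" for k
    using that
  proof (induction k)
    case 0
    have "mass (\<lambda>x. True) \<le> mass (\<lambda>x. 0 \<le> mean_reach 0 x)"
      by (rule mass_mono) (simp add: mean_reach_nonneg)
    then show ?case using mass_neg[of "\<lambda>x. False"] by (simp add: mass_def)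
  next
    case (Suc k)
    let ?r = "2 * real k * \<Delta>"
    have r: "0 \<le> ?r" "?r + 2 * \<Delta> \<le> 1 / 10 ^ 9" using \<Delta>0 Suc.prems by (auto simp: algebra_simps)
    have "1 - ?\<eta> \<le> mass (\<lambda>x. real k / 22 + 1/22 \<le> mean_reach (?r + 2 * \<Delta>) x)"
    proof (rule chain_step[OF gaps])
      fix A b assume "A \<subseteq> {..<m}"
        "1/150000 \<le> mass (\<lambda>x. b \<le> proj A x \<and> real k / 22 - 1/44 \<le> reach ?r x A)"
      then show "1 - 1/150000 \<le> mass (\<lambda>x. \<exists>y\<in>V. (b \<le> proj A y \<and> real k / 22 - 1/44 \<le> reach ?r y A) \<and> d x y \<le> \<Delta>)"
        using r(1) by (intro expand seed_reach)
    next
      assume "1/150000 \<le> mass (\<lambda>x. real k / 22 + 1/22 \<le> mean_reach (?r + \<Delta>) x)"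
      moreover have "0 \<le> ?r + \<Delta>" using r \<Delta>0 by simp
      ultimately show "1 - 1/150000 \<le> mass (\<lambda>x. \<exists>y\<in>V. real k / 22 + 1/22 \<le> mean_reach (?r + \<Delta>) y \<and> d x y \<le> \<Delta>)"
        by (intro expand seed_mean_reach)
    next
      show "1 - 1/150000 \<le> mass (\<lambda>x. real k / 22 \<le> mean_reach ?r x)"
        using Suc.IH r \<Delta>0 by simp
    qed (use r \<Delta>0 in auto)
    then show ?case by (simp add: algebra_simps add_divide_distrib)
  qed
  \<comment> \<open>\<open>K\<close> lies between 4 and 5 times \<open>sqrt m\<close>. After
    \<open>K\<close> steps the mean reach would be at least \<open>4/22 * sqrt m\<close> at some
    point, while the radius allows at most \<open>sqrt m / 10^4\<close>.\<close>
  define K where "K = nat \<lfloor>sqrt (real m) * 5\<rfloor>"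
  have K: "real K \<le> sqrt (real m) * 5" "sqrt (real m) * 5 < real K + 1"
    using sm by (simp_all add: K_def)
  have K4: "4 * sqrt (real m) \<le> real K" using K sm by linarith
  have rK: "2 * real K * \<Delta> \<le> 1 / 10 ^ 9"
    using K sm by (simp add: \<Delta>_def field_simps)
  have "0 < mass (\<lambda>x. real K / 22 \<le> mean_reach (2 * real K * \<Delta>) x)"
    using grow[OF rK] by simp
  then obtain x where x: "x \<in> V" "real K / 22 \<le> mean_reach (2 * real K * \<Delta>) x"
    using mass_pos_ex by blast
  have "real K / 22 \<le> sqrt (2 * real K * \<Delta> * real m)"
    using x mean_reach_le[of x "2 * real K * \<Delta>"] \<Delta>0 by simp
  also have "\<dots> \<le> sqrt (1 / 10 ^ 8 * real m)"
    using rK by (intro real_sqrt_le_mono mult_right_mono) auto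
  also have "\<dots> = sqrt (real m) / 10 ^ 4"
    by (simp add: real_sqrt_mult real_sqrt_divide)
  finally show False using K4 sm by simp
qed

end

section \<open>Sweep cuts\<close>

lemma sum_offdiag_pairs:
  fixes g :: "'a::linorder \<Rightarrow> 'a \<Rightarrow> real"
  assumes "finite V" "\<And>i. i \<in> V \<Longrightarrow> g i i = 0"
  shows "(\<Sum>i\<in>V. \<Sum>j\<in>V. g i j) = (\<Sum>(i, j)\<in>{(i, j). i \<in> V \<and> j \<in> V \<and> i < j}. g i j + g j i)"
proof -
  let ?L = "{(i, j). i \<in> V \<and> j \<in> V \<and> i < j}"
  let ?U = "{(i, j). i \<in> V \<and> j \<in> V \<and> j < i}"
  let ?D = "{(i, j). i \<in> V \<and> j \<in> V \<and> i = j}"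
  have fin: "finite ?L" "finite ?U" "finite ?D"
    by (rule finite_subset[of _ "V \<times> V"]; use assms in auto)+
  have split: "V \<times> V = (?L \<union> ?U) \<union> ?D" by auto
  have "(\<Sum>i\<in>V. \<Sum>j\<in>V. g i j) = (\<Sum>(i, j)\<in>(?L \<union> ?U) \<union> ?D. g i j)"
    unfolding sum.cartesian_product split ..
  also have "\<dots> = (\<Sum>(i, j)\<in>?L. g i j) + (\<Sum>(i, j)\<in>?U. g i j) + (\<Sum>(i, j)\<in>?D. g i j)"
    using fin by (subst sum.union_disjoint; (subst sum.union_disjoint)?; auto)
  also have "(\<Sum>(i, j)\<in>?D. g i j) = 0"
    by (rule sum.neutral) (auto simp: assms)
  also have "(\<Sum>(i, j)\<in>?U. g i j) = (\<Sum>(i, j)\<in>?L. g j i)"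
    by (rule sum.reindex_bij_witness[of _ "\<lambda>(i, j). (j, i)" "\<lambda>(i, j). (j, i)"]) auto
  finally show ?thesis by (simp add: sum.distrib split_def)
qed

text \<open>The level set runs through finitely many subsets of \<open>V\<close>, so the function is
  a finite combination of indicators of the parameter sets on which the level set is a given
  \<open>A\<close>.\<close>

lemma borel_measurable_set_step:
  fixes H :: "'a set \<Rightarrow> real"
  assumes "finite V" "\<And>i. i \<in> V \<Longrightarrow> {t. P i t} \<in> sets (borel :: real measure)"
  shows "(\<lambda>t. H {i \<in> V. P i t}) \<in> borel_measurable borel"
proof -
  have eq: "H {i \<in> V. P i t} = (\<Sum>A\<in>Pow V. H A * indicator {t. \<forall>i\<in>V. P i t \<longleftrightarrow> i \<in> A} t)" for t
  proof -
    have "(\<Sum>A\<in>Pow V. H A * indicator {t. \<forall>i\<in>V. P i t \<longleftrightarrow> i \<in> A} t) =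
        (\<Sum>A\<in>Pow V. if A = {i \<in> V. P i t} then H A else 0)"
      by (rule sum.cong) (auto simp: indicator_def)
    also have "\<dots> = H {i \<in> V. P i t}"
      using assms(1) by (subst sum.delta) auto
    finally show ?thesis by simp
  qed
  have "{t. \<forall>i\<in>V. P i t \<longleftrightarrow> i \<in> A} \<in> sets (borel :: real measure)" for A
  proof -
    have "{t. \<forall>i\<in>V. P i t \<longleftrightarrow> i \<in> A} = (\<Inter>i\<in>V. if i \<in> A then {t. P i t} else - {t. P i t})"
      by auto
    also have "\<dots> \<in> sets borel"
    proof (cases "V = {}")
      case False
      then show ?thesis using assms by (intro sets.finite_INT) auto
    qed simp
    finally show ?thesis .
  qed
  then show ?thesis unfolding eq by measurable
qed

lemma integrable_bounded_support:
  fixes g :: "real \<Rightarrow> real"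
  assumes "g \<in> borel_measurable borel" "\<And>t. \<bar>g t\<bar> \<le> C" "\<And>t. t < a \<or> b < t \<Longrightarrow> g t = 0"
  shows "integrable lborel g"
proof (rule Bochner_Integration.integrable_bound[of lborel "\<lambda>t. C * indicator {a..b} t"])
  show "integrable lborel (\<lambda>t. C * indicator {a..b} t)"
    by (intro integrable_mult_right integrable_real_indicator) (auto simp: emeasure_lborel_Icc_eq)
  show "AE t in lborel. norm (g t) \<le> norm (C * indicator {a..b} t)"
  proof (rule AE_I2)
    fix t
    show "norm (g t) \<le> norm (C * indicator {a..b} t)"
      using assms(2)[of t] assms(3)[of t] by (cases "t \<in> {a..b}") auto
  qed
qed (use assms(1) in simp)

lemma set_step_finite_range:
  fixes H :: "'a set \<Rightarrow> real"
  assumes "finite V"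
  obtains C where "\<And>S. S \<subseteq> V \<Longrightarrow> \<bar>H S\<bar> \<le> C"
proof -
  have "\<bar>H S\<bar> \<le> Max ((\<lambda>S. \<bar>H S\<bar>) ` Pow V)" if "S \<subseteq> V" for S
    using assms that by (intro Max_ge) auto
  then show ?thesis by (rule that)
qed

text \<open>For \<open>t \<le> 0\<close> the level set of an absolute value is all of
  \<open>h\<close>, so the second integral of the Lovasz extension vanishes.\<close>

lemma F_norm_eq_integral:
  "F_norm h F x = (\<integral>t. indicator {0<..} t * F {i \<in> h. t \<le> \<bar>x i\<bar>} \<partial>lborel)"
proof -
  have "(LBINT t:{..0}. F {i \<in> h. \<bar>x i\<bar> \<ge> t} - F h) = (LBINT t:{..0::real}. (0::real))"
  proof (rule set_lebesgue_integral_cong)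
    show "\<forall>t. t \<in> {..0} \<longrightarrow> F {i \<in> h. \<bar>x i\<bar> \<ge> t} - F h = 0"
    proof safe
      fix t :: real assume "t \<le> 0"
      then have "{i \<in> h. \<bar>x i\<bar> \<ge> t} = h" using order_trans by fastforce
      then show "F {i \<in> h. \<bar>x i\<bar> \<ge> t} - F h = 0" by simp
    qed
  qed simp
  also have "\<dots> = 0" by (simp add: set_lebesgue_integral_def)
  finally show ?thesis by (simp add: F_norm_def lovasz_ext_def set_lebesgue_integral_def)
qed

section \<open>Level sets within one hyperedge\<close>

locale cut_function_edge =
  fixes h :: "'a set" and F :: "'a set \<Rightarrow> real"
  assumes fin_h: "finite h" and F_mono: "nondecreasing_on h F" and F_empty: "F {} = 0"
begin

lemma F_le: "A \<subseteq> B \<Longrightarrow> B \<subseteq> h \<Longrightarrow> F A \<le> F B"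
  using F_mono by (auto simp: nondecreasing_on_def)

lemma F_nonneg: "A \<subseteq> h \<Longrightarrow> 0 \<le> F A"
  using F_le[of "{}" A] F_empty by simp

text \<open>The integrand of the norm, extended by zero to the whole line so that it can be
  translated and reflected.\<close>

definition tail :: "('a \<Rightarrow> real) \<Rightarrow> real \<Rightarrow> real" where
  "tail x t = indicator {0<..} t * F {i \<in> h. t \<le> \<bar>x i\<bar>}"

lemma tail_nonneg: "0 \<le> tail x t"
  unfolding tail_def by (intro mult_nonneg_nonneg F_nonneg) auto

lemma integral_tail: "(\<integral>t. tail x t \<partial>lborel) = F_norm h F x"
  unfolding tail_def F_norm_eq_integral ..

lemma integrable_tail: "integrable lborel (tail x)"
proof -
  define b where "b = (\<Sum>i\<in>h. \<bar>x i\<bar>)"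
  have xb: "\<bar>x i\<bar> \<le> b" if "i \<in> h" for i
    unfolding b_def using fin_h that by (intro member_le_sum) auto
  show ?thesis
  proof (rule integrable_bounded_support[where C = "F h" and a = 0 and b = b])
    have "(\<lambda>t. F {i \<in> h. t \<le> \<bar>x i\<bar>}) \<in> borel_measurable borel"
      by (rule borel_measurable_set_step[OF fin_h]) simp
    then show "tail x \<in> borel_measurable borel"
      unfolding tail_def[abs_def] by measurable
    show "\<bar>tail x t\<bar> \<le> F h" for t
      using F_le[of "{i \<in> h. t \<le> \<bar>x i\<bar>}" h] F_nonneg[of "{i \<in> h. t \<le> \<bar>x i\<bar>}"] F_nonneg[of h]
      by (auto simp: tail_def indicator_def)
    show "tail x t = 0" if "t < 0 \<or> b < t" for t
    proof (cases "b < t")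
      case True
      then have "{i \<in> h. t \<le> \<bar>x i\<bar>} = {}" using xb by force
      then show ?thesis by (simp add: tail_def F_empty del: Collect_empty_eq)
    qed (use that in \<open>auto simp: tail_def\<close>)
  qed
qed

text \<open>The intervals around \<open>f i\<close> of radius \<open>x i\<close> intersect pairwise, hence have a common point \<open>c\<close>;
  a level set below \<open>c\<close>, or the complement of one above \<open>c\<close>, consists of vertices with large \<open>x i\<close>.\<close>

lemma integral_level_cut_le:
  assumes f: "\<And>i j. i \<in> h \<Longrightarrow> j \<in> h \<Longrightarrow> f i - f j \<le> \<bar>x i\<bar> + \<bar>x j\<bar>"
  defines "lcut \<equiv> \<lambda>t. min (F {i \<in> h. f i \<le> t}) (F {i \<in> h. \<not> f i \<le> t})"
  shows "integrable lborel lcut" "(\<integral>t. lcut t \<partial>lborel) \<le> 2 * F_norm h F x"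
proof -
  \<comment> \<open>Helly's theorem on the line: the largest left endpoint lies in all intervals.
    The empty hyperedge has no such endpoint and is treated apart.\<close>
  obtain c where c: "\<And>i. i \<in> h \<Longrightarrow> f i - \<bar>x i\<bar> \<le> c" "\<And>i. i \<in> h \<Longrightarrow> c \<le> f i + \<bar>x i\<bar>"
  proof (cases "h = {}")
    case True
    then show ?thesis using that by auto
  next
    case False
    show ?thesis
    proof (rule that[of "Max ((\<lambda>i. f i - \<bar>x i\<bar>) ` h)"])
      fix i assume i: "i \<in> h"
      then show "f i - \<bar>x i\<bar> \<le> Max ((\<lambda>i. f i - \<bar>x i\<bar>) ` h)" using fin_h by simp
      have "f j - \<bar>x j\<bar> \<le> f i + \<bar>x i\<bar>" if "j \<in> h" for j using f[OF that i] by linarith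
      then show "Max ((\<lambda>i. f i - \<bar>x i\<bar>) ` h) \<le> f i + \<bar>x i\<bar>" using fin_h False by simp
    qed
  qed
  define B where "B = \<bar>c\<bar> + (\<Sum>i\<in>h. \<bar>f i\<bar>)"
  have fB: "\<bar>f i\<bar> \<le> B" if "i \<in> h" for i
  proof -
    have "\<bar>f i\<bar> \<le> (\<Sum>i\<in>h. \<bar>f i\<bar>)" using fin_h that by (intro member_le_sum) auto
    then show ?thesis by (simp add: B_def)
  qed
  have cut_nonneg: "0 \<le> lcut t" for t
    using F_nonneg[of "{i \<in> h. f i \<le> t}"] F_nonneg[of "{i \<in> h. \<not> f i \<le> t}"]
    by (simp add: lcut_def)
  have cut_le: "lcut t \<le> F h" for t
    using F_le[of "{i \<in> h. f i \<le> t}" h] by (simp add: lcut_def min.coboundedI1)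
  show int_cut: "integrable lborel lcut"
  proof (rule integrable_bounded_support[where C = "F h" and a = "- B" and b = B])
    have "(\<lambda>t. F {i \<in> h. f i \<le> t}) \<in> borel_measurable borel"
      by (rule borel_measurable_set_step[OF fin_h]) simp
    moreover have "(\<lambda>t. F {i \<in> h. \<not> f i \<le> t}) \<in> borel_measurable borel"
      by (rule borel_measurable_set_step[OF fin_h]) simp
    ultimately show "lcut \<in> borel_measurable borel" unfolding lcut_def by measurable
    show "\<bar>lcut t\<bar> \<le> F h" for t using cut_nonneg[of t] cut_le[of t] by simp
    \<comment> \<open>Outside the range of \<open>f\<close> one of the two sides is empty, and the
      minimum vanishes.\<close>
    show "lcut t = 0" if "t < - B \<or> B < t" for t
    proof -
      have "{i \<in> h. f i \<le> t} = {} \<or> {i \<in> h. \<not> f i \<le> t} = {}"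
        using that fB by (smt (verit, best) Collect_empty_eq)
      then show ?thesis
        using F_nonneg[of "{i \<in> h. f i \<le> t}"] F_nonneg[of "{i \<in> h. \<not> f i \<le> t}"]
        unfolding lcut_def by (auto simp: F_empty min_def simp del: Collect_empty_eq)
    qed
  qed
  \<comment> \<open>Thresholds below \<open>c\<close> are charged to the reflected copy
    \<open>tail x (c - t)\<close>, those above to \<open>tail x (t - c)\<close>; the two copies
    account for the factor 2.\<close>
  have left: "integrable lborel (\<lambda>t. tail x (c + (-1) * t))"
    using lborel_integrable_real_affine_iff[of "-1" "tail x" c] integrable_tail by simp
  have right: "integrable lborel (\<lambda>t. tail x (- c + 1 * t))"
    using lborel_integrable_real_affine_iff[of 1 "tail x" "- c"] integrable_tail by simp
  have "(\<integral>t. lcut t \<partial>lborel) \<le> (\<integral>t. tail x (c + (-1) * t) + tail x (- c + 1 * t) \<partial>lborel)"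
  proof (rule integral_mono_AE)
    \<comment> \<open>The point \<open>t = c\<close> is left out because \<open>tail\<close> is zero
      at 0, whereas the cut at \<open>c\<close> may be positive.\<close>
    show "AE t in lborel. lcut t \<le> tail x (c + (-1) * t) + tail x (- c + 1 * t)"
      using AE_lborel_singleton[of c]
    proof (rule AE_mp, intro AE_I2 impI)
      fix t assume "t \<noteq> c"
      then consider "t < c" | "c < t" by linarith
      then show "lcut t \<le> tail x (c + (-1) * t) + tail x (- c + 1 * t)"
      proof cases
        case 1
        have "lcut t \<le> F {i \<in> h. f i \<le> t}" by (simp add: lcut_def)
        also have "\<dots> \<le> F {i \<in> h. c - t \<le> \<bar>x i\<bar>}"
          by (rule F_le) (use c(2) in force)+
        also have "\<dots> = tail x (c + (-1) * t)" using 1 by (simp add: tail_def)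
        finally show ?thesis using tail_nonneg[of x "- c + 1 * t"] by linarith
      next
        case 2
        have "lcut t \<le> F {i \<in> h. \<not> f i \<le> t}" by (simp add: lcut_def)
        also have "\<dots> \<le> F {i \<in> h. t - c \<le> \<bar>x i\<bar>}"
          by (rule F_le) (use c(1) in force)+
        also have "\<dots> = tail x (- c + 1 * t)" using 2 by (simp add: tail_def)
        finally show ?thesis using tail_nonneg[of x "c + (-1) * t"] by linarith
      qed
    qed
  qed (use int_cut left right in auto)
  also have "\<dots> = 2 * F_norm h F x"
    using left right lborel_integral_real_affine[of "-1" "tail x" c]
      lborel_integral_real_affine[of 1 "tail x" "- c"]
    by (simp add: integral_tail[symmetric])
  finally show "(\<integral>t. lcut t \<partial>lborel) \<le> 2 * F_norm h F x" .
qed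

end

section \<open>Averaging over sweep cuts\<close>

definition cut_weight :: "'a hypergraph \<Rightarrow> 'a set \<Rightarrow> real" where
  "cut_weight G S = (\<Sum>h\<in>hedges G. weight G h * cut_function G h (S \<inter> h))"

lemma Psi_eq: "Psi G S = cut_weight G S / balance G S"
  by (simp add: Psi_def cut_weight_def)

lemma sqdist_commute: "sqdist G v i j = sqdist G v j i"
  by (simp add: sqdist_def power2_commute)

lemma sqdist_nonneg: "0 \<le> sqdist G v i j"
  by (simp add: sqdist_def sum_nonneg)

lemma sqdist_same [simp]: "sqdist G v i i = 0"
  by (simp add: sqdist_def)

text \<open>Two distinct vertices of \<open>h\<close> are joined by the path through
  \<open>h\<close> alone. Equal vertices form no such path, since nodes are not repeated, but their
  distance is zero. The absolute values are those of \<open>F_norm\<close>.\<close>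

lemma rc_feasible_edge:
  assumes feas: "rc_feasible G l v" and G: "submodular_hypergraph G"
    and h: "h \<in> hedges G" and ij: "i \<in> h" "j \<in> h"
  shows "sqdist G v i j \<le> \<bar>l h i\<bar> + \<bar>l h j\<bar>"
proof (cases "i = j")
  case False
  have V: "i \<in> verts G" "j \<in> verts G" using G h ij by (auto simp: submodular_hypergraph_def)
  have "factor_path G [i, j] [h]"
    using V h ij False
    unfolding factor_path_def factor_graph_def by (auto simp: insert_commute)
  then have "sqdist G v (hd [i, j]) (last [i, j])
      \<le> (\<Sum>m<length [h]. l ([h] ! m) ([i, j] ! m) + l ([h] ! m) ([i, j] ! Suc m))"
    using feas unfolding rc_feasible_def by blast
  then show ?thesis by simp
qed simp

lemma integrable_measurable_level:
  fixes H :: "'a set \<Rightarrow> real"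
  assumes V: "finite V" and H: "H {} = 0" "H V = 0"
  shows "integrable lborel (\<lambda>t. H {i \<in> V. f i \<le> (t::real)})"
proof -
  obtain C where C: "\<And>S. S \<subseteq> V \<Longrightarrow> \<bar>H S\<bar> \<le> C" using set_step_finite_range[OF V] by blast
  define B where "B = (\<Sum>i\<in>V. \<bar>f i\<bar>)"
  have fB: "\<bar>f i\<bar> \<le> B" if "i \<in> V" for i
    unfolding B_def using V that by (intro member_le_sum) auto
  show ?thesis
  proof (rule integrable_bounded_support[where C = C and a = "- B" and b = B])
    show "(\<lambda>t. H {i \<in> V. f i \<le> t}) \<in> borel_measurable borel"
      by (rule borel_measurable_set_step[OF V]) simp
    show "\<bar>H {i \<in> V. f i \<le> t}\<bar> \<le> C" for t by (rule C) auto
    show "H {i \<in> V. f i \<le> t} = 0" if "t < - B \<or> B < t" for t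
    proof -
      have "{i \<in> V. f i \<le> t} = {} \<or> {i \<in> V. f i \<le> t} = V"
        using that fB by (smt (verit, best) Collect_cong Collect_empty_eq Collect_mem_eq)
      then show ?thesis using H by metis
    qed
  qed
qed

text \<open>Co-area argument: cut weight and balance are integrated over all thresholds. The
  integral of the cut weight is at most twice the objective, that of the balance at least
  \<open>I\<close>, and the best threshold is no worse than the quotient of the integrals.\<close>

theorem sweep_cut:
  fixes G :: "('a::linorder) hypergraph"
  assumes G: "submodular_hypergraph G" and feas: "rc_feasible G l v"
    and lip: "\<And>i j. i \<in> verts G \<Longrightarrow> j \<in> verts G \<Longrightarrow> f i \<le> f j + sqdist G v i j"
  defines "I \<equiv> \<Sum>(i, j)\<in>{(i, j). i \<in> verts G \<and> j \<in> verts G \<and> i < j}.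
    meas G i * meas G j / total_meas G (verts G) * \<bar>f i - f j\<bar>"
  assumes I: "0 < I"
  shows "\<exists>t. 0 < balance G {i \<in> verts G. f i \<le> t} \<and>
    Psi G {i \<in> verts G. f i \<le> t} * I \<le> 2 * rc_objective G l"
proof -
  define V where "V = verts G"
  define S where "S t = {i \<in> V. f i \<le> t}" for t
  define M where "M = total_meas G V"
  have V: "finite V" using G by (simp add: submodular_hypergraph_def V_def)
  have sub: "h \<subseteq> V" if "h \<in> hedges G" for h
    using G that by (auto simp: submodular_hypergraph_def V_def)
  have finE: "finite (hedges G)"
    using sub V by (intro finite_subset[of "hedges G" "Pow V"]) auto
  have w: "0 < weight G h" if "h \<in> hedges G" for h
    using G that by (auto simp: submodular_hypergraph_def)
  have mu: "0 \<le> meas G i" if "i \<in> V" for i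
    using G that by (auto simp: submodular_hypergraph_def V_def)
  have edge: "cut_function_edge h (subf G h)" if "h \<in> hedges G" for h
    using G that finite_subset[OF sub[OF that] V]
    by (auto simp: submodular_hypergraph_def cut_function_edge_def)
  have meas_nonneg: "0 \<le> total_meas G A" if "A \<subseteq> V" for A
    unfolding total_meas_def using mu that by (intro sum_nonneg) auto
  have meas_compl: "total_meas G A + total_meas G (V - A) = M" if "A \<subseteq> V" for A
    unfolding total_meas_def M_def using sum.subset_diff[OF that V, of "meas G"] by simp
  have bal_nonneg: "0 \<le> balance G A" if "A \<subseteq> V" for A
    unfolding balance_def V_def[symmetric] using meas_nonneg that by simp
  have cut_h_eq: "cut_function G h (S t \<inter> h) =
      min (subf G h {i \<in> h. f i \<le> t}) (subf G h {i \<in> h. \<not> f i \<le> t})" if "h \<in> hedges G" for h t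
  proof -
    have "S t \<inter> h = {i \<in> h. f i \<le> t}" "h - S t \<inter> h = {i \<in> h. \<not> f i \<le> t}"
      using sub[OF that] by (auto simp: S_def)
    then show ?thesis by (simp add: cut_function_def)
  qed
  have lip_h: "f i - f j \<le> \<bar>l h i\<bar> + \<bar>l h j\<bar>" if "h \<in> hedges G" "i \<in> h" "j \<in> h" for h i j
    using rc_feasible_edge[OF feas G that] lip[of i j] that sub[OF that(1)] by (force simp: V_def)
  have int_h: "integrable lborel (\<lambda>t. cut_function G h (S t \<inter> h))"
      "(\<integral>t. cut_function G h (S t \<inter> h) \<partial>lborel) \<le> 2 * F_norm h (subf G h) (l h)"
    if "h \<in> hedges G" for h
    unfolding cut_h_eq[OF that] using cut_function_edge.integral_level_cut_le[OF edge lip_h, OF that that]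
    by auto
  have cut_nonneg: "0 \<le> cut_weight G A" if "A \<subseteq> V" for A
    unfolding cut_weight_def
  proof (intro sum_nonneg mult_nonneg_nonneg)
    fix h assume h: "h \<in> hedges G"
    show "0 \<le> weight G h" using w[OF h] by simp
    show "0 \<le> cut_function G h (A \<inter> h)"
      unfolding cut_function_def using cut_function_edge.F_nonneg[OF edge[OF h]] by (simp add: Int_commute)
  qed
  have int_cut: "integrable lborel (\<lambda>t. cut_weight G (S t))"
    unfolding cut_weight_def by (intro Bochner_Integration.integrable_sum integrable_mult_right int_h)
  have "(\<integral>t. cut_weight G (S t) \<partial>lborel) =
      (\<Sum>h\<in>hedges G. weight G h * (\<integral>t. cut_function G h (S t \<inter> h) \<partial>lborel))"
    unfolding cut_weight_def
    by (subst Bochner_Integration.integral_sum) (auto intro!: integrable_mult_right int_h)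
  also have "\<dots> \<le> (\<Sum>h\<in>hedges G. weight G h * (2 * F_norm h (subf G h) (l h)))"
    using w int_h(2) by (intro sum_mono mult_left_mono) (auto intro: less_imp_le)
  also have "\<dots> = 2 * rc_objective G l"
    by (simp add: rc_objective_def sum_distrib_left mult_ac)
  finally have cut_le: "(\<integral>t. cut_weight G (S t) \<partial>lborel) \<le> 2 * rc_objective G l" .
  \<comment> \<open>With \<open>M = 0\<close> the division by zero would make \<open>I\<close>
    vanish.\<close>
  have M: "0 < M"
  proof (rule ccontr)
    assume "\<not> 0 < M"
    then have "M = 0" using meas_nonneg[of V] by (simp add: M_def)
    then show False using I by (simp add: I_def M_def V_def)
  qed
  have int_bal: "integrable lborel (\<lambda>t. balance G (S t))"
    unfolding S_def using meas_nonneg[of V]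
    by (intro integrable_measurable_level[OF V]) (auto simp: balance_def V_def[symmetric] total_meas_def)
  \<comment> \<open>\<open>ind i j\<close> marks the thresholds that leave \<open>i\<close> below
    and \<open>j\<close> above. Of the two ordered versions of a pair at most one has a nonzero
    integral, and together they give \<open>\<bar>f i - f j\<bar>\<close>.\<close>
  define ind where "ind i j = (indicator {f i..<f j} :: real \<Rightarrow> real)" for i j
  have int_ind: "integrable lborel (ind i j)" for i j
    unfolding ind_def by (intro integrable_real_indicator; cases "f i \<le> f j") auto
  have integral_ind: "(\<integral>t. ind i j t \<partial>lborel) = max 0 (f j - f i)" for i j
    unfolding ind_def by (auto simp: max_def)
  let ?g = "\<lambda>t. \<Sum>i\<in>V. \<Sum>j\<in>V. meas G i * meas G j / M * ind i j t"
  have "I = (\<Sum>(i, j)\<in>{(i, j). i \<in> V \<and> j \<in> V \<and> i < j}.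
      meas G i * meas G j / M * max 0 (f j - f i) + meas G j * meas G i / M * max 0 (f i - f j))"
    unfolding I_def V_def[symmetric] M_def[symmetric]
    by (rule sum.cong) (auto simp: max_def)
  also have "\<dots> = (\<Sum>i\<in>V. \<Sum>j\<in>V. meas G i * meas G j / M * max 0 (f j - f i))"
    by (rule sum_offdiag_pairs[symmetric]) (use V in auto)
  also have "\<dots> = (\<integral>t. ?g t \<partial>lborel)"
    by (subst Bochner_Integration.integral_sum
        | (subst integral_mult_right_zero) | (simp only: integral_ind)
        | (rule Bochner_Integration.integrable_sum integrable_mult_right int_ind)
        | (rule sum.cong refl))+
  also have "\<dots> \<le> (\<integral>t. balance G (S t) \<partial>lborel)"
  proof (rule integral_mono)
    show "integrable lborel ?g"
      by (intro Bochner_Integration.integrable_sum integrable_mult_right int_ind)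
    fix t
    have ind: "ind i j t = of_bool (i \<in> S t) * of_bool (j \<in> V - S t)" if "i \<in> V" "j \<in> V" for i j
      using that by (auto simp: ind_def S_def indicator_def)
    have tot: "total_meas G A = (\<Sum>i\<in>V. meas G i * of_bool (i \<in> A))" if "A \<subseteq> V" for A
    proof -
      have "(\<Sum>i\<in>V. meas G i * of_bool (i \<in> A)) = (\<Sum>i\<in>V. if i \<in> A then meas G i else 0)"
        by (rule sum.cong) auto
      also have "\<dots> = (\<Sum>i\<in>A. meas G i)"
        using that V by (simp add: sum.If_cases Int_absorb1)
      finally show ?thesis by (simp add: total_meas_def)
    qed
    let ?a = "total_meas G (S t)" and ?b = "total_meas G (V - S t)"
    have St: "S t \<subseteq> V" by (auto simp: S_def)
    have "?g t = (\<Sum>i\<in>V. \<Sum>j\<in>V. (meas G i * of_bool (i \<in> S t)) * (meas G j * of_bool (j \<in> V - S t)) / M)"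
      by (intro sum.cong refl) (simp add: ind)
    also have "\<dots> = ?a * ?b / M"
      unfolding tot[OF St] tot[OF Diff_subset] sum_product sum_divide_distrib ..
    \<comment> \<open>Since \<open>a + b = M\<close>, each of the factors \<open>a / M\<close> and
      \<open>b / M\<close> is at most 1.\<close>
    also have "\<dots> \<le> min ?a ?b"
    proof -
      have ab: "0 \<le> ?a" "0 \<le> ?b" "?a + ?b = M"
        using meas_nonneg[of "S t"] meas_nonneg[of "V - S t"] meas_compl[OF St] St by auto
      then have "?a * ?b \<le> ?a * M" "?b * ?a \<le> ?b * M"
        by (intro mult_left_mono; linarith)+
      then have "?a * ?b / M \<le> ?a" "?a * ?b / M \<le> ?b"
        using M by (simp_all add: divide_le_eq mult.commute)
      then show ?thesis by simp
    qed
    also have "\<dots> = balance G (S t)" by (simp add: balance_def V_def)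
    finally show "?g t \<le> balance G (S t)" .
  qed (rule int_bal)
  finally have I_le: "I \<le> (\<integral>t. balance G (S t) \<partial>lborel)" .
  \<comment> \<open>Finitely many distinct sweep cuts occur, so the best ratio is attained. Cuts of
    balance zero must stay out, as their quotient is the default value 0 and would win.\<close>
  define \<C> where "\<C> = {A \<in> range S. 0 < balance G A}"
  have \<C>fin: "finite \<C>"
    using V by (intro finite_subset[of \<C> "Pow V"]) (auto simp: \<C>_def S_def)
  have \<C>ne: "\<C> \<noteq> {}"
  proof
    assume "\<C> = {}"
    then have "\<not> 0 < balance G (S t)" for t by (auto simp: \<C>_def)
    moreover have "0 \<le> balance G (S t)" for t by (rule bal_nonneg) (auto simp: S_def)
    ultimately have "balance G (S t) = 0" for t by (meson linorder_not_less order_antisym)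
    then show False using I I_le by simp
  qed
  define \<kappa> where "\<kappa> = Min (Psi G ` \<C>)"
  have "\<kappa> \<in> Psi G ` \<C>" unfolding \<kappa>_def using \<C>fin \<C>ne by (intro Min_in) auto
  then obtain t where t: "S t \<in> \<C>" "\<kappa> = Psi G (S t)" by (auto simp: \<C>_def)
  have \<kappa>0: "0 \<le> \<kappa>"
    unfolding t(2) Psi_eq using cut_nonneg[of "S t"] bal_nonneg[of "S t"] by (auto simp: S_def)
  have pt: "\<kappa> * balance G (S u) \<le> cut_weight G (S u)" for u
  proof (cases "0 < balance G (S u)")
    case True
    then have "S u \<in> \<C>" by (auto simp: \<C>_def)
    then have "\<kappa> \<le> Psi G (S u)" unfolding \<kappa>_def using \<C>fin by (intro Min_le) auto
    then show ?thesis using True by (simp add: Psi_eq field_simps)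
  next
    case False
    moreover have "S u \<subseteq> V" by (auto simp: S_def)
    ultimately show ?thesis using bal_nonneg[of "S u"] cut_nonneg[of "S u"] by simp
  qed
  have "\<kappa> * I \<le> \<kappa> * (\<integral>t. balance G (S t) \<partial>lborel)"
    by (rule mult_left_mono[OF I_le \<kappa>0])
  also have "\<dots> = (\<integral>t. \<kappa> * balance G (S t) \<partial>lborel)" by simp
  also have "\<dots> \<le> (\<integral>t. cut_weight G (S t) \<partial>lborel)"
    by (rule integral_mono[OF _ int_cut pt]) (intro integrable_mult_right int_bal)
  also note cut_le
  finally have "Psi G (S t) * I \<le> 2 * rc_objective G l" using t by simp
  then show ?thesis using t by (auto simp: \<C>_def S_def V_def)
qed

section \<open>Deterministic dimension reduction\<close>

lemma sinh_le_mult_cosh: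
  fixes y :: real
  assumes "0 \<le> y"
  shows "sinh y \<le> y * cosh y"
proof -
  have "(\<lambda>x. x * cosh x - sinh x) 0 \<le> (\<lambda>x. x * cosh x - sinh x) y"
  proof (rule DERIV_nonneg_imp_nondecreasing[OF assms])
    fix x :: real assume "0 \<le> x"
    moreover have "((\<lambda>x. x * cosh x - sinh x) has_real_derivative x * sinh x) (at x)"
      by (auto intro!: derivative_eq_intros)
    ultimately show "\<exists>y. ((\<lambda>x. x * cosh x - sinh x) has_real_derivative y) (at x) \<and> 0 \<le> y"
      by (intro exI[of _ "x * sinh x"]) auto
  qed
  then show ?thesis by simp
qed

text \<open>Hoeffding's bound for one sign, obtained from \<open>tanh z \<le> z\<close> by
  integrating the derivative of \<open>ln (cosh z)\<close>.\<close>

lemma cosh_le_exp_half_square: "cosh y \<le> exp (y\<^sup>2 / 2)" for y :: real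
proof -
  have pos: "cosh x \<le> exp (x\<^sup>2 / 2)" if x: "0 \<le> x" for x :: real
  proof -
    have "(\<lambda>x. x\<^sup>2 / 2 - ln (cosh x)) 0 \<le> (\<lambda>x. x\<^sup>2 / 2 - ln (cosh x)) x"
    proof (rule DERIV_nonneg_imp_nondecreasing[OF x])
      fix z :: real assume z: "0 \<le> z"
      have "((\<lambda>x. x\<^sup>2 / 2 - ln (cosh x)) has_real_derivative z - sinh z / cosh z) (at z)"
        by (auto intro!: derivative_eq_intros simp: field_simps cosh_real_pos)
      moreover have "0 \<le> z - sinh z / cosh z"
        using sinh_le_mult_cosh[OF z] cosh_real_pos[of z] by (simp add: field_simps)
      ultimately show "\<exists>y. ((\<lambda>x. x\<^sup>2 / 2 - ln (cosh x)) has_real_derivative y) (at z) \<and> 0 \<le> y" by blast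
    qed
    then have "ln (cosh x) \<le> x\<^sup>2 / 2" by simp
    then have "exp (ln (cosh x)) \<le> exp (x\<^sup>2 / 2)" by (simp only: exp_le_cancel_iff)
    then show ?thesis by (simp add: cosh_real_pos)
  qed
  show ?thesis
    using pos[of "\<bar>y\<bar>"] by (cases "0 \<le> y") auto
qed

lemma exp_sum_le:
  fixes a b :: real
  shows "exp (a + b) + exp (a - b) \<le> 2 * exp (a + b\<^sup>2 / 2)"
proof -
  have "exp (a + b) + exp (a - b) = 2 * (exp a * cosh b)"
    by (simp add: cosh_field_def exp_add exp_diff exp_minus field_simps)
  also have "\<dots> \<le> 2 * (exp a * exp (b\<^sup>2 / 2))"
    using cosh_le_exp_half_square[of b] by simp
  finally show ?thesis by (simp add: exp_add)
qed

text \<open>The machine has no exponential function, but \<open>m\<close> squarings compute this approximation.\<close>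

definition exp_approx :: "nat \<Rightarrow> real \<Rightarrow> real" where
  "exp_approx m x = (1 + x / 2 ^ m) ^ (2 ^ m)"

text \<open>With \<open>N = 2 ^ m\<close> the logarithm of the approximation is
  \<open>N * ln (1 + x / N)\<close>. It never exceeds \<open>x\<close> and falls short of it by at
  most \<open>2 * x^2 / N\<close>, which the third assumption bounds by
  \<open>\<eta>\<close>.\<close>

lemma exp_approx_bounds:
  assumes x: "\<bar>x\<bar> \<le> B" "2 * B \<le> 2 ^ m" "2 * B\<^sup>2 \<le> \<eta> * 2 ^ m"
  shows "exp_approx m x \<le> exp x" "exp (x - \<eta>) \<le> exp_approx m x"
proof -
  define N :: real where "N = 2 ^ m"
  have N: "0 < N" by (simp add: N_def)
  have y: "\<bar>x / N\<bar> \<le> 1/2" using x N by (simp add: N_def field_simps)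
  have pos: "0 < 1 + x / N" using y by linarith
  have eq: "exp_approx m x = exp (N * ln (1 + x / N))"
  proof -
    have "exp_approx m x = (exp (ln (1 + x / N))) ^ (2 ^ m)"
      using pos by (simp add: exp_approx_def N_def)
    also have "\<dots> = exp (real (2 ^ m) * ln (1 + x / N))" by (rule exp_of_nat_mult[symmetric])
    finally show ?thesis by (simp add: N_def)
  qed
  have "ln (1 + x / N) \<le> x / N" using pos by (intro ln_add_one_self_le_self2) simp
  then have "N * ln (1 + x / N) \<le> x" using N by (simp add: field_simps)
  then show "exp_approx m x \<le> exp x" by (simp add: eq)
  have "\<bar>ln (1 + x / N) - x / N\<bar> \<le> 2 * (x / N)\<^sup>2"
    using abs_ln_one_plus_x_minus_x_bound[OF y] .
  then have "x / N - 2 * (x / N)\<^sup>2 \<le> ln (1 + x / N)" by linarith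
  then have "N * (x / N - 2 * (x / N)\<^sup>2) \<le> N * ln (1 + x / N)" using N by simp
  moreover have "N * (x / N - 2 * (x / N)\<^sup>2) = x - 2 * x\<^sup>2 / N"
    using N by (simp add: power2_eq_square field_simps)
  moreover have "2 * x\<^sup>2 / N \<le> \<eta>"
  proof -
    have "x\<^sup>2 \<le> B\<^sup>2" using x(1) by (metis abs_ge_zero power2_abs power_mono)
    then have "2 * x\<^sup>2 \<le> \<eta> * N" using x(3) by (simp add: N_def)
    then show ?thesis using N by (simp add: field_simps)
  qed
  ultimately show "exp (x - \<eta>) \<le> exp_approx m x" by (simp add: eq)
qed

text \<open>The two exponents of the potential for one pair of points at squared distance \<open>D\<close>: \<open>X\<close> is the sum of
  squares of the first \<open>k\<close> rows, \<open>s\<close> the partial sum of row \<open>k\<close>, and \<open>R\<close> the part of \<open>D\<close>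
  carried by the columns whose sign is not chosen yet. The coefficients of \<open>s\<close> vary with \<open>R\<close> so as to
  absorb the second-order term of the next sign. If \<open>D = 0\<close> both exponents are zero.\<close>

definition up_exponent :: "nat \<Rightarrow> real \<Rightarrow> real \<Rightarrow> real \<Rightarrow> real \<Rightarrow> real" where
  "up_exponent k X s R D = (X / 8 + (1 + R / D) * (s * s) / 8 + R / 4 - (real k + 1) * D / 4) / D"

definition lo_exponent :: "nat \<Rightarrow> real \<Rightarrow> real \<Rightarrow> real \<Rightarrow> real \<Rightarrow> real" where
  "lo_exponent k X s R D = 0 - (X / 8 + (1 - R / D / 2) * (s * s) / 8 + R / 16 - (real k + 1) * D / 16) / D"

text \<open>The two signs give exponents \<open>A + B\<close> and \<open>A - B\<close>, so
  \<open>exp_sum_le\<close> applies. Returning \<open>a^2\<close> to \<open>R\<close> raises the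
  coefficient of \<open>s^2\<close> by enough to pay for \<open>B^2 / 2\<close>, as
  \<open>(1 + \<rho>)^2 \<le> 4\<close>, and the term \<open>R / 4\<close> pays for the expected
  growth of \<open>s^2\<close>.\<close>

lemma up_exponent_step:
  assumes R: "0 \<le> R" "R + a\<^sup>2 \<le> D" and D: "0 \<le> D"
  shows "exp (up_exponent k X (s + a) R D) + exp (up_exponent k X (s - a) R D)
    \<le> 2 * exp (up_exponent k X s (R + a\<^sup>2) D)"
proof (cases "D = 0")
  case False
  then have D: "0 < D" using D by simp
  define \<rho> where "\<rho> = R / D"
  define z where "z = a\<^sup>2 / D"
  have "\<rho> + z = (R + a\<^sup>2) / D" by (simp add: \<rho>_def z_def add_divide_distrib)
  then have "\<rho> + z \<le> 1" using R D by simp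
  moreover have "0 \<le> \<rho>" "0 \<le> z" using R D by (auto simp: \<rho>_def z_def)
  ultimately have \<rho>: "0 \<le> \<rho>" "\<rho> \<le> 1" "0 \<le> z" "\<rho> + z \<le> 1" by auto
  define A where "A = up_exponent k X s R D + (1 + \<rho>) * z / 8"
  define B where "B = (1 + \<rho>) * s * a / (4 * D)"
  have e: "up_exponent k X (s + a) R D = A + B" "up_exponent k X (s - a) R D = A - B"
    using D by (simp_all add: up_exponent_def A_def B_def \<rho>_def z_def power2_eq_square field_simps)
  have "2 * exp (A + B\<^sup>2 / 2) \<le> 2 * exp (up_exponent k X s (R + a\<^sup>2) D)"
  proof -
    have B2: "B\<^sup>2 / 2 = (1 + \<rho>)\<^sup>2 / 4 * (z * (s\<^sup>2 / D) / 8)"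
      using D by (simp add: B_def z_def power2_eq_square field_simps)
    have "(1 + \<rho>)\<^sup>2 \<le> 2\<^sup>2" using \<rho> by (intro power_mono) auto
    then have "B\<^sup>2 / 2 \<le> 1 * (z * (s\<^sup>2 / D) / 8)"
      unfolding B2 using \<rho> D by (intro mult_right_mono) auto
    moreover have "(1 + \<rho>) * z \<le> 2 * z" using \<rho> by (intro mult_right_mono) auto
    moreover have "up_exponent k X s (R + a\<^sup>2) D = up_exponent k X s R D + z * (s\<^sup>2 / D) / 8 + z / 4"
      using D by (simp add: up_exponent_def z_def power2_eq_square field_simps)
    ultimately show ?thesis by (simp add: A_def)
  qed
  then show ?thesis unfolding e using exp_sum_le[of A B] by (rule order_trans[rotated])
qed (simp add: up_exponent_def)

text \<open>As for the upper exponent with reversed sign. The factor \<open>1 - \<rho> / 2\<close>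
  stays between 1/2 and 1, so the favourable drift is at least \<open>z / 16\<close>; this is why
  the rate is 1/16 in place of 1/4.\<close>

lemma lo_exponent_step:
  assumes R: "0 \<le> R" "R + a\<^sup>2 \<le> D" and D: "0 \<le> D"
  shows "exp (lo_exponent k X (s + a) R D) + exp (lo_exponent k X (s - a) R D)
    \<le> 2 * exp (lo_exponent k X s (R + a\<^sup>2) D)"
proof (cases "D = 0")
  case False
  then have D: "0 < D" using D by simp
  define \<rho> where "\<rho> = R / D"
  define z where "z = a\<^sup>2 / D"
  have "\<rho> + z = (R + a\<^sup>2) / D" by (simp add: \<rho>_def z_def add_divide_distrib)
  then have "\<rho> + z \<le> 1" using R D by simp
  moreover have "0 \<le> \<rho>" "0 \<le> z" using R D by (auto simp: \<rho>_def z_def)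
  ultimately have \<rho>: "0 \<le> \<rho>" "\<rho> \<le> 1" "0 \<le> z" "\<rho> + z \<le> 1" by auto
  define A where "A = lo_exponent k X s R D - (1 - \<rho> / 2) * z / 8"
  define B where "B = - (1 - \<rho> / 2) * s * a / (4 * D)"
  have e: "lo_exponent k X (s + a) R D = A + B" "lo_exponent k X (s - a) R D = A - B"
    using D by (simp_all add: lo_exponent_def A_def B_def \<rho>_def z_def power2_eq_square field_simps)
  have "2 * exp (A + B\<^sup>2 / 2) \<le> 2 * exp (lo_exponent k X s (R + a\<^sup>2) D)"
  proof -
    have B2: "B\<^sup>2 / 2 = (1 - \<rho> / 2)\<^sup>2 / 2 * (z * (s\<^sup>2 / D) / 16)"
      using D by (simp add: B_def z_def power2_eq_square field_simps)
    have "(1 - \<rho> / 2)\<^sup>2 \<le> 1\<^sup>2" using \<rho> by (intro power_mono) auto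
    then have "B\<^sup>2 / 2 \<le> 1 * (z * (s\<^sup>2 / D) / 16)"
      unfolding B2 using \<rho> D by (intro mult_right_mono) auto
    moreover have "1/2 * z \<le> (1 - \<rho> / 2) * z" using \<rho> by (intro mult_right_mono) auto
    moreover have "lo_exponent k X s (R + a\<^sup>2) D = lo_exponent k X s R D + z * (s\<^sup>2 / D) / 16 - z / 16"
      using D by (simp add: lo_exponent_def z_def power2_eq_square field_simps)
    ultimately show ?thesis by (simp add: A_def)
  qed
  then show ?thesis unfolding e using exp_sum_le[of A B] by (rule order_trans[rotated])
qed (simp add: lo_exponent_def)

section \<open>The potential over all pairs\<close>

definition rest :: "(nat \<Rightarrow> nat \<Rightarrow> real) \<Rightarrow> nat \<Rightarrow> nat \<Rightarrow> nat \<Rightarrow> nat \<Rightarrow> real" where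
  "rest v n c i j = (\<Sum>k=c..<n. (v i k - v j k)\<^sup>2)"

text \<open>The parameter \<open>e\<close> is the exact exponential in the analysis and
  \<open>exp_approx m\<close> in the program.\<close>

definition potential ::
  "(real \<Rightarrow> real) \<Rightarrow> (nat \<Rightarrow> nat \<Rightarrow> real) \<Rightarrow> nat \<Rightarrow> nat \<Rightarrow> nat \<Rightarrow> (nat \<Rightarrow> nat \<Rightarrow> real) \<Rightarrow> (nat \<Rightarrow> nat \<Rightarrow> real) \<Rightarrow> real" where
  "potential e v n k c X s = (\<Sum>i<n. \<Sum>j<n.
     e (up_exponent k (X i j) (s i j) (rest v n c i j) (rest v n 0 i j)) +
     e (lo_exponent k (X i j) (s i j) (rest v n c i j) (rest v n 0 i j)))"

lemma rest_nonneg: "0 \<le> rest v n c i j"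
  by (simp add: rest_def sum_nonneg)

lemma rest_Suc: "c < n \<Longrightarrow> rest v n c i j = rest v n (Suc c) i j + (v i c - v j c)\<^sup>2"
  by (simp add: rest_def sum.atLeast_Suc_lessThan)

lemma rest_le: "rest v n c i j \<le> rest v n 0 i j"
  unfolding rest_def by (rule sum_mono2) auto

lemma potential_cong:
  "(\<And>i j. i < n \<Longrightarrow> j < n \<Longrightarrow> X i j = X' i j) \<Longrightarrow>
   (\<And>i j. i < n \<Longrightarrow> j < n \<Longrightarrow> s i j = s' i j) \<Longrightarrow> potential e v n k c X s = potential e v n k c X' s'"
  by (simp add: potential_def)

text \<open>Supermartingale property: under a uniform choice of the next sign the potential does not
  grow on average, so one of the two signs does not increase it.\<close>

lemma potential_step:
  assumes "c < n"
  shows "potential exp v n k (Suc c) X (\<lambda>i j. s i j + (v i c - v j c)) +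
      potential exp v n k (Suc c) X (\<lambda>i j. s i j - (v i c - v j c)) \<le> 2 * potential exp v n k c X s"
proof -
  have "exp (up_exponent k (X i j) (s i j + (v i c - v j c)) (rest v n (Suc c) i j) (rest v n 0 i j)) +
      exp (lo_exponent k (X i j) (s i j + (v i c - v j c)) (rest v n (Suc c) i j) (rest v n 0 i j)) +
      (exp (up_exponent k (X i j) (s i j - (v i c - v j c)) (rest v n (Suc c) i j) (rest v n 0 i j)) +
      exp (lo_exponent k (X i j) (s i j - (v i c - v j c)) (rest v n (Suc c) i j) (rest v n 0 i j)))
    \<le> 2 * (exp (up_exponent k (X i j) (s i j) (rest v n c i j) (rest v n 0 i j)) +
      exp (lo_exponent k (X i j) (s i j) (rest v n c i j) (rest v n 0 i j)))" for i j
    using up_exponent_step[of "rest v n (Suc c) i j" "v i c - v j c" "rest v n 0 i j" k "X i j" "s i j"]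
      lo_exponent_step[of "rest v n (Suc c) i j" "v i c - v j c" "rest v n 0 i j" k "X i j" "s i j"]
      rest_le[of v n c i j] rest_nonneg[of v n "Suc c" i j] rest_nonneg[of v n 0 i j]
    unfolding rest_Suc[OF assms, of v i j] by simp
  then show ?thesis
    unfolding potential_def sum_distrib_left sum.distrib[symmetric] by (intro sum_mono)
qed

text \<open>At the end of a row no columns remain and \<open>s^2\<close> joins \<open>X\<close>. The
  fresh row brings \<open>R = D\<close>, which is cancelled by the compensator advancing by one row;
  this explains \<open>real k + 1\<close> in the exponents.\<close>

lemma potential_row_end:
  "potential e v n (Suc k) 0 (\<lambda>i j. X i j + s i j * s i j) (\<lambda>i j. 0) = potential e v n k n X s"
proof -
  have u: "up_exponent (Suc k) (x + t * t) 0 D D = up_exponent k x t 0 D" for x t D :: real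
    by (simp add: up_exponent_def field_simps)
  have l: "lo_exponent (Suc k) (x + t * t) 0 D D = lo_exponent k x t 0 D" for x t D :: real
    by (cases "D = 0") (simp_all add: lo_exponent_def add_divide_distrib diff_divide_distrib algebra_simps)
  have "rest v n n i j = 0" for i j by (simp add: rest_def)
  then show ?thesis unfolding potential_def by (simp add: u l)
qed

lemma potential_start: "potential exp v n 0 0 (\<lambda>i j. 0) (\<lambda>i j. 0) = 2 * (real n)\<^sup>2"
proof -
  have "up_exponent 0 0 0 D D = 0" "lo_exponent 0 0 0 D D = 0" for D
    by (simp_all add: up_exponent_def lo_exponent_def)
  then show ?thesis unfolding potential_def by (simp add: power2_eq_square)
qed

text \<open>The bounds on \<open>X\<close> and \<open>q\<close> are crude; they keep the exponents
  in the range where \<open>exp_approx\<close> is accurate. Each of the \<open>n * m\<close> signs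
  may cost a factor \<open>exp (1 / (n * m))\<close>, which the prefactor records, so the total loss
  is \<open>exp 1\<close>.\<close>

definition signs_inv :: "(nat \<Rightarrow> nat \<Rightarrow> real) \<Rightarrow> nat \<Rightarrow> nat \<Rightarrow> nat \<Rightarrow> nat \<Rightarrow> (nat \<Rightarrow> nat \<Rightarrow> real) \<Rightarrow> (nat \<Rightarrow> real) \<Rightarrow> bool" where
  "signs_inv v n m k c X q \<longleftrightarrow>
     (\<forall>i<n. \<forall>j<n. 0 \<le> X i j \<and> X i j \<le> real k * real n * rest v n 0 i j \<and>
        \<bar>q i - q j\<bar> \<le> (\<Sum>c'<c. \<bar>v i c' - v j c'\<bar>)) \<and>
     potential exp v n k c X (\<lambda>i j. q i - q j) \<le> exp (real (k * n + c) / real (n * m)) * (2 * (real n)\<^sup>2)"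

section \<open>Correctness of the greedy signs\<close>

locale sign_choice =
  fixes v :: "nat \<Rightarrow> nat \<Rightarrow> real" and n m L :: nat
  assumes m: "m = 128 * L" and L: "0 < L" and n: "0 < n" "n \<le> 2 ^ L"
begin

text \<open>For exponents up to \<open>B = 2 * m * n\<close>, precision \<open>1 / (n * m)\<close>
  of the approximation requires \<open>2 * B^2 * n * m = 8 * m^3 * n^3 \<le> 2 ^ m\<close>. Both
  \<open>L^3\<close> and \<open>n^3\<close> are at most \<open>2 ^ (3 * L)\<close>, and
  \<open>8 * 128^3 = 2^24\<close>.\<close>

lemma m_cube: "8 * m ^ 3 * n ^ 3 \<le> (2::nat) ^ m"
proof -
  have "L \<le> 2 ^ L" using less_exp[of L] by simp
  then have "8 * m ^ 3 * n ^ 3 \<le> 8 * (128 * 2 ^ L) ^ 3 * (2 ^ L) ^ 3"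
    unfolding m using n by (intro mult_mono power_mono) auto
  also have "\<dots> = (2::nat) ^ (24 + 6 * L)"
  proof -
    have "(2::nat) ^ (24 + 6 * L) = 2 ^ 24 * 2 ^ (3 * L) * 2 ^ (3 * L)"
    proof -
      have "24 + 6 * L = (24 + 3 * L) + 3 * L" by simp
      then show ?thesis by (simp only: power_add)
    qed
    then show ?thesis by (simp add: power_mult_distrib power_mult mult.commute[of 3 L])
  qed
  also have "\<dots> \<le> 2 ^ m" unfolding m using L by (intro power_increasing) auto
  finally show ?thesis .
qed

lemma square_partial_sum_le:
  assumes "\<bar>s\<bar> \<le> (\<Sum>c'<c. \<bar>v i c' - v j c'\<bar>)" "c \<le> n"
  shows "s * s \<le> real n * rest v n 0 i j"
proof -
  have "\<bar>s\<bar> \<le> (\<Sum>c'<n. \<bar>v i c' - v j c'\<bar>)"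
    using assms by (intro order_trans[OF assms(1)] sum_mono2) auto
  then have "\<bar>s\<bar>\<^sup>2 \<le> (\<Sum>c'<n. 1 * \<bar>v i c' - v j c'\<bar>)\<^sup>2" by (intro power_mono) auto
  also have "\<dots> \<le> (\<Sum>c'<n. 1\<^sup>2) * (\<Sum>c'<n. \<bar>v i c' - v j c'\<bar>\<^sup>2)"
    by (rule Cauchy_Schwarz_ineq_sum)
  finally show ?thesis by (simp add: rest_def power2_eq_square atLeast0LessThan)
qed

lemma exponent_bounds:
  assumes X: "0 \<le> X" "X \<le> real k * real n * D" and s: "s * s \<le> real n * D"
    and R: "0 \<le> R" "R \<le> D" and k: "k < m"
  shows "\<bar>up_exponent k X s R D\<bar> \<le> 2 * real m * real n" "\<bar>lo_exponent k X s R D\<bar> \<le> 2 * real m * real n"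
proof -
  have "\<bar>up_exponent k X s R D\<bar> \<le> 2 * real m * real n \<and> \<bar>lo_exponent k X s R D\<bar> \<le> 2 * real m * real n"
  proof (cases "D = 0")
    case False
    then have D: "0 < D" using R by simp
    define x where "x = X / D"
    define t where "t = s * s / D"
    define \<rho> where "\<rho> = R / D"
    have x: "0 \<le> x" "x \<le> real k * real n" using X D by (auto simp: x_def field_simps)
    have t: "0 \<le> t" "t \<le> real n" using s D by (auto simp: t_def field_simps)
    have \<rho>: "0 \<le> \<rho>" "\<rho> \<le> 1" using R D by (auto simp: \<rho>_def)
    have u: "up_exponent k X s R D = x / 8 + (1 + \<rho>) * t / 8 + \<rho> / 4 - (real k + 1) / 4"
      using D by (simp add: up_exponent_def x_def t_def \<rho>_def field_simps)
    have l: "lo_exponent k X s R D = - (x / 8 + (1 - \<rho> / 2) * t / 8 + \<rho> / 16 - (real k + 1) / 16)"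
      using D by (simp add: lo_exponent_def x_def t_def \<rho>_def field_simps)
    have "0 \<le> real k" by simp
    have k1: "real k + 1 \<le> real m" using k by linarith
    have n1: "1 \<le> real n" using n by linarith
    have xm: "x \<le> real m * real n"
      using x k by (meson mult_right_mono of_nat_0_le_iff of_nat_less_iff less_imp_le order_trans)
    have nm: "real n \<le> real m * real n" "real m \<le> real m * real n"
      using n1 k1 by (auto simp: mult_le_cancel_right1 mult_le_cancel_left1)
    have "0 \<le> (1 + \<rho>) * t" "(1 + \<rho>) * t \<le> 2 * t" "0 \<le> (1 - \<rho> / 2) * t" "(1 - \<rho> / 2) * t \<le> t"
    proof -
      have "0 \<le> \<rho> * t" "\<rho> * t \<le> 1 * t" using \<rho> t by (intro mult_nonneg_nonneg mult_right_mono; simp)+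
      then show "0 \<le> (1 + \<rho>) * t" "(1 + \<rho>) * t \<le> 2 * t" "0 \<le> (1 - \<rho> / 2) * t" "(1 - \<rho> / 2) * t \<le> t"
        using t unfolding distrib_right left_diff_distrib times_divide_eq_left by linarith+
    qed
    moreover define p r Z where "p = (1 + \<rho>) * t" and "r = (1 - \<rho> / 2) * t" and "Z = real m * real n"
    ultimately have b: "0 \<le> p" "p \<le> 2 * t" "0 \<le> r" "r \<le> t" "x \<le> Z" "real n \<le> Z" "real m \<le> Z"
      using xm nm by auto
    have "1 \<le> Z" "p \<le> 2 * Z" "r \<le> Z" "real k + 1 \<le> Z" using b t k1 n1 by linarith+
    then show ?thesis
      unfolding u l abs_le_iff mult.assoc p_def[symmetric] r_def[symmetric] Z_def[symmetric]
      using b(1,3,5) x(1) \<rho> \<open>0 \<le> real k\<close> by argo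
  qed (simp add: up_exponent_def lo_exponent_def)
  then show "\<bar>up_exponent k X s R D\<bar> \<le> 2 * real m * real n" "\<bar>lo_exponent k X s R D\<bar> \<le> 2 * real m * real n"
    by auto
qed

lemma exp_approx_error:
  assumes "\<bar>x\<bar> \<le> 2 * real m * real n"
  shows "exp_approx m x \<le> exp x" "exp (x - 1 / (real n * real m)) \<le> exp_approx m x"
proof -
  let ?B = "2 * real m * real n"
  have mn: "1 \<le> real m" "1 \<le> real n" using m L n by auto
  have c: "8 * real m ^ 3 * real n ^ 3 \<le> 2 ^ m"
    using m_cube by (metis (mono_tags, lifting) of_nat_le_iff of_nat_mult of_nat_numeral of_nat_power)
  have "1 * 1 \<le> (real m)\<^sup>2 * (real n)\<^sup>2" using mn by (intro mult_mono) auto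
  then have "2 * ?B * 1 \<le> 2 * ?B * ((real m)\<^sup>2 * (real n)\<^sup>2)" using mn by (intro mult_left_mono) auto
  also have "\<dots> \<le> 8 * real m ^ 3 * real n ^ 3" by (simp add: power2_eq_square power3_eq_cube)
  finally have 1: "2 * ?B \<le> 2 ^ m" using c by simp
  have "2 * ?B\<^sup>2 * (real n * real m) = 8 * real m ^ 3 * real n ^ 3"
    by (simp add: power2_eq_square power3_eq_cube)
  then have "2 * ?B\<^sup>2 * (real n * real m) \<le> 2 ^ m" using c by (simp only:)
  then have 2: "2 * ?B\<^sup>2 \<le> 1 / (real n * real m) * 2 ^ m"
    using mn by (simp add: field_simps)
  show "exp_approx m x \<le> exp x" "exp (x - 1 / (real n * real m)) \<le> exp_approx m x"
    using exp_approx_bounds[OF assms 1 2] by auto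
qed

lemma potential_approx:
  assumes X: "\<And>i j. i < n \<Longrightarrow> j < n \<Longrightarrow> 0 \<le> X i j \<and> X i j \<le> real k * real n * rest v n 0 i j"
    and s: "\<And>i j. i < n \<Longrightarrow> j < n \<Longrightarrow> s i j * s i j \<le> real n * rest v n 0 i j"
    and k: "k < m"
  shows "potential (exp_approx m) v n k c X s \<le> potential exp v n k c X s"
    "potential exp v n k c X s \<le> exp (1 / (real n * real m)) * potential (exp_approx m) v n k c X s"
proof -
  have b: "\<bar>up_exponent k (X i j) (s i j) (rest v n c i j) (rest v n 0 i j)\<bar> \<le> 2 * real m * real n"
    "\<bar>lo_exponent k (X i j) (s i j) (rest v n c i j) (rest v n 0 i j)\<bar> \<le> 2 * real m * real n"
    if "i < n" "j < n" for i j
    using exponent_bounds[of "X i j" k "rest v n 0 i j" "s i j" "rest v n c i j"] X s k that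
      rest_nonneg rest_le by auto
  show "potential (exp_approx m) v n k c X s \<le> potential exp v n k c X s"
    unfolding potential_def by (intro sum_mono add_mono exp_approx_error(1) b) auto
  have "exp x \<le> exp (1 / (real n * real m)) * exp_approx m x" if "\<bar>x\<bar> \<le> 2 * real m * real n" for x
    using exp_approx_error(2)[OF that] by (simp add: exp_diff field_simps)
  then show "potential exp v n k c X s \<le> exp (1 / (real n * real m)) * potential (exp_approx m) v n k c X s"
    unfolding potential_def sum_distrib_left distrib_left by (intro sum_mono add_mono b) (auto intro: b)
qed

lemma signs_inv_start: "signs_inv v n m 0 0 (\<lambda>i j. 0) (\<lambda>i. 0)"
  by (simp add: signs_inv_def potential_start rest_nonneg)

text \<open>The program compares approximations only. On the way from the exact value at
  \<open>\<sigma>\<close> through the two approximate ones to the exact value at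
  \<open>- \<sigma>\<close>, a single factor \<open>exp (1 / (n * m))\<close> is lost, and
  \<open>potential_step\<close> bounds the sum of the exact values.\<close>

lemma signs_inv_column:
  assumes inv: "signs_inv v n m k c X q" and kc: "k < m" "c < n" and \<sigma>: "\<sigma> = 1 \<or> \<sigma> = -1"
    and q': "\<And>i. i < n \<Longrightarrow> q' i = q i + \<sigma> * v i c"
    and best: "potential (exp_approx m) v n k (Suc c) X (\<lambda>i j. q i - q j + \<sigma> * (v i c - v j c))
      \<le> potential (exp_approx m) v n k (Suc c) X (\<lambda>i j. q i - q j + (- \<sigma>) * (v i c - v j c))"
  shows "signs_inv v n m k (Suc c) X q'"
proof -
  let ?P = "\<lambda>e \<sigma>. potential e v n k (Suc c) X (\<lambda>i j. q i - q j + \<sigma> * (v i c - v j c))"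
  let ?E = "exp (1 / (real n * real m))"
  have X: "0 \<le> X i j \<and> X i j \<le> real k * real n * rest v n 0 i j" if "i < n" "j < n" for i j
    using inv that by (auto simp: signs_inv_def)
  have s: "\<bar>q i - q j + \<tau> * (v i c - v j c)\<bar> \<le> (\<Sum>c'<Suc c. \<bar>v i c' - v j c'\<bar>)"
    if "i < n" "j < n" "\<bar>\<tau>\<bar> = 1" for i j \<tau>
  proof -
    have "\<bar>q i - q j\<bar> \<le> (\<Sum>c'<c. \<bar>v i c' - v j c'\<bar>)" using inv that by (auto simp: signs_inv_def)
    moreover have "\<bar>\<tau> * (v i c - v j c)\<bar> = \<bar>v i c - v j c\<bar>" using that by (simp add: abs_mult)
    ultimately show ?thesis using abs_triangle_ineq[of "q i - q j" "\<tau> * (v i c - v j c)"] by simp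
  qed
  have s2: "(q i - q j + \<tau> * (v i c - v j c)) * (q i - q j + \<tau> * (v i c - v j c)) \<le> real n * rest v n 0 i j"
    if "i < n" "j < n" "\<bar>\<tau>\<bar> = 1" for i j \<tau>
    using square_partial_sum_le[OF s[OF that]] kc by simp
  have E1: "1 \<le> ?E" by simp
  have pos: "0 \<le> ?P exp \<tau>" for \<tau> unfolding potential_def by (intro sum_nonneg) (simp add: add_nonneg_nonneg)
  have "?P exp \<sigma> \<le> ?E * ?P (exp_approx m) \<sigma>"
    by (rule potential_approx(2)[OF X s2 kc(1)]) (use \<sigma> in auto)
  also have "\<dots> \<le> ?E * ?P (exp_approx m) (- \<sigma>)" using best by (intro mult_left_mono) auto
  also have "\<dots> \<le> ?E * ?P exp (- \<sigma>)"
    by (intro mult_left_mono potential_approx(1)[OF X s2 kc(1)]) (use \<sigma> in auto)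
  finally have "?P exp \<sigma> \<le> ?E * ?P exp (- \<sigma>)" .
  have "?P exp \<sigma> \<le> ?E * ?P exp \<sigma>" using mult_right_mono[OF E1 pos[of \<sigma>]] by simp
  have "2 * ?P exp \<sigma> \<le> ?E * (?P exp 1 + ?P exp (- 1))"
  proof -
    have "?P exp \<sigma> + ?P exp (- \<sigma>) = ?P exp 1 + ?P exp (- 1)"
      using \<sigma> by (elim disjE) (simp_all only: minus_minus add.commute)
    moreover have "2 * ?P exp \<sigma> \<le> ?E * (?P exp \<sigma> + ?P exp (- \<sigma>))"
      using \<open>?P exp \<sigma> \<le> ?E * ?P exp (- \<sigma>)\<close> \<open>?P exp \<sigma> \<le> ?E * ?P exp \<sigma>\<close>
      unfolding distrib_left by linarith
    ultimately show ?thesis by simp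
  qed
  also have "?P exp 1 + ?P exp (- 1) \<le> 2 * potential exp v n k c X (\<lambda>i j. q i - q j)"
    using potential_step[OF kc(2), of v k X "\<lambda>i j. q i - q j"] by (simp only: mult_1 mult_minus1 diff_conv_add_uminus)
  finally have "?P exp \<sigma> \<le> ?E * potential exp v n k c X (\<lambda>i j. q i - q j)" by simp
  also have "\<dots> \<le> ?E * (exp (real (k * n + c) / real (n * m)) * (2 * (real n)\<^sup>2))"
    using inv by (intro mult_left_mono) (auto simp: signs_inv_def)
  also have "\<dots> = exp (real (k * n + Suc c) / real (n * m)) * (2 * (real n)\<^sup>2)"
  proof -
    have "1 / (real n * real m) + real (k * n + c) / real (n * m) = real (k * n + Suc c) / real (n * m)"
      by (simp add: add_divide_distrib[symmetric])
    then show ?thesis by (simp add: exp_add[symmetric] del: of_nat_mult of_nat_add)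
  qed
  finally have pot: "?P exp \<sigma> \<le> exp (real (k * n + Suc c) / real (n * m)) * (2 * (real n)\<^sup>2)" .
  have q'_diff: "q' i - q' j = q i - q j + \<sigma> * (v i c - v j c)" if "i < n" "j < n" for i j
    using that by (simp add: q' right_diff_distrib)
  have "potential exp v n k (Suc c) X (\<lambda>i j. q' i - q' j) = ?P exp \<sigma>"
    by (rule potential_cong) (auto simp: q'_diff)
  then show ?thesis
    using pot X s[of _ _ \<sigma>] \<sigma> unfolding signs_inv_def
    by (intro conjI allI impI) (auto simp only: q'_diff abs_one abs_minus_cancel)
qed

lemma signs_inv_row:
  assumes inv: "signs_inv v n m k n X q"
    and X': "\<And>i j. i < n \<Longrightarrow> j < n \<Longrightarrow> X' i j = X i j + (q i - q j) * (q i - q j)"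
    and q': "\<And>i. i < n \<Longrightarrow> q' i = 0"
  shows "signs_inv v n m (Suc k) 0 X' q'"
proof -
  have "potential exp v n (Suc k) 0 X' (\<lambda>i j. q' i - q' j) =
      potential exp v n (Suc k) 0 (\<lambda>i j. X i j + (q i - q j) * (q i - q j)) (\<lambda>i j. 0)"
    by (rule potential_cong) (auto simp: X' q')
  also have "\<dots> = potential exp v n k n X (\<lambda>i j. q i - q j)"
    by (rule potential_row_end)
  finally have pot: "potential exp v n (Suc k) 0 X' (\<lambda>i j. q' i - q' j)
      \<le> exp (real (Suc k * n + 0) / real (n * m)) * (2 * (real n)\<^sup>2)"
    using inv by (simp add: signs_inv_def add.commute)
  have "0 \<le> X' i j \<and> X' i j \<le> real (Suc k) * real n * rest v n 0 i j" if ij: "i < n" "j < n" for i j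
  proof -
    have "\<bar>q i - q j\<bar> \<le> (\<Sum>c'<n. \<bar>v i c' - v j c'\<bar>)" using inv ij by (auto simp: signs_inv_def)
    then have "(q i - q j) * (q i - q j) \<le> real n * rest v n 0 i j"
      by (rule square_partial_sum_le) simp
    moreover have "0 \<le> X i j \<and> X i j \<le> real k * real n * rest v n 0 i j"
      using inv ij unfolding signs_inv_def by blast
    moreover have "0 \<le> (q i - q j) * (q i - q j)" by simp
    ultimately show ?thesis unfolding X'[OF ij] by (simp only: of_nat_Suc distrib_right) simp
  qed
  then show ?thesis using pot unfolding signs_inv_def by (auto simp: q')
qed

text \<open>All summands of the potential are positive, so each pair inherits the bound on the
  total. With the current row empty and \<open>D > 0\<close> the exponents are
  \<open>X / (8 * D) - m / 4\<close> and \<open>m / 16 - X / (8 * D)\<close>, which confines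
  \<open>X / D\<close> from both sides.\<close>

lemma signs_inv_final:
  assumes inv: "signs_inv v n m m 0 X q" and q: "\<And>i. i < n \<Longrightarrow> q i = 0" and ij: "i < n" "j < n"
  shows "real m / 5 * rest v n 0 i j \<le> X i j" "X i j \<le> 3 * real m * rest v n 0 i j"
proof -
  let ?D = "rest v n 0 i j"
  have mn: "1 \<le> real m" "1 \<le> real n" "1 \<le> real L" using m L n by auto
  have "real m / 5 * ?D \<le> X i j \<and> X i j \<le> 3 * real m * ?D"
  proof (cases "?D = 0")
    case True
    \<comment> \<open>For coincident vectors the exponents carry no information, and the crude bound
      of the invariant forces \<open>X i j = 0\<close>.\<close>
    have "0 \<le> X i j \<and> X i j \<le> real m * real n * ?D" using inv ij unfolding signs_inv_def by blast
    then show ?thesis unfolding True by simp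
  next
    case False
    then have D: "0 < ?D" using rest_nonneg[of v n 0 i j] by simp
    let ?T = "\<lambda>i j. exp (up_exponent m (X i j) (q i - q j) (rest v n 0 i j) (rest v n 0 i j)) +
      exp (lo_exponent m (X i j) (q i - q j) (rest v n 0 i j) (rest v n 0 i j))"
    have "?T i j \<le> (\<Sum>j<n. ?T i j)" using ij by (intro member_le_sum) (auto simp: add_nonneg_nonneg)
    also have "\<dots> \<le> (\<Sum>i<n. \<Sum>j<n. ?T i j)"
      using ij by (intro member_le_sum[of i "{..<n}" "\<lambda>i. \<Sum>j<n. ?T i j"]) (auto simp: add_nonneg_nonneg intro!: sum_nonneg)
    also have "\<dots> = potential exp v n m 0 X (\<lambda>i j. q i - q j)" by (simp add: potential_def)
    also have "\<dots> \<le> exp (real (m * n + 0) / real (n * m)) * (2 * (real n)\<^sup>2)"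
      using inv by (simp add: signs_inv_def)
    also have "\<dots> = exp 1 * (2 * (real n)\<^sup>2)" using mn by (simp add: mult.commute)
    also have "\<dots> = exp (1 + ln 2 + 2 * ln (real n))"
      using mn by (simp add: exp_add power2_eq_square exp_double)
    \<comment> \<open>\<open>1 + ln 2 + 2 * ln n\<close> is at most
      \<open>1 + 25/36 + 25/18 * L\<close>, and \<open>L \<ge> 1\<close>.\<close>
    also have "\<dots> \<le> exp (3.1 * real L)"
    proof -
      have "ln (real n) \<le> ln (2 ^ L)" using n mn by (subst ln_le_cancel_iff) (auto simp flip: of_nat_power_le_of_nat_cancel_iff)
      then have "ln (real n) \<le> real L * ln 2" by (simp add: ln_realpow)
      moreover have "real L * ln 2 \<le> real L * (25/36)" using ln2_le_25_over_36 by (intro mult_left_mono) auto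
      ultimately have "ln (real n) \<le> real L * (25/36)" by simp
      then show ?thesis using ln2_le_25_over_36 mn by simp
    qed
    finally have T: "?T i j \<le> exp (3.1 * real L)" .
    have "exp (up_exponent m (X i j) (q i - q j) ?D ?D) \<le> exp (3.1 * real L)"
      "exp (lo_exponent m (X i j) (q i - q j) ?D ?D) \<le> exp (3.1 * real L)"
      using T by (smt (verit) exp_gt_zero)+
    then have "up_exponent m (X i j) 0 ?D ?D \<le> 3.1 * real L" "lo_exponent m (X i j) 0 ?D ?D \<le> 3.1 * real L"
      using q ij by simp_all
    moreover have "up_exponent m (X i j) 0 ?D ?D = X i j / ?D / 8 - real m / 4"
      "lo_exponent m (X i j) 0 ?D ?D = real m / 16 - X i j / ?D / 8"
      using D by (simp_all add: up_exponent_def lo_exponent_def field_simps)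
    \<comment> \<open>The choice \<open>m = 128 * L\<close> provides the margin: in units of
      \<open>L\<close>, \<open>8 * (3.1 + 32) < 3 * 128\<close> and
      \<open>8 * (8 - 3.1) > 128 / 5\<close>.\<close>
    ultimately have "X i j / ?D \<le> 3 * real m" "real m / 5 \<le> X i j / ?D"
      using mn unfolding m by auto
    then show ?thesis using D by (simp add: field_simps)
  qed
  then show "real m / 5 * rest v n 0 i j \<le> X i j" "X i j \<le> 3 * real m * rest v n 0 i j" by auto
qed

end

section \<open>A good candidate exists\<close>

text \<open>This is \<open>reach\<close> before normalisation, which involves a square root; it
  needs field operations and comparisons only.\<close>

definition gain :: "(nat \<Rightarrow> nat \<Rightarrow> real) \<Rightarrow> nat \<Rightarrow> real \<Rightarrow> (nat \<Rightarrow> real) \<Rightarrow> nat \<Rightarrow> real" where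
  "gain D n r t x = Max ((\<lambda>z. t z - t x) ` {z. z < n \<and> D x z \<le> r})"

definition dirval :: "(nat \<Rightarrow> nat \<Rightarrow> real) \<Rightarrow> nat \<Rightarrow> nat set \<Rightarrow> nat \<Rightarrow> real" where
  "dirval P m C x = signed_sum m (\<lambda>k. P k x) C"

definition gain_sum :: "(nat \<Rightarrow> nat \<Rightarrow> real) \<Rightarrow> nat \<Rightarrow> (nat \<Rightarrow> nat \<Rightarrow> real) \<Rightarrow> nat \<Rightarrow> real \<Rightarrow> nat \<Rightarrow> real" where
  "gain_sum D n P m r x = (\<Sum>C\<in>Pow {..<m}. gain D n r (dirval P m C) x)"

definition direction_seed :: "(nat \<Rightarrow> nat \<Rightarrow> real) \<Rightarrow> nat \<Rightarrow> real \<Rightarrow> (nat \<Rightarrow> real) \<Rightarrow> nat \<Rightarrow> nat \<Rightarrow> nat set" where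
  "direction_seed D n r t x1 x2 = {x. x < n \<and> t x1 \<le> t x \<and> gain D n r t x2 \<le> gain D n r t x}"

definition mean_seed :: "(nat \<Rightarrow> nat \<Rightarrow> real) \<Rightarrow> nat \<Rightarrow> (nat \<Rightarrow> nat \<Rightarrow> real) \<Rightarrow> nat \<Rightarrow> real \<Rightarrow> nat \<Rightarrow> nat set" where
  "mean_seed D n P m r x2 = {x. x < n \<and> gain_sum D n P m r x2 \<le> gain_sum D n P m r x}"

definition nbhd :: "(nat \<Rightarrow> nat \<Rightarrow> real) \<Rightarrow> nat \<Rightarrow> nat set \<Rightarrow> real \<Rightarrow> nat set" where
  "nbhd D n A r = {x. x < n \<and> (\<exists>y<n. y \<in> A \<and> D x y \<le> r)}"

text \<open>The seeds in computable form. Radii are distances of two points and thresholds are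
  values at points, so the family has polynomial size as soon as \<open>2 ^ m\<close> is
  polynomial.\<close>

definition candidate :: "(nat \<Rightarrow> nat \<Rightarrow> real) \<Rightarrow> nat \<Rightarrow> (nat \<Rightarrow> nat \<Rightarrow> real) \<Rightarrow> nat \<Rightarrow> nat set \<Rightarrow> bool" where
  "candidate D n P m A \<longleftrightarrow> (\<exists>x0<n. A = {x0}) \<or>
     (\<exists>C a b x1 x2. C \<subseteq> {..<m} \<and> a < n \<and> b < n \<and> x1 < n \<and> x2 < n \<and>
        A = direction_seed D n (D a b) (dirval P m C) x1 x2) \<or>
     (\<exists>a b x2. a < n \<and> b < n \<and> x2 < n \<and> A = mean_seed D n P m (D a b) x2)"

text \<open>Replace \<open>t\<close> by the largest distance not exceeding it; the pair
  \<open>(0, 0)\<close> guarantees that one exists.\<close>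

lemma threshold_attained:
  fixes D :: "nat \<Rightarrow> nat \<Rightarrow> real"
  assumes n: "0 < n" and D0: "D 0 0 = 0" and t: "0 \<le> t"
  obtains a b where "a < n" "b < n" "\<And>x y. x < n \<Longrightarrow> y < n \<Longrightarrow> D x y \<le> t \<longleftrightarrow> D x y \<le> D a b"
proof -
  define T where "T = (\<lambda>(x, y). D x y) ` {(x, y). x < n \<and> y < n \<and> D x y \<le> t}"
  have fin: "finite {(x, y). x < n \<and> y < n \<and> D x y \<le> t}"
    by (rule finite_subset[of _ "{..<n} \<times> {..<n}"]) auto
  have "(0, 0) \<in> {(x, y). x < n \<and> y < n \<and> D x y \<le> t}" using assms by simp
  then have ne: "T \<noteq> {}" unfolding T_def by blast
  have "Max T \<in> T" using ne fin by (intro Max_in) (auto simp: T_def)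
  then obtain a b where ab: "a < n" "b < n" "D a b \<le> t" "Max T = D a b" by (auto simp: T_def)
  have "D x y \<le> t \<longleftrightarrow> D x y \<le> D a b" if "x < n" "y < n" for x y
  proof
    assume "D x y \<le> t"
    then have "D x y \<in> T" using that by (auto simp: T_def)
    then show "D x y \<le> D a b" unfolding ab(4)[symmetric] using fin by (intro Max_ge) (auto simp: T_def)
  qed (use ab in linarith)
  then show ?thesis using that ab by blast
qed

text \<open>Each threshold can be raised to the least value that its function attains on the
  set.\<close>

lemma upper_level_attained:
  fixes g h :: "nat \<Rightarrow> real"
  assumes "A = {x. x < n \<and> b \<le> g x \<and> a \<le> h x}" "A \<noteq> {}"
  obtains x1 x2 where "x1 < n" "x2 < n" "A = {x. x < n \<and> g x1 \<le> g x \<and> h x2 \<le> h x}"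
proof -
  have fin: "finite A" using assms(1) by simp
  obtain x1 where x1: "x1 \<in> A" "\<And>x. x \<in> A \<Longrightarrow> g x1 \<le> g x"
    using arg_min_if_finite[OF fin assms(2), of g] by (metis not_le_imp_less)
  obtain x2 where x2: "x2 \<in> A" "\<And>x. x \<in> A \<Longrightarrow> h x2 \<le> h x"
    using arg_min_if_finite[OF fin assms(2), of h] by (metis not_le_imp_less)
  have "A = {x. x < n \<and> g x1 \<le> g x \<and> h x2 \<le> h x}"
    using x1 x2 unfolding assms(1) by fastforce
  then show ?thesis using that x1(1) x2(1) assms(1) by blast
qed

lemma sqdist_eq_rest: "sqdist G v i j = rest v (card (verts G)) 0 i j"
  by (simp add: sqdist_def rest_def atLeast0LessThan)

lemma Psi_nonneg:
  assumes G: "submodular_hypergraph G" and S: "S \<subseteq> verts G"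
  shows "0 \<le> Psi G S"
proof -
  have "0 \<le> cut_function G h (S \<inter> h)" if h: "h \<in> hedges G" for h
  proof -
    have "finite h" using G h by (auto simp: submodular_hypergraph_def intro: finite_subset)
    then interpret cut_function_edge h "subf G h"
      using G h by (auto simp: submodular_hypergraph_def cut_function_edge_def)
    show ?thesis by (simp add: cut_function_def F_nonneg)
  qed
  moreover have "0 \<le> total_meas G A" if "A \<subseteq> verts G" for A
    unfolding total_meas_def using G that by (intro sum_nonneg) (auto simp: submodular_hypergraph_def)
  ultimately show ?thesis
    unfolding Psi_def balance_def using G S
    by (intro divide_nonneg_nonneg sum_nonneg mult_nonneg_nonneg)
       (auto simp: submodular_hypergraph_def less_imp_le)
qed

text \<open>Constraint (a) amounts to \<open>M / 2 * D0 \<ge> 1\<close> for the average distance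
  \<open>D0\<close>. Hence a seed of spread \<open>\<kappa>\<close> in the metric scaled by
  \<open>D0\<close> yields \<open>I \<ge> \<kappa>\<close> in \<open>sweep_cut\<close>, and the cut
  loses the factor \<open>2 / \<kappa>\<close>. The remaining work translates the seed and the
  threshold into unscaled data of the input.\<close>

theorem good_candidate:
  fixes G :: "nat hypergraph"
  assumes G: "submodular_hypergraph G" and V: "verts G = {..<n}" and feas: "rc_feasible G l v"
    and m: "0 < m"
    and P: "\<And>x y. x < n \<Longrightarrow> y < n \<Longrightarrow> real m / 5 * sqdist G v x y \<le> (\<Sum>k<m. (P k x - P k y)\<^sup>2)"
      "\<And>x y. x < n \<Longrightarrow> y < n \<Longrightarrow> (\<Sum>k<m. (P k x - P k y)\<^sup>2) \<le> 3 * real m * sqdist G v x y"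
  shows "\<exists>A a b. candidate (sqdist G v) n P m A \<and> a < n \<and> b < n \<and>
    0 < balance G (nbhd (sqdist G v) n A (sqdist G v a b)) \<and>
    Psi G (nbhd (sqdist G v) n A (sqdist G v a b)) \<le> rc_objective G l * (2 * 10 ^ 22 * sqrt (real m))"
proof -
  define D where "D = sqdist G v"
  define M where "M = total_meas G (verts G)"
  define W where "W i = meas G i / M" for i
  define D0 where "D0 = (\<Sum>x<n. \<Sum>y<n. W x * W y * D x y)"
  define s where "s = sqrt (3 * real m * D0)"
  define d where "d x y = D x y / D0" for x y
  define \<phi> where "\<phi> k x = P k x / s" for k x
  define \<kappa> where "\<kappa> = 1 / (10 ^ 22 * sqrt (real m))"
  have mu: "0 \<le> meas G i" if "i < n" for i
    using G V that by (auto simp: submodular_hypergraph_def)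
  \<comment> \<open>Ordered pairs count twice, and \<open>meas G i * meas G j / M\<close> is
    \<open>M\<close> times the product of the normalised weights; together this makes the factor
    \<open>M / 2\<close>.\<close>
  have offdiag: "(\<Sum>(i, j)\<in>{(i, j). i \<in> verts G \<and> j \<in> verts G \<and> i < j}. meas G i * meas G j / M * g i j) =
      M / 2 * (\<Sum>x<n. \<Sum>y<n. W x * W y * g x y)"
    if "\<And>i j. g i j = g j i" "\<And>i. g i i = 0" and M: "0 < M" for g
  proof -
    have "(\<Sum>x<n. \<Sum>y<n. meas G x * meas G y / M * g x y) =
        (\<Sum>(i, j)\<in>{(i, j). i \<in> {..<n} \<and> j \<in> {..<n} \<and> i < j}. meas G i * meas G j / M * g i j + meas G j * meas G i / M * g j i)"
      by (rule sum_offdiag_pairs) (simp_all add: that)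
    also have "\<dots> = 2 * (\<Sum>(i, j)\<in>{(i, j). i \<in> {..<n} \<and> j \<in> {..<n} \<and> i < j}. meas G i * meas G j / M * g i j)"
      unfolding sum_distrib_left by (rule sum.cong) (auto simp: that(1) mult_ac)
    finally have "(\<Sum>(i, j)\<in>{(i, j). i \<in> verts G \<and> j \<in> verts G \<and> i < j}. meas G i * meas G j / M * g i j) =
        1 / 2 * (\<Sum>x<n. \<Sum>y<n. meas G x * meas G y / M * g x y)"
      unfolding V by simp
    also have "(\<Sum>x<n. \<Sum>y<n. meas G x * meas G y / M * g x y) = M * (\<Sum>x<n. \<Sum>y<n. W x * W y * g x y)"
      unfolding sum_distrib_left using M by (intro sum.cong) (auto simp: W_def)
    finally show ?thesis by simp
  qed
  have a: "1 \<le> (\<Sum>(i, j)\<in>{(i, j). i \<in> verts G \<and> j \<in> verts G \<and> i < j}. meas G i * meas G j / M * D i j)"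
    using feas unfolding rc_feasible_def M_def D_def by blast
  have tri: "D i j \<le> D i k + D k j" if "i < n" "j < n" "k < n" for i j k
    using feas that unfolding rc_feasible_def D_def V by blast
  have M: "0 < M"
  proof (rule ccontr)
    assume "\<not> 0 < M"
    moreover have "0 \<le> M" unfolding M_def total_meas_def V by (intro sum_nonneg) (auto simp: mu)
    ultimately have "M = 0" by simp
    then show False using a by simp
  qed
  have D_sym: "D x y = D y x" and D_nonneg: "0 \<le> D x y" and D_same: "D x x = 0" for x y
    unfolding D_def by (auto simp: sqdist_commute[of G v x y] sqdist_nonneg)
  have MD0: "1 \<le> M / 2 * D0"
    using a offdiag[of D, OF D_sym D_same M] by (simp add: D0_def)
  then have D0: "0 < D0" using M by (metis mult_nonneg_nonpos not_less not_one_le_zero order_trans half_gt_zero less_imp_le)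
  have s: "0 < s" "s\<^sup>2 = 3 * real m * D0" using D0 m by (auto simp: s_def)
  have phi_sum: "(\<Sum>k<m. (\<phi> k x - \<phi> k y)\<^sup>2) = (\<Sum>k<m. (P k x - P k y)\<^sup>2) / (3 * real m * D0)" for x y
    unfolding s(2)[symmetric] sum_divide_distrib
    by (rule sum.cong) (auto simp: \<phi>_def diff_divide_distrib[symmetric] power_divide)
  have Wsum: "sum W {..<n} = 1"
    using M by (simp add: W_def M_def total_meas_def V sum_divide_distrib[symmetric])
  interpret cube_embedding "{..<n}" W d m \<phi>
  proof unfold_locales
    show "0 \<le> W x" if "x \<in> {..<n}" for x using that mu M by (simp add: W_def)
    show "d x z \<le> d x y + d y z" if "x \<in> {..<n}" "y \<in> {..<n}" "z \<in> {..<n}" for x y z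
      using tri[of x z y] that D0 by (simp add: d_def add_divide_distrib[symmetric] divide_right_mono)
    show "(\<Sum>k<m. (\<phi> k x - \<phi> k y)\<^sup>2) \<le> d x y" if "x \<in> {..<n}" "y \<in> {..<n}" for x y
      using P(2)[of x y] that D0 m unfolding phi_sum d_def D_def by (simp add: field_simps)
    \<comment> \<open>15 is the quotient of the two distortion constants \<open>3 * m\<close> and
      \<open>m / 5\<close>.\<close>
    show "d x y / 15 \<le> (\<Sum>k<m. (\<phi> k x - \<phi> k y)\<^sup>2)" if "x \<in> {..<n}" "y \<in> {..<n}" for x y
      using P(1)[of x y] that D0 m unfolding phi_sum d_def D_def by (simp add: field_simps)
  qed (use Wsum D_sym D_nonneg D_same D0 in \<open>auto simp: d_def\<close>)
  have n: "0 < n" using Wsum by (cases n) auto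
  have avg2_eq: "avg2 f = (\<Sum>x<n. \<Sum>y<n. W x * W y * f x y)" for f by (simp add: avg2_def)
  have "avg2 d = 1"
  proof -
    have "avg2 d = D0 / D0" unfolding D0_def sum_divide_distrib avg2_eq d_def by simp
    then show ?thesis using D0 by simp
  qed
  moreover have \<kappa>: "0 < \<kappa>" "\<kappa> * (10 ^ 22 * sqrt (real m)) \<le> 1" using m by (simp_all add: \<kappa>_def)
  ultimately obtain A where A: "A \<subseteq> {..<n}" "A \<noteq> {}"
      "\<kappa> \<le> avg2 (\<lambda>x y. \<bar>setdist A x - setdist A y\<bar>)" "seed A"
    using large_spread_seed[OF m] by blast
  define f where "f x = D0 * setdist A x" for x
  define I where "I = (\<Sum>(i, j)\<in>{(i, j). i \<in> verts G \<and> j \<in> verts G \<and> i < j}.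
    meas G i * meas G j / total_meas G (verts G) * \<bar>f i - f j\<bar>)"
  have "I = M / 2 * (\<Sum>x<n. \<Sum>y<n. W x * W y * \<bar>f x - f y\<bar>)"
    unfolding I_def M_def[symmetric] by (rule offdiag) (auto simp: M)
  also have "\<dots> = M / 2 * D0 * avg2 (\<lambda>x y. \<bar>setdist A x - setdist A y\<bar>)"
  proof -
    have "(\<Sum>x<n. \<Sum>y<n. W x * W y * \<bar>f x - f y\<bar>) = D0 * avg2 (\<lambda>x y. \<bar>setdist A x - setdist A y\<bar>)"
    proof -
      have "\<bar>f x - f y\<bar> = D0 * \<bar>setdist A x - setdist A y\<bar>" for x y
        using D0 by (simp add: f_def right_diff_distrib[symmetric] abs_mult)
      then show ?thesis by (simp add: avg2_eq sum_distrib_left mult_ac)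
    qed
    then show ?thesis by simp
  qed
  finally have "1 * \<kappa> \<le> I" using mult_mono[OF MD0 A(3)] \<kappa> M D0 by simp
  then have I: "\<kappa> \<le> I" by simp
  have lip: "f i \<le> f j + sqdist G v i j" if "i \<in> verts G" "j \<in> verts G" for i j
  proof -
    have "setdist A i \<le> setdist A j + d i j" using setdist_lipschitz[OF A(1,2)] that V by auto
    then have "D0 * setdist A i \<le> D0 * (setdist A j + d i j)" using D0 by simp
    then show ?thesis using D0 by (simp add: f_def d_def distrib_left D_def)
  qed
  obtain t where t: "0 < balance G {i \<in> verts G. f i \<le> t}"
      "Psi G {i \<in> verts G. f i \<le> t} * I \<le> 2 * rc_objective G l"
    using sweep_cut[OF G feas, of f, OF lip] I \<kappa>(1) unfolding I_def by force
  have S_eq: "{i \<in> verts G. f i \<le> t} = nbhd D n A t"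
  proof -
    have "f x \<le> t \<longleftrightarrow> (\<exists>y\<in>A. D x y \<le> t)" for x
    proof -
      have "f x \<le> t \<longleftrightarrow> setdist A x \<le> t / D0" using D0 by (simp add: f_def field_simps)
      also have "\<dots> \<longleftrightarrow> (\<exists>y\<in>A. D x y \<le> t)"
        using D0 by (simp add: setdist_le_iff[OF A(1,2)] d_def divide_le_cancel)
      finally show ?thesis .
    qed
    then show ?thesis using A(1) by (auto simp: nbhd_def V)
  qed
  \<comment> \<open>A cut of positive balance is nonempty, and a point in it witnesses
    \<open>0 \<le> t\<close>, which \<open>threshold_attained\<close> requires.\<close>
  have "nbhd D n A t \<noteq> {}"
  proof
    assume "nbhd D n A t = {}"
    then show False using t(1) unfolding S_eq by (simp add: balance_def total_meas_def)
  qed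
  then obtain x y where "D x y \<le> t" by (auto simp: nbhd_def)
  then have "0 \<le> t" using D_nonneg order_trans by blast
  then obtain a b where ab: "a < n" "b < n" "\<And>x y. x < n \<Longrightarrow> y < n \<Longrightarrow> D x y \<le> t \<longleftrightarrow> D x y \<le> D a b"
    using threshold_attained[of n D t] n D_same by blast
  have nb: "nbhd D n A t = nbhd D n A (D a b)"
    using ab(3) by (auto simp: nbhd_def)
  have "Psi G (nbhd D n A (D a b)) * \<kappa> \<le> 2 * rc_objective G l"
    using mult_left_mono[OF I, of "Psi G (nbhd D n A (D a b))"] t(2)
      Psi_nonneg[OF G, of "nbhd D n A (D a b)"] V
    unfolding S_eq nb by (force simp: nbhd_def)
  then have psi: "Psi G (nbhd D n A (D a b)) \<le> rc_objective G l * (2 * 10 ^ 22 * sqrt (real m))"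
    using m by (simp add: \<kappa>_def field_simps)
  have proj_eq: "proj C x = dirval P m C x / s" for C x
    by (simp add: proj_def dirval_def signed_sum_def \<phi>_def sum_divide_distrib)
  have reach_eq: "reach r x C = gain D n (r * D0) (dirval P m C) x / s" if x: "x < n" and r: "0 \<le> r" for r x C
  proof -
    let ?Z = "{z. z < n \<and> D x z \<le> r * D0}"
    have Z: "{z \<in> {..<n}. d x z \<le> r} = ?Z" using D0 by (auto simp: d_def divide_le_eq)
    have ne: "?Z \<noteq> {}" using x r D0 D_same[of x] by auto
    have "reach r x C = Max ((\<lambda>u. u / s) ` (\<lambda>z. dirval P m C z - dirval P m C x) ` ?Z)"
      unfolding reach_def Z proj_diff proj_eq by (simp add: image_image diff_divide_distrib)
    also have "\<dots> = gain D n (r * D0) (dirval P m C) x / s"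
      unfolding gain_def using ne s
      by (subst mono_Max_commute[symmetric, of "\<lambda>u. u / s"]) (auto simp: mono_def divide_right_mono)
    finally show ?thesis .
  qed
  have gain_radius: "\<exists>a b. a < n \<and> b < n \<and> (\<forall>t. \<forall>x<n. gain D n (r * D0) t x = gain D n (D a b) t x)"
    if r: "0 \<le> r" for r
  proof -
    have "0 \<le> r * D0" using r D0 by simp
    then obtain a b where ab: "a < n" "b < n" "\<And>x y. x < n \<Longrightarrow> y < n \<Longrightarrow> D x y \<le> r * D0 \<longleftrightarrow> D x y \<le> D a b"
      using threshold_attained[of n D "r * D0"] n D_same by blast
    have "gain D n (r * D0) t x = gain D n (D a b) t x" if "x < n" for t x
    proof -
      have "{z. z < n \<and> D x z \<le> r * D0} = {z. z < n \<and> D x z \<le> D a b}" using ab(3) that by auto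
      then show ?thesis by (simp add: gain_def)
    qed
    then show ?thesis using ab by blast
  qed
  have "candidate D n P m A"
    using A(4) unfolding seed_def
  proof (elim disjE exE conjE)
    fix x assume "A = {x}"
    then show ?thesis using A(1) by (auto simp: candidate_def)
  next
    fix C r a b
    assume C: "C \<subseteq> {..<m}" and r: "0 \<le> r" and AC: "A = {x \<in> {..<n}. b \<le> proj C x \<and> a \<le> reach r x C}"
    obtain i j where ij: "i < n" "j < n" "\<And>t x. x < n \<Longrightarrow> gain D n (r * D0) t x = gain D n (D i j) t x"
      using gain_radius[OF r] by blast
    let ?t = "dirval P m C"
    have "A = {x. x < n \<and> b * s \<le> ?t x \<and> a * s \<le> gain D n (D i j) ?t x}"
      unfolding AC using s(1) r by (auto simp: proj_eq reach_eq ij(3) pos_le_divide_eq)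
    then obtain x1 x2 where "x1 < n" "x2 < n"
        "A = {x. x < n \<and> ?t x1 \<le> ?t x \<and> gain D n (D i j) ?t x2 \<le> gain D n (D i j) ?t x}"
      by (rule upper_level_attained[OF _ A(2)])
    then show ?thesis using C ij unfolding candidate_def direction_seed_def by blast
  next
    fix r a
    assume r: "0 \<le> r" and AC: "A = {x \<in> {..<n}. a \<le> mean_reach r x}"
    obtain i j where ij: "i < n" "j < n" "\<And>t x. x < n \<Longrightarrow> gain D n (r * D0) t x = gain D n (D i j) t x"
      using gain_radius[OF r] by blast
    have mr: "mean_reach r x = gain_sum D n P m (D i j) x / (s * 2 ^ m)" if "x < n" for x
      using that r by (simp add: mean_reach_def cube_avg_def reach_eq ij(3) gain_sum_def sum_divide_distrib)
    have "A = {x. x < n \<and> a * (s * 2 ^ m) \<le> gain_sum D n P m (D i j) x \<and>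
        a * (s * 2 ^ m) \<le> gain_sum D n P m (D i j) x}"
      unfolding AC using s(1) by (auto simp: mr pos_le_divide_eq)
    then obtain x1 x2 where x12: "x1 < n" "x2 < n"
        "A = {x. x < n \<and> gain_sum D n P m (D i j) x1 \<le> gain_sum D n P m (D i j) x \<and>
          gain_sum D n P m (D i j) x2 \<le> gain_sum D n P m (D i j) x}"
      by (rule upper_level_attained[OF _ A(2)])
    \<comment> \<open>Both thresholds concern the same function, so the larger one decides.\<close>
    define x3 where "x3 = (if gain_sum D n P m (D i j) x1 \<le> gain_sum D n P m (D i j) x2 then x2 else x1)"
    have "x3 < n" "A = {x. x < n \<and> gain_sum D n P m (D i j) x3 \<le> gain_sum D n P m (D i j) x}"
      unfolding x3_def using x12 by (auto split: if_splits)
    then obtain x2 where "x2 < n"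
        "A = {x. x < n \<and> gain_sum D n P m (D i j) x2 \<le> gain_sum D n P m (D i j) x}"
      by blast
    then show ?thesis using ij unfolding candidate_def mean_seed_def by blast
  qed
  moreover have "0 < balance G (nbhd D n A (D a b))" using t(1) unfolding S_eq nb .
  ultimately show ?thesis
    unfolding D_def[symmetric] using ab(1,2) psi
    by (intro exI[of _ A] exI[of _ a] exI[of _ b] conjI)
qed

section \<open>Total correctness with step counts\<close>

definition nset :: "store \<Rightarrow> nat \<Rightarrow> nat \<Rightarrow> nat \<Rightarrow> nat \<Rightarrow> store" where
  "nset s a i j y = s\<lparr>nats := set_cell (nats s) a i j y\<rparr>"

definition rset :: "store \<Rightarrow> nat \<Rightarrow> nat \<Rightarrow> nat \<Rightarrow> real \<Rightarrow> store" where
  "rset s a i j y = s\<lparr>reals := set_cell (reals s) a i j y\<rparr>"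

lemma store_set_simps [simp]:
  "nats (nset s a i j y) = (nats s)(a := (nats s a)(i := (nats s a i)(j := y)))"
  "reals (nset s a i j y) = reals s"
  "reals (rset s a i j z) = (reals s)(a := (reals s a)(i := (reals s a i)(j := z)))"
  "nats (rset s a i j z) = nats s"
  by (simp_all add: nset_def rset_def set_cell_def)

text \<open>Frame condition at the granularity of whole arrays; changes inside an array are
  described by explicit functions in the postconditions.\<close>

definition keep :: "nat set \<Rightarrow> nat set \<Rightarrow> store \<Rightarrow> store \<Rightarrow> bool" where
  "keep NA RA s s' \<longleftrightarrow> (\<forall>a. a \<notin> NA \<longrightarrow> nats s' a = nats s a) \<and> (\<forall>a. a \<notin> RA \<longrightarrow> reals s' a = reals s a)"

lemma keep_refl [simp]: "keep NA RA s s"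
  by (simp add: keep_def)

lemma keep_nats: "keep NA RA s s' \<Longrightarrow> a \<notin> NA \<Longrightarrow> nats s' a = nats s a"
  by (simp add: keep_def)

lemma keep_reals: "keep NA RA s s' \<Longrightarrow> a \<notin> RA \<Longrightarrow> reals s' a = reals s a"
  by (simp add: keep_def)

lemma keep_nset: "keep NA RA s s' \<Longrightarrow> a \<in> NA \<Longrightarrow> keep NA RA s (nset s' a i j y)"
  by (auto simp: keep_def)

lemma keep_rset: "keep NA RA s s' \<Longrightarrow> a \<in> RA \<Longrightarrow> keep NA RA s (rset s' a i j y)"
  by (auto simp: keep_def)

lemma keep_trans:
  "keep NA RA s s' \<Longrightarrow> keep NB RB s' s'' \<Longrightarrow> NA \<subseteq> N \<Longrightarrow> NB \<subseteq> N \<Longrightarrow> RA \<subseteq> R \<Longrightarrow> RB \<subseteq> R \<Longrightarrow> keep N R s s''"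
  unfolding keep_def by (metis subsetD)

lemma keep_weaken: "keep NA RA s s' \<Longrightarrow> NA \<subseteq> N \<Longrightarrow> RA \<subseteq> R \<Longrightarrow> keep N R s s'"
  unfolding keep_def by blast

section \<open>Rules for total correctness with time bounds\<close>

definition ach :: "(nat \<Rightarrow> nat set \<Rightarrow> real) \<Rightarrow> prog \<Rightarrow> store \<Rightarrow> nat \<Rightarrow> (store \<Rightarrow> bool) \<Rightarrow> bool" where
  "ach Q c s T R \<longleftrightarrow> (\<exists>t s'. run Q c s t s' \<and> t \<le> T \<and> R s')"

lemma ach_conseq:
  "ach Q c s T R \<Longrightarrow> (\<And>s'. R s' \<Longrightarrow> R' s') \<Longrightarrow> T \<le> T' \<Longrightarrow> ach Q c s T' R'"
  unfolding ach_def by (meson order_trans)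

lemma ach_Skip: "R s \<Longrightarrow> ach Q Skip s 1 R"
  unfolding ach_def by (blast intro: run_Skip)

lemma ach_NSet: "R (nset s a (nval i s) (nval j s) (nval e s)) \<Longrightarrow> ach Q (NSet a i j e) s 1 R"
  unfolding ach_def nset_def by (blast intro: run_NSet)

lemma ach_RSet: "R (rset s a (nval i s) (nval j s) (rval e s)) \<Longrightarrow> ach Q (RSet a i j e) s 1 R"
  unfolding ach_def rset_def by (blast intro: run_RSet)

lemma ach_Query: "R (rset s d 0 0 (Q (nval e s) {i. nats s a i 0 \<noteq> 0})) \<Longrightarrow> ach Q (Query d e a) s 1 R"
  unfolding ach_def rset_def by (blast intro: run_Query)

lemma ach_Seq:
  assumes "ach Q c s T R'" "\<And>s'. R' s' \<Longrightarrow> ach Q c' s' T' R"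
  shows "ach Q (Seq c c') s (T + T') R"
  using assms unfolding ach_def by (meson add_mono run_Seq)

lemma ach_time: "ach Q c s T R \<Longrightarrow> T \<le> T' \<Longrightarrow> ach Q c s T' R"
  by (rule ach_conseq)

lemma ach_seq:
  assumes "ach Q c s T1 R'" "\<And>s'. R' s' \<Longrightarrow> ach Q c' s' T2 R" "T1 + T2 \<le> T"
  shows "ach Q (Seq c c') s T R"
  by (rule ach_time[OF ach_Seq[OF assms(1,2)] assms(3)])

lemma ach_seq_NSet:
  assumes "ach Q c s T1 (\<lambda>s'. R (nset s' a (nval i s') (nval j s') (nval e s')))" "T1 + 1 \<le> T"
  shows "ach Q (Seq c (NSet a i j e)) s T R"
  by (rule ach_seq[OF assms(1) ach_NSet assms(2)])

lemma ach_seq_RSet: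
  assumes "ach Q c s T1 (\<lambda>s'. R (rset s' a (nval i s') (nval j s') (rval e s')))" "T1 + 1 \<le> T"
  shows "ach Q (Seq c (RSet a i j e)) s T R"
  by (rule ach_seq[OF assms(1) ach_RSet assms(2)])

lemma ach_NSet_seq:
  assumes "ach Q c (nset s a (nval i s) (nval j s) (nval e s)) T1 R" "T1 + 1 \<le> T"
  shows "ach Q (Seq (NSet a i j e) c) s T R"
  by (rule ach_time[OF ach_Seq[OF ach_NSet[where R = "\<lambda>s'. ach Q c s' T1 R"]]]) (use assms in simp_all)

lemma ach_RSet_seq:
  assumes "ach Q c (rset s a (nval i s) (nval j s) (rval e s)) T1 R" "T1 + 1 \<le> T"
  shows "ach Q (Seq (RSet a i j e) c) s T R"
  by (rule ach_time[OF ach_Seq[OF ach_RSet[where R = "\<lambda>s'. ach Q c s' T1 R"]]]) (use assms in simp_all)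

lemma ach_cond:
  assumes "bval b s \<Longrightarrow> ach Q c s T1 R" "\<not> bval b s \<Longrightarrow> ach Q c' s T1 R" "T1 + 1 \<le> T"
  shows "ach Q (Cond b c c') s T R"
proof (cases "bval b s")
  case True
  with assms(1) obtain t s' where "run Q c s t s'" "t \<le> T1" "R s'" unfolding ach_def by blast
  then show ?thesis using True assms(3) unfolding ach_def
    by (intro exI[of _ "t + 1"] exI[of _ s'] conjI run_CondT) auto
next
  case False
  with assms(2) obtain t s' where "run Q c' s t s'" "t \<le> T1" "R s'" unfolding ach_def by blast
  then show ?thesis using False assms(3) unfolding ach_def
    by (intro exI[of _ "t + 1"] exI[of _ s'] conjI run_CondF) auto
qed

section \<open>Counting loops, sums and table filling\<close>

abbreviation NZ :: nexp where "NZ \<equiv> NConst 0"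
abbreviation NV :: "nat \<Rightarrow> nexp" where "NV x \<equiv> NGet x NZ NZ"
abbreviation RV :: "nat \<Rightarrow> rexp" where "RV x \<equiv> RGet x NZ NZ"
abbreviation RC :: "nat \<Rightarrow> rexp" where "RC c \<equiv> ROfNat (NConst c)"

definition For :: "nat \<Rightarrow> nexp \<Rightarrow> prog \<Rightarrow> prog" where
  "For x e c = Seq (NSet x NZ NZ NZ)
     (While (NLess (NV x) e) (Seq c (NSet x NZ NZ (NPlus (NV x) (NConst 1)))))"

text \<open>Each round costs its body, one test and one increment; initialisation and the failing
  test give the last \<open>+ 2\<close>. The bound \<open>e\<close> is evaluated anew in every
  round, so its value must survive the frame, and the invariant must tolerate writes to the
  counter.\<close>

lemma ach_For:
  assumes x: "x \<in> NA"
    and body: "\<And>i s'. i < N \<Longrightarrow> keep NA RA s s' \<Longrightarrow> J i s' \<Longrightarrow> nats s' x 0 0 = i \<Longrightarrow>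
      ach Q c s' T (\<lambda>s''. keep NA RA s s'' \<and> J (Suc i) s'' \<and> nats s'' x 0 0 = i)"
    and start: "J 0 s"
    and stable: "\<And>i s' y. J i s' \<Longrightarrow> J i (nset s' x 0 0 y)"
    and bound: "\<And>s'. keep NA RA s s' \<Longrightarrow> nval e s' = N"
  shows "ach Q (For x e c) s (N * (T + 2) + 2) (\<lambda>s'. keep NA RA s s' \<and> J N s')"
proof -
  let ?w = "While (NLess (NV x) e) (Seq c (NSet x NZ NZ (NPlus (NV x) (NConst 1))))"
  have loop: "\<exists>t s''. run Q ?w s' t s'' \<and> t \<le> (N - i) * (T + 2) + 1 \<and> keep NA RA s s'' \<and> J N s''"
    if "i \<le> N" "keep NA RA s s'" "J i s'" "nats s' x 0 0 = i" for i s'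
    using that
  proof (induction "N - i" arbitrary: i s')
    case 0
    then have "\<not> bval (NLess (NV x) e) s'" using bound by simp
    then have "run Q ?w s' 1 s'" by (rule run_WhileF)
    then show ?case using 0 by (intro exI[of _ 1] exI[of _ s']) auto
  next
    case (Suc r)
    then have i: "i < N" by simp
    then have b: "bval (NLess (NV x) e) s'" using Suc.prems bound by simp
    obtain t s1 where 1: "run Q c s' t s1" "t \<le> T" "keep NA RA s s1" "J (Suc i) s1" "nats s1 x 0 0 = i"
      using body[OF i Suc.prems(2-4)] unfolding ach_def by blast
    define s2 where "s2 = nset s1 x 0 0 (Suc i)"
    have "run Q (NSet x NZ NZ (NPlus (NV x) (NConst 1))) s1 1 s2"
      using run_NSet[of Q x NZ NZ "NPlus (NV x) (NConst 1)" s1] 1(5) by (simp add: s2_def nset_def)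
    then have r1: "run Q (Seq c (NSet x NZ NZ (NPlus (NV x) (NConst 1)))) s' (t + 1) s2"
      using run_Seq[OF 1(1)] by blast
    have "keep NA RA s s2" "J (Suc i) s2" "nats s2 x 0 0 = Suc i"
      using 1 x by (auto simp: s2_def intro: keep_nset stable)
    moreover have "r = N - Suc i" using Suc.hyps by simp
    ultimately obtain t' s3 where 3: "run Q ?w s2 t' s3" "t' \<le> (N - Suc i) * (T + 2) + 1" "keep NA RA s s3" "J N s3"
      using Suc.hyps(1)[of "Suc i" s2] i by fastforce
    have "run Q ?w s' (t + 1 + t' + 1) s3" by (rule run_WhileT[OF b r1 3(1)])
    moreover have "t + 1 + t' + 1 \<le> (N - i) * (T + 2) + 1"
    proof -
      have "N - i = Suc (N - Suc i)" using i by simp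
      then have "(N - i) * (T + 2) = (T + 2) + (N - Suc i) * (T + 2)" by simp
      then show ?thesis using 1(2) 3(2) by linarith
    qed
    ultimately show ?case using 3 by blast
  qed
  define s1 where "s1 = nset s x 0 0 0"
  have r0: "run Q (NSet x NZ NZ NZ) s 1 s1"
    using run_NSet[of Q x NZ NZ NZ s] by (simp add: s1_def nset_def)
  have "keep NA RA s s1" "J 0 s1" "nats s1 x 0 0 = 0"
    using x start by (auto simp: s1_def intro: keep_nset stable)
  then obtain t s2 where "run Q ?w s1 t s2" "t \<le> N * (T + 2) + 1" "keep NA RA s s2" "J N s2"
    using loop[of 0 s1] by auto
  then show ?thesis
    unfolding ach_def For_def using run_Seq[OF r0]
    by (intro exI[of _ "1 + t"] exI[of _ s2]) auto
qed

definition sum_prog :: "nat \<Rightarrow> nat \<Rightarrow> nexp \<Rightarrow> prog \<Rightarrow> rexp \<Rightarrow> prog" where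
  "sum_prog x acc b c e = Seq (RSet acc NZ NZ (RC 0)) (For x b (Seq c (RSet acc NZ NZ (RPlus (RV acc) e))))"

lemma ach_sum:
  assumes sub: "x \<in> NA" "acc \<in> RA" "x \<notin> NB" "acc \<notin> RB" "NB \<subseteq> NA" "RB \<subseteq> RA"
    and body: "\<And>i s'. i < N \<Longrightarrow> keep NA RA s s' \<Longrightarrow> nats s' x 0 0 = i \<Longrightarrow>
      ach Q c s' T (\<lambda>s''. keep NB RB s' s'' \<and> rval e s'' = val i)"
    and bound: "\<And>s'. keep NA RA s s' \<Longrightarrow> nval b s' = N"
  shows "ach Q (sum_prog x acc b c e) s
    (N * (T + 3) + 3) (\<lambda>s'. keep NA RA s s' \<and> reals s' acc 0 0 = (\<Sum>i<N. val i))"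
  unfolding sum_prog_def
proof (rule ach_conseq[OF ach_Seq[OF ach_RSet[where R = "\<lambda>s'. s' = rset s acc 0 0 0"],
        where R = "\<lambda>s'. keep NA RA s s' \<and> reals s' acc 0 0 = (\<Sum>i<N. val i)"]])
  show "rset s acc (nval NZ s) (nval NZ s) (rval (RC 0) s) = rset s acc 0 0 0" by simp
next
  fix s1 assume s1: "s1 = rset s acc 0 0 0"
  have k1: "keep NA RA s s1" unfolding s1 by (rule keep_rset) (use sub in auto)
  have kt: "keep NA RA s s'" if "keep NA RA s1 s'" for s' by (rule keep_trans[OF k1 that]) auto
  have "ach Q (For x b (Seq c (RSet acc NZ NZ (RPlus (RV acc) e)))) s1 (N * (T + 1 + 2) + 2)
      (\<lambda>s'. keep NA RA s1 s' \<and> reals s' acc 0 0 = (\<Sum>i<N. val i))"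
  proof (rule ach_For[OF sub(1), where J = "\<lambda>i s'. reals s' acc 0 0 = (\<Sum>i<i. val i)"])
    fix i s' assume i: "i < N" and k: "keep NA RA s1 s'" and J: "reals s' acc 0 0 = (\<Sum>i<i. val i)" and x: "nats s' x 0 0 = i"
    show "ach Q (Seq c (RSet acc NZ NZ (RPlus (RV acc) e))) s' (T + 1)
       (\<lambda>s''. keep NA RA s1 s'' \<and> reals s'' acc 0 0 = (\<Sum>i<Suc i. val i) \<and> nats s'' x 0 0 = i)"
    proof (rule ach_Seq[OF body[OF i kt[OF k] x]], rule ach_RSet, elim conjE, intro conjI)
      fix s'' assume k2: "keep NB RB s' s''" and v: "rval e s'' = val i"
      show "keep NA RA s1 (rset s'' acc (nval NZ s'') (nval NZ s'') (rval (RPlus (RV acc) e) s''))"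
        by (rule keep_rset[OF keep_trans[OF k k2]]) (use sub in auto)
      show "reals (rset s'' acc (nval NZ s'') (nval NZ s'') (rval (RPlus (RV acc) e) s'')) acc 0 0 = (\<Sum>i<Suc i. val i)"
        using v J keep_reals[OF k2 sub(4)] by simp
      show "nats (rset s'' acc (nval NZ s'') (nval NZ s'') (rval (RPlus (RV acc) e) s'')) x 0 0 = i"
        using x keep_nats[OF k2 sub(3)] by simp
    qed
  qed (use s1 bound kt sub in auto)
  then show "ach Q (For x b (Seq c (RSet acc NZ NZ (RPlus (RV acc) e)))) s1 (N * (T + 1 + 2) + 2)
      (\<lambda>s'. keep NA RA s s' \<and> reals s' acc 0 0 = (\<Sum>i<N. val i))"
    by (rule ach_conseq) (auto intro: kt)
qed (auto simp: algebra_simps)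

text \<open>The body may rely on the old content of the cell that it is about to write, which
  permits updates in place.\<close>

lemma ach_fill1_real:
  assumes sub: "x \<in> NA" "a \<in> RA" "x \<notin> NB" "NB \<subseteq> NA" "RB \<subseteq> RA"
    and body: "\<And>i s'. i < N \<Longrightarrow> keep NA RA s s' \<Longrightarrow> nats s' x 0 0 = i \<Longrightarrow> reals s' a i 0 = reals s a i 0 \<Longrightarrow>
      ach Q c s' T (\<lambda>s''. keep NB RB s' s'' \<and> reals s'' a = (reals s' a)(i := (reals s' a i)(0 := val i)))"
    and bound: "\<And>s'. keep NA RA s s' \<Longrightarrow> nval b s' = N"
  shows "ach Q (For x b c) s (N * (T + 2) + 2)
    (\<lambda>s'. keep NA RA s s' \<and> reals s' a = (\<lambda>k l. if k < N \<and> l = 0 then val k else reals s a k l))"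
proof (rule ach_For[OF sub(1), where J = "\<lambda>i s'. reals s' a = (\<lambda>k l. if k < i \<and> l = 0 then val k else reals s a k l)"])
  fix i s' assume i: "i < N" and k: "keep NA RA s s'" and x: "nats s' x 0 0 = i"
    and J: "reals s' a = (\<lambda>k l. if k < i \<and> l = 0 then val k else reals s a k l)"
  have a0: "reals s' a i 0 = reals s a i 0" by (simp add: J)
  show "ach Q c s' T (\<lambda>s''. keep NA RA s s'' \<and>
      reals s'' a = (\<lambda>k l. if k < Suc i \<and> l = 0 then val k else reals s a k l) \<and> nats s'' x 0 0 = i)"
  proof (rule ach_conseq[OF body[OF i k x a0]], elim conjE, intro conjI)
    fix s'' assume k2: "keep NB RB s' s''" and a: "reals s'' a = (reals s' a)(i := (reals s' a i)(0 := val i))"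
    show "keep NA RA s s''" by (rule keep_trans[OF k k2]) (use sub in auto)
    show "reals s'' a = (\<lambda>k l. if k < Suc i \<and> l = 0 then val k else reals s a k l)"
      unfolding a J by (intro ext) (simp add: less_Suc_eq)
    show "nats s'' x 0 0 = i" using x keep_nats[OF k2] sub by simp
  qed simp
qed (use bound in auto)

lemma ach_fill1_nat:
  assumes sub: "x \<in> NA" "a \<in> NA" "x \<noteq> a" "x \<notin> NB" "NB \<subseteq> NA" "RB \<subseteq> RA"
    and body: "\<And>i s'. i < N \<Longrightarrow> keep NA RA s s' \<Longrightarrow> nats s' x 0 0 = i \<Longrightarrow>
      ach Q c s' T (\<lambda>s''. keep NB RB s' s'' \<and> nats s'' a = (nats s' a)(i := (nats s' a i)(0 := val i)))"
    and bound: "\<And>s'. keep NA RA s s' \<Longrightarrow> nval b s' = N"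
  shows "ach Q (For x b c) s (N * (T + 2) + 2)
    (\<lambda>s'. keep NA RA s s' \<and> nats s' a = (\<lambda>k l. if k < N \<and> l = 0 then val k else nats s a k l))"
proof (rule ach_For[OF sub(1), where J = "\<lambda>i s'. nats s' a = (\<lambda>k l. if k < i \<and> l = 0 then val k else nats s a k l)"])
  fix i s' assume i: "i < N" and k: "keep NA RA s s'" and x: "nats s' x 0 0 = i"
    and J: "nats s' a = (\<lambda>k l. if k < i \<and> l = 0 then val k else nats s a k l)"
  show "ach Q c s' T (\<lambda>s''. keep NA RA s s'' \<and>
      nats s'' a = (\<lambda>k l. if k < Suc i \<and> l = 0 then val k else nats s a k l) \<and> nats s'' x 0 0 = i)"
  proof (rule ach_conseq[OF body[OF i k x]], elim conjE, intro conjI)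
    fix s'' assume k2: "keep NB RB s' s''" and a: "nats s'' a = (nats s' a)(i := (nats s' a i)(0 := val i))"
    show "keep NA RA s s''" by (rule keep_trans[OF k k2]) (use sub in auto)
    show "nats s'' a = (\<lambda>k l. if k < Suc i \<and> l = 0 then val k else nats s a k l)"
      unfolding a J by (intro ext) (simp add: less_Suc_eq)
    show "nats s'' x 0 0 = i" using x keep_nats[OF k2] sub by simp
  qed simp
qed (use bound sub in auto)

lemma ach_fill2_real:
  assumes sub: "x \<in> NA" "y \<in> NA" "x \<noteq> y" "a \<in> RA" "x \<notin> NB" "y \<notin> NB" "NB \<subseteq> NA" "RB \<subseteq> RA"
    and body: "\<And>i j s'. i < N \<Longrightarrow> j < M \<Longrightarrow> keep NA RA s s' \<Longrightarrow> nats s' x 0 0 = i \<Longrightarrow> nats s' y 0 0 = j \<Longrightarrow>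
      reals s' a i j = reals s a i j \<Longrightarrow>
      ach Q c s' T (\<lambda>s''. keep NB RB s' s'' \<and> reals s'' a = (reals s' a)(i := (reals s' a i)(j := val i j)))"
    and bound: "\<And>s'. keep NA RA s s' \<Longrightarrow> nval b s' = N" "\<And>s'. keep NA RA s s' \<Longrightarrow> nval d s' = M"
  shows "ach Q (For x b (For y d c)) s (N * (M * (T + 2) + 4) + 2)
    (\<lambda>s'. keep NA RA s s' \<and> reals s' a = (\<lambda>k l. if k < N \<and> l < M then val k l else reals s a k l))"
proof (rule ach_conseq[OF ach_For[OF sub(1), where J = "\<lambda>i s'. reals s' a = (\<lambda>k l. if k < i \<and> l < M then val k l else reals s a k l)"
      and T = "M * (T + 2) + 2"]])
  fix i s' assume i: "i < N" and k: "keep NA RA s s'" and x: "nats s' x 0 0 = i"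
    and J: "reals s' a = (\<lambda>k l. if k < i \<and> l < M then val k l else reals s a k l)"
  define NC where "NC = NB \<union> {y}"
  have NC: "y \<in> NC" "x \<notin> NC" "NC \<subseteq> NA" using sub by (auto simp: NC_def)
  have kt: "keep NA RA s s''" if "keep NC RA s' s''" for s''
    by (rule keep_trans[OF k that]) (use NC in auto)
  have "ach Q (For y d c) s' (M * (T + 2) + 2)
     (\<lambda>s''. keep NC RA s' s'' \<and> reals s'' a = (\<lambda>k l. if k = i \<and> l < M then val k l else reals s' a k l))"
  proof (rule ach_For[OF NC(1), where J = "\<lambda>j s''. reals s'' a = (\<lambda>k l. if k = i \<and> l < j then val k l else reals s' a k l)"])
    fix j s'' assume j: "j < M" and k2: "keep NC RA s' s''" and y: "nats s'' y 0 0 = j"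
      and J2: "reals s'' a = (\<lambda>k l. if k = i \<and> l < j then val k l else reals s' a k l)"
    have "nats s'' x 0 0 = i" using keep_nats[OF k2 NC(2)] x by simp
    moreover have "reals s'' a i j = reals s a i j" by (simp add: J J2)
    ultimately have b: "ach Q c s'' T (\<lambda>s3. keep NB RB s'' s3 \<and>
        reals s3 a = (reals s'' a)(i := (reals s'' a i)(j := val i j)))"
      by (intro body[OF i j kt[OF k2] _ y])
    show "ach Q c s'' T (\<lambda>s3. keep NC RA s' s3 \<and>
        reals s3 a = (\<lambda>k l. if k = i \<and> l < Suc j then val k l else reals s' a k l) \<and> nats s3 y 0 0 = j)"
    proof (rule ach_conseq[OF b], elim conjE, intro conjI)
      fix s3 assume k3: "keep NB RB s'' s3" and a: "reals s3 a = (reals s'' a)(i := (reals s'' a i)(j := val i j))"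
      show "keep NC RA s' s3" by (rule keep_trans[OF k2 k3]) (use sub NC_def in auto)
      show "reals s3 a = (\<lambda>k l. if k = i \<and> l < Suc j then val k l else reals s' a k l)"
        unfolding a J2 by (intro ext) (simp add: less_Suc_eq)
      show "nats s3 y 0 0 = j" using y keep_nats[OF k3] sub by simp
    qed simp
  qed (use bound kt in auto)
  then show "ach Q (For y d c) s' (M * (T + 2) + 2)
     (\<lambda>s''. keep NA RA s s'' \<and> reals s'' a = (\<lambda>k l. if k < Suc i \<and> l < M then val k l else reals s a k l) \<and> nats s'' x 0 0 = i)"
  proof (rule ach_conseq, elim conjE, intro conjI)
    fix s'' assume k2: "keep NC RA s' s''" and a: "reals s'' a = (\<lambda>k l. if k = i \<and> l < M then val k l else reals s' a k l)"
    show "keep NA RA s s''" by (rule kt[OF k2])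
    show "reals s'' a = (\<lambda>k l. if k < Suc i \<and> l < M then val k l else reals s a k l)"
      unfolding a J by (intro ext) (simp add: less_Suc_eq)
    show "nats s'' x 0 0 = i" using x keep_nats[OF k2] NC by simp
  qed simp
qed (use bound in \<open>auto simp: algebra_simps\<close>)

section \<open>The program: distances and number of rows\<close>

abbreviation num_verts :: nexp where "num_verts \<equiv> NV 0"
abbreviation num_edges :: nexp where "num_edges \<equiv> NGet 0 NZ (NConst 1)"

text \<open>
  Use of the arrays. Naturals: 2 best cut found so far; 10 number \<open>m\<close> of rows; 11 \<open>2 ^ m\<close>; 12 is nonzero
  once a cut was found; 13 and 14 current cut and its complement; 15 current seed set; 16 to 18 scratch;
  from 20 on loop variables, where 23 is the row and 24 the column in the choice of signs.
  Reals: 10 squared distances; 11 rows of projections; 12 signed sums of rows, indexed by directions; 13 and 14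
  reaches and their sums; 15 sums of squares of the rows finished; 16 current row;
  17 the quantities \<open>rest\<close>; 18 current sign; 19 value of the best cut; from 20 on scratch.
\<close>

definition dist_prog :: prog where
  "dist_prog = For 20 num_verts (For 21 num_verts (Seq
     (sum_prog 22 30 num_verts Skip
        (RTimes (RMinus (RGet 2 (NV 20) (NV 22)) (RGet 2 (NV 21) (NV 22)))
                (RMinus (RGet 2 (NV 20) (NV 22)) (RGet 2 (NV 21) (NV 22)))))
     (RSet 10 (NV 20) (NV 21) (RV 30))))"

lemma ach_dist:
  assumes n: "nats s 0 0 0 = n"
  shows "ach Q dist_prog s (n * (n * (n * 4 + 6) + 4) + 2) (\<lambda>s'. keep {20, 21, 22} {10, 30} s s' \<and>
    reals s' 10 = (\<lambda>i j. if i < n \<and> j < n then rest (reals s 2) n 0 i j else reals s 10 i j))"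
proof (unfold dist_prog_def, rule ach_conseq[OF ach_fill2_real[where NB = "{22}" and RB = "{10, 30}"
      and N = n and M = n and T = "n * 4 + 4"]])
  fix i j s' assume k: "keep {20, 21, 22} {10, 30} s s'" and i: "nats s' 20 0 0 = i" and j: "nats s' 21 0 0 = j"
  note kn = keep_nats[OF k] keep_reals[OF k]
  let ?e = "RTimes (RMinus (RGet 2 (NV 20) (NV 22)) (RGet 2 (NV 21) (NV 22)))
                (RMinus (RGet 2 (NV 20) (NV 22)) (RGet 2 (NV 21) (NV 22)))"
  have "ach Q (sum_prog 22 30 num_verts Skip ?e) s' (n * (1 + 3) + 3) (\<lambda>s''. keep {22} {30} s' s'' \<and>
      reals s'' 30 0 0 = (\<Sum>c<n. (reals s 2 i c - reals s 2 j c)\<^sup>2))"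
  proof (rule ach_sum[where NB = "{}" and RB = "{}"])
    fix c s'' assume k2: "keep {22} {30} s' s''" and c: "nats s'' 22 0 0 = c"
    show "ach Q Skip s'' 1 (\<lambda>s3. keep {} {} s'' s3 \<and> rval ?e s3 = (reals s 2 i c - reals s 2 j c)\<^sup>2)"
      by (rule ach_Skip) (simp add: c i j kn keep_nats[OF k2] keep_reals[OF k2] power2_eq_square)
  qed (auto simp: n kn keep_nats)
  then show "ach Q (Seq (sum_prog 22 30 num_verts Skip ?e) (RSet 10 (NV 20) (NV 21) (RV 30))) s' (n * 4 + 4)
      (\<lambda>s''. keep {22} {10, 30} s' s'' \<and> reals s'' 10 = (reals s' 10)(i := (reals s' 10 i)(j := rest (reals s 2) n 0 i j)))"
  proof (intro ach_seq_RSet, rule ach_conseq, elim conjE, intro conjI)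
    fix s'' assume k2: "keep {22} {30} s' s''" and v: "reals s'' 30 0 0 = (\<Sum>c<n. (reals s 2 i c - reals s 2 j c)\<^sup>2)"
    show "keep {22} {10, 30} s' (rset s'' 10 (nval (NV 20) s'') (nval (NV 21) s'') (rval (RV 30) s''))"
      by (intro keep_rset keep_weaken[OF k2]) auto
    show "reals (rset s'' 10 (nval (NV 20) s'') (nval (NV 21) s'') (rval (RV 30) s'')) 10 =
        (reals s' 10)(i := (reals s' 10 i)(j := rest (reals s 2) n 0 i j))"
      by (simp add: v i j keep_nats[OF k2] keep_reals[OF k2] rest_def atLeast0LessThan)
  qed auto
qed (auto simp: n keep_nats)

definition log_prog :: prog where
  "log_prog = Seq (NSet 17 NZ NZ (NConst 1)) (Seq (NSet 10 NZ NZ NZ) (Seq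
     (For 20 num_verts (Cond (NLess (NV 17) num_verts)
        (Seq (NSet 17 NZ NZ (NPlus (NV 17) (NV 17))) (NSet 10 NZ NZ (NPlus (NV 10) (NConst 128)))) Skip))
     (Seq (NSet 11 NZ NZ (NConst 1)) (For 20 (NV 10) (NSet 11 NZ NZ (NPlus (NV 11) (NV 11)))))))"

text \<open>\<open>n\<close> rounds of doubling suffice because \<open>n \<le> 2 ^ n\<close>. The
  final power of two is below \<open>2 * n\<close>, which keeps \<open>2 ^ (128 * L)\<close>
  polynomial in \<open>n\<close>.\<close>

lemma ach_log:
  assumes n: "nats s 0 0 0 = n" "2 \<le> n"
  shows "ach Q log_prog s (n * 6 + 128 * n * 3 + 8) (\<lambda>s'. keep {10, 11, 17, 20} {} s s' \<and>
    (\<exists>L. 0 < L \<and> n \<le> 2 ^ L \<and> 2 ^ L \<le> 2 * n \<and> nats s' 10 0 0 = 128 * L \<and> nats s' 11 0 0 = 2 ^ (128 * L)))"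
proof -
  \<comment> \<open>\<open>L\<close> equals the number of rounds while doubling continues, and is
    frozen once \<open>2 ^ L\<close> reaches \<open>n\<close>.\<close>
  let ?J = "\<lambda>i s'. \<exists>L\<le>i. nats s' 17 0 0 = 2 ^ L \<and> nats s' 10 0 0 = 128 * L \<and> (L = i \<or> n \<le> 2 ^ L) \<and> 2 ^ L < 2 * n"
  let ?R = "\<lambda>s''. keep {10, 11, 17, 20} {} s s'' \<and>
    (\<exists>L. 0 < L \<and> n \<le> 2 ^ L \<and> 2 ^ L \<le> 2 * n \<and> nats s'' 10 0 0 = 128 * L \<and> nats s'' 11 0 0 = 2 ^ (128 * L))"
  define s2 where "s2 = nset (nset s 17 0 0 1) 10 0 0 0"
  let ?c = "Cond (NLess (NV 17) num_verts)
        (Seq (NSet 17 NZ NZ (NPlus (NV 17) (NV 17))) (NSet 10 NZ NZ (NPlus (NV 10) (NConst 128)))) Skip"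
  let ?d = "NSet 11 NZ NZ (NPlus (NV 11) (NV 11))"
  have k2: "keep {10, 17, 20} {} s s2" unfolding s2_def by (intro keep_nset) auto
  have n2: "nats s2 0 0 0 = n" using n by (simp add: s2_def)
  have 1: "ach Q (For 20 num_verts ?c) s2 (n * (4 + 2) + 2) (\<lambda>s'. keep {10, 17, 20} {} s2 s' \<and> ?J n s')"
  proof (rule ach_For[where J = ?J])
    fix i s' assume i: "i < n" and k: "keep {10, 17, 20} {} s2 s'" and J: "?J i s'" and x: "nats s' 20 0 0 = i"
    from J obtain L where L: "L \<le> i" "nats s' 17 0 0 = 2 ^ L" "nats s' 10 0 0 = 128 * L" "L = i \<or> n \<le> 2 ^ L" "2 ^ L < 2 * n"
      by auto
    have n': "nats s' 0 0 0 = n" using keep_nats[OF k, of 0] n2 by simp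
    show "ach Q ?c s' 4 (\<lambda>s''. keep {10, 17, 20} {} s2 s'' \<and> ?J (Suc i) s'' \<and> nats s'' 20 0 0 = i)"
    proof (rule ach_cond[where ?T1.0 = 2])
      assume b: "bval (NLess (NV 17) num_verts) s'"
      then have Li: "L = i" "2 ^ i < n" using L n' by auto
      show "ach Q (Seq (NSet 17 NZ NZ (NPlus (NV 17) (NV 17))) (NSet 10 NZ NZ (NPlus (NV 10) (NConst 128)))) s' 2
         (\<lambda>s''. keep {10, 17, 20} {} s2 s'' \<and> ?J (Suc i) s'' \<and> nats s'' 20 0 0 = i)"
        by (rule ach_NSet_seq, rule ach_NSet)
           (use k x L Li in \<open>auto intro!: keep_nset exI[of _ "Suc i"]\<close>)
    next
      assume "\<not> bval (NLess (NV 17) num_verts) s'"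
      then have "n \<le> 2 ^ L" using L n' by simp
      then have "?J (Suc i) s'" using L by (intro exI[of _ L]) auto
      then show "ach Q Skip s' 2 (\<lambda>s''. keep {10, 17, 20} {} s2 s'' \<and> ?J (Suc i) s'' \<and> nats s'' 20 0 0 = i)"
        using k x by (intro ach_time[OF ach_Skip]) auto
    qed simp
  next
    show "?J 0 s2" using n by (auto simp: s2_def)
  qed (auto simp: n2 keep_nats)
  have 2: "ach Q (Seq (NSet 11 NZ NZ (NConst 1)) (For 20 (NV 10) ?d)) s' (128 * n * 3 + 3) ?R"
    if kJ: "keep {10, 17, 20} {} s2 s' \<and> ?J n s'" for s'
  proof -
    have k: "keep {10, 17, 20} {} s2 s'" using kJ by blast
    from kJ obtain L where L: "L \<le> n" "nats s' 10 0 0 = 128 * L" "L = n \<or> n \<le> 2 ^ L" "2 ^ L < 2 * n" by auto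
    have nL: "n \<le> 2 ^ L" using L(3) less_exp[of n] by auto
    have L0: "0 < L" using nL n by (cases L) auto
    let ?s3 = "nset s' 11 0 0 1"
    have k3: "keep {10, 11, 17, 20} {} s ?s3"
      by (intro keep_nset keep_trans[OF k2 k]) auto
    have "ach Q (For 20 (NV 10) ?d) ?s3 (128 * L * (1 + 2) + 2)
        (\<lambda>s''. keep {11, 20} {} ?s3 s'' \<and> nats s'' 11 0 0 = 2 ^ (128 * L))"
    proof (rule ach_For[where J = "\<lambda>i s''. nats s'' 11 0 0 = 2 ^ i"])
      fix i s'' assume "keep {11, 20} {} ?s3 s''" "nats s'' 11 0 0 = 2 ^ i" "nats s'' 20 0 0 = i"
      then show "ach Q ?d s'' 1 (\<lambda>s''. keep {11, 20} {} ?s3 s'' \<and> nats s'' 11 0 0 = 2 ^ Suc i \<and> nats s'' 20 0 0 = i)"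
        by (intro ach_NSet) (auto intro!: keep_nset)
    qed (auto simp: L keep_nats)
    then have F: "ach Q (For 20 (NV 10) ?d) ?s3 (128 * n * 3 + 2) ?R"
    proof (rule ach_conseq, elim conjE, intro conjI)
      fix s'' assume k4: "keep {11, 20} {} ?s3 s''" and e: "nats s'' 11 0 0 = 2 ^ (128 * L)"
      show "keep {10, 11, 17, 20} {} s s''" by (rule keep_trans[OF k3 k4]) auto
      show "\<exists>L. 0 < L \<and> n \<le> 2 ^ L \<and> 2 ^ L \<le> 2 * n \<and> nats s'' 10 0 0 = 128 * L \<and> nats s'' 11 0 0 = 2 ^ (128 * L)"
        using L0 nL L e keep_nats[OF k4, of 10] by (intro exI[of _ L]) auto
    qed (use L in simp)
    show ?thesis by (rule ach_NSet_seq, simp only: nval.simps, rule F, simp)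
  qed
  have F: "ach Q (Seq (For 20 num_verts ?c) (Seq (NSet 11 NZ NZ (NConst 1)) (For 20 (NV 10) ?d))) s2 (n * 6 + 128 * n * 3 + 6) ?R"
    by (rule ach_seq[OF 1 2]) simp_all
  show ?thesis
    unfolding log_prog_def
    by (rule ach_NSet_seq, rule ach_NSet_seq, simp only: nval.simps s2_def[symmetric], rule F, rule order_refl, simp)
qed

section \<open>Evaluating the potential\<close>

lemma ach_power:
  assumes m: "nats s 10 0 0 = m" and t: "t \<noteq> 10"
  shows "ach Q (Seq (RSet y NZ NZ e) (For t (NV 10) (RSet y NZ NZ (RTimes (RV y) (RV y))))) s (m * 3 + 3)
    (\<lambda>s'. keep {t} {y} s s' \<and> reals s' y 0 0 = (rval e s) ^ (2 ^ m))"
proof (rule ach_RSet_seq)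
  let ?s1 = "rset s y (nval NZ s) (nval NZ s) (rval e s)"
  have k1: "keep {t} {y} s ?s1" by (intro keep_rset) auto
  have "ach Q (For t (NV 10) (RSet y NZ NZ (RTimes (RV y) (RV y)))) ?s1 (m * (1 + 2) + 2)
    (\<lambda>s'. keep {t} {y} ?s1 s' \<and> reals s' y 0 0 = (rval e s) ^ (2 ^ m))"
  proof (rule ach_For[where J = "\<lambda>i s'. reals s' y 0 0 = (rval e s) ^ (2 ^ i)"])
    fix i s' assume "keep {t} {y} ?s1 s'" "reals s' y 0 0 = rval e s ^ 2 ^ i" "nats s' t 0 0 = i"
    then show "ach Q (RSet y NZ NZ (RTimes (RV y) (RV y))) s' 1
       (\<lambda>s''. keep {t} {y} ?s1 s'' \<and> reals s'' y 0 0 = rval e s ^ 2 ^ Suc i \<and> nats s'' t 0 0 = i)"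
      by (intro ach_RSet) (auto intro!: keep_rset simp: power_add[symmetric] mult_2)
  qed (use m t in \<open>auto simp: keep_nats\<close>)
  then show "ach Q (For t (NV 10) (RSet y NZ NZ (RTimes (RV y) (RV y)))) ?s1 (m * 3 + 2)
    (\<lambda>s'. keep {t} {y} s s' \<and> reals s' y 0 0 = (rval e s) ^ (2 ^ m))"
    by (rule ach_conseq) (auto intro: keep_trans[OF k1])
qed simp

definition power_prog :: "nat \<Rightarrow> nat \<Rightarrow> rexp \<Rightarrow> prog" where
  "power_prog y t e = Seq (RSet y NZ NZ e) (For t (NV 10) (RSet y NZ NZ (RTimes (RV y) (RV y))))"

definition entry :: "nat \<Rightarrow> rexp" where
  "entry a = RGet a (NV 21) (NV 22)"

definition signed_exp :: rexp where
  "signed_exp = RPlus (RMinus (RGet 16 (NV 21) NZ) (RGet 16 (NV 22) NZ))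
     (RTimes (RV 18) (RMinus (RGet 2 (NV 21) (NV 24)) (RGet 2 (NV 22) (NV 24))))"

text \<open>Follows \<open>up_exponent\<close> operation by operation, including the division by a
  zero distance, which yields 0 in both.\<close>

definition up_exp :: rexp where
  "up_exp = RDivide (RMinus (RPlus (RPlus (RDivide (entry 15) (RC 8))
       (RDivide (RTimes (RPlus (RC 1) (RDivide (entry 17) (entry 10))) (RTimes (RV 34) (RV 34))) (RC 8)))
       (RDivide (entry 17) (RC 4)))
     (RDivide (RTimes (RPlus (ROfNat (NV 23)) (RC 1)) (entry 10)) (RC 4))) (entry 10)"

definition lo_exp :: rexp where
  "lo_exp = RMinus (RC 0) (RDivide (RMinus (RPlus (RPlus (RDivide (entry 15) (RC 8))
       (RDivide (RTimes (RMinus (RC 1) (RDivide (RDivide (entry 17) (entry 10)) (RC 2))) (RTimes (RV 34) (RV 34))) (RC 8)))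
       (RDivide (entry 17) (RC 16)))
     (RDivide (RTimes (RPlus (ROfNat (NV 23)) (RC 1)) (entry 10)) (RC 16))) (entry 10))"

definition pair_prog :: prog where
  "pair_prog = Seq (RSet 34 NZ NZ signed_exp) (Seq
     (power_prog 32 25 (RPlus (RC 1) (RDivide up_exp (ROfNat (NV 11)))))
     (power_prog 33 25 (RPlus (RC 1) (RDivide lo_exp (ROfNat (NV 11))))))"

definition potential_prog :: prog where
  "potential_prog = sum_prog 21 20 num_verts
     (sum_prog 22 31 num_verts pair_prog (RPlus (RV 32) (RV 33))) (RV 31)"

lemma ach_pair:
  assumes m: "nats s 10 0 0 = m" "nats s 11 0 0 = 2 ^ m"
    and ij: "nats s 21 0 0 = i" "nats s 22 0 0 = j" and kc: "nats s 23 0 0 = k" "nats s 24 0 0 = c"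
  defines "z \<equiv> reals s 16 i 0 - reals s 16 j 0 + reals s 18 0 0 * (reals s 2 i c - reals s 2 j c)"
  shows "ach Q pair_prog s (6 * m + 7) (\<lambda>s'. keep {25} {32, 33, 34} s s' \<and> reals s' 32 0 0 + reals s' 33 0 0 =
    exp_approx m (up_exponent k (reals s 15 i j) z (reals s 17 i j) (reals s 10 i j)) +
    exp_approx m (lo_exponent k (reals s 15 i j) z (reals s 17 i j) (reals s 10 i j)))"
proof -
  let ?s1 = "rset s 34 0 0 z"
  have e: "rval signed_exp s = z"
    by (simp add: signed_exp_def z_def ij kc)
  have k1: "keep {25} {34} s ?s1" by (intro keep_rset) auto
  let ?u = "up_exponent k (reals s 15 i j) z (reals s 17 i j) (reals s 10 i j)"
  let ?l = "lo_exponent k (reals s 15 i j) z (reals s 17 i j) (reals s 10 i j)"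
  let ?eu = "RPlus (RC 1) (RDivide up_exp (ROfNat (NV 11)))"
  let ?el = "RPlus (RC 1) (RDivide lo_exp (ROfNat (NV 11)))"
  have u: "rval ?eu ?s1 = 1 + ?u / 2 ^ m"
    by (simp add: up_exp_def entry_def up_exponent_def ij kc m)
  have 1: "ach Q (power_prog 32 25 ?eu) ?s1 (m * 3 + 3) (\<lambda>s'. keep {25} {32} ?s1 s' \<and> reals s' 32 0 0 = exp_approx m ?u)"
    unfolding exp_approx_def u[symmetric] power_prog_def by (rule ach_power) (simp_all add: m)
  have 2: "ach Q (power_prog 33 25 ?el) s' (m * 3 + 3) (\<lambda>s'. keep {25} {32, 33, 34} s s' \<and>
      reals s' 32 0 0 + reals s' 33 0 0 = exp_approx m ?u + exp_approx m ?l)"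
    if k: "keep {25} {32} ?s1 s' \<and> reals s' 32 0 0 = exp_approx m ?u" for s'
  proof -
    have k2: "keep {25} {32} ?s1 s'" using k by blast
    note kn = keep_nats[OF k2] keep_reals[OF k2]
    have l: "rval ?el s' = 1 + ?l / 2 ^ m"
      by (simp add: kn lo_exp_def entry_def lo_exponent_def ij kc m)
    have "ach Q (power_prog 33 25 ?el) s' (m * 3 + 3) (\<lambda>s''. keep {25} {33} s' s'' \<and> reals s'' 33 0 0 = exp_approx m ?l)"
      unfolding exp_approx_def l[symmetric] power_prog_def by (rule ach_power) (simp_all add: m kn)
    then show ?thesis
    proof (rule ach_conseq, elim conjE, intro conjI)
      fix s'' assume k3: "keep {25} {33} s' s''" and v: "reals s'' 33 0 0 = exp_approx m ?l"
      have "keep {25} {32, 34} s s'" by (rule keep_trans[OF k1 k2]) auto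
      then show "keep {25} {32, 33, 34} s s''" by (rule keep_trans[OF _ k3]) auto
      show "reals s'' 32 0 0 + reals s'' 33 0 0 = exp_approx m ?u + exp_approx m ?l"
        using v k keep_reals[OF k3, of 32] by simp
    qed simp
  qed
  show ?thesis
    unfolding pair_prog_def
    by (rule ach_RSet_seq, simp only: e nval.simps, rule ach_seq[OF 1 2], assumption, rule order_refl, simp)
qed

text \<open>The current column is already removed from array 17 while its sign in array 18 is still
  tentative; hence \<open>Suc c\<close> in the potential together with an explicit term for column
  \<open>c\<close>.\<close>

lemma ach_potential:
  assumes n: "nats s 0 0 0 = n" and m: "nats s 10 0 0 = m" "nats s 11 0 0 = 2 ^ m"
    and kc: "nats s 23 0 0 = k" "nats s 24 0 0 = c"
    and R: "\<And>i j. i < n \<Longrightarrow> j < n \<Longrightarrow> reals s 17 i j = rest (reals s 2) n (Suc c) i j"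
    and D: "\<And>i j. i < n \<Longrightarrow> j < n \<Longrightarrow> reals s 10 i j = rest (reals s 2) n 0 i j"
  shows "ach Q potential_prog s (n * (n * (6 * m + 10) + 6) + 3) (\<lambda>s'. keep {21, 22, 25} {20, 31, 32, 33, 34} s s' \<and>
    reals s' 20 0 0 = potential (exp_approx m) (reals s 2) n k (Suc c) (reals s 15)
      (\<lambda>i j. reals s 16 i 0 - reals s 16 j 0 + reals s 18 0 0 * (reals s 2 i c - reals s 2 j c)))"
proof -
  let ?z = "\<lambda>i j. reals s 16 i 0 - reals s 16 j 0 + reals s 18 0 0 * (reals s 2 i c - reals s 2 j c)"
  let ?e = "\<lambda>i j. exp_approx m (up_exponent k (reals s 15 i j) (?z i j) (rest (reals s 2) n (Suc c) i j) (rest (reals s 2) n 0 i j)) +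
    exp_approx m (lo_exponent k (reals s 15 i j) (?z i j) (rest (reals s 2) n (Suc c) i j) (rest (reals s 2) n 0 i j))"
  have "ach Q potential_prog s (n * (n * (6 * m + 7 + 3) + 3 + 3) + 3) (\<lambda>s'. keep {21, 22, 25} {20, 31, 32, 33, 34} s s' \<and>
    reals s' 20 0 0 = (\<Sum>i<n. \<Sum>j<n. ?e i j))"
    unfolding potential_prog_def
  proof (rule ach_sum[where NB = "{22, 25}" and RB = "{31, 32, 33, 34}"])
    fix i s1 assume i: "i < n" and k1: "keep {21, 22, 25} {20, 31, 32, 33, 34} s s1" and x: "nats s1 21 0 0 = i"
    show "ach Q (sum_prog 22 31 num_verts pair_prog (RPlus (RV 32) (RV 33))) s1 (n * (6 * m + 7 + 3) + 3)
       (\<lambda>s''. keep {22, 25} {31, 32, 33, 34} s1 s'' \<and> rval (RV 31) s'' = (\<Sum>j<n. ?e i j))"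
      unfolding rval.simps nval.simps
    proof (rule ach_sum[where NB = "{25}" and RB = "{32, 33, 34}"])
      fix j s2 assume j: "j < n" and k2: "keep {22, 25} {31, 32, 33, 34} s1 s2" and y: "nats s2 22 0 0 = j"
      note kn = keep_nats[OF k1] keep_reals[OF k1] keep_nats[OF k2] keep_reals[OF k2]
      have "ach Q pair_prog s2 (6 * m + 7) (\<lambda>s'. keep {25} {32, 33, 34} s2 s' \<and> reals s' 32 0 0 + reals s' 33 0 0 =
          exp_approx m (up_exponent k (reals s2 15 i j) (reals s2 16 i 0 - reals s2 16 j 0 + reals s2 18 0 0 * (reals s2 2 i c - reals s2 2 j c)) (reals s2 17 i j) (reals s2 10 i j)) +
          exp_approx m (lo_exponent k (reals s2 15 i j) (reals s2 16 i 0 - reals s2 16 j 0 + reals s2 18 0 0 * (reals s2 2 i c - reals s2 2 j c)) (reals s2 17 i j) (reals s2 10 i j)))"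
        by (rule ach_pair) (simp_all add: kn m kc x y)
      then show "ach Q pair_prog s2 (6 * m + 7)
        (\<lambda>s''. keep {25} {32, 33, 34} s2 s'' \<and> rval (RPlus (RV 32) (RV 33)) s'' = ?e i j)"
        by (simp add: kn R[OF i j] D[OF i j])
    qed (auto simp: n keep_nats[OF k1] keep_nats)
  qed (auto simp: n keep_nats)
  then show ?thesis
    by (rule ach_conseq) (simp_all add: potential_def)
qed

section \<open>Choosing the signs\<close>

definition column_prog :: prog where
  "column_prog = Seq
     (For 21 num_verts (For 22 num_verts (RSet 17 (NV 21) (NV 22) (RMinus (entry 17)
        (RTimes (RMinus (RGet 2 (NV 21) (NV 24)) (RGet 2 (NV 22) (NV 24)))
                (RMinus (RGet 2 (NV 21) (NV 24)) (RGet 2 (NV 22) (NV 24))))))))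
     (Seq (RSet 18 NZ NZ (RC 1)) (Seq potential_prog (Seq (RSet 35 NZ NZ (RV 20))
     (Seq (RSet 18 NZ NZ (RMinus (RC 0) (RC 1))) (Seq potential_prog
     (Seq (Cond (RLess (RV 20) (RV 35)) Skip (RSet 18 NZ NZ (RC 1)))
     (For 21 num_verts (RSet 16 (NV 21) NZ (RPlus (RGet 16 (NV 21) NZ) (RTimes (RV 18) (RGet 2 (NV 21) (NV 24))))))))))))"

text \<open>Both signs are tried and a tie selects 1. The partial sums in array 16 change only after
  the decision, so both trials see the same state, as \<open>signs_inv_column\<close>
  demands.\<close>

lemma ach_column:
  assumes sc: "sign_choice n m L" and c: "c < n" and k: "k < m"
    and n: "nats s 0 0 0 = n" and m: "nats s 10 0 0 = m" "nats s 11 0 0 = 2 ^ m"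
    and kc: "nats s 23 0 0 = k" "nats s 24 0 0 = c"
    and R: "\<And>i j. i < n \<Longrightarrow> j < n \<Longrightarrow> reals s 17 i j = rest (reals s 2) n c i j"
    and D: "\<And>i j. i < n \<Longrightarrow> j < n \<Longrightarrow> reals s 10 i j = rest (reals s 2) n 0 i j"
    and inv: "signs_inv (reals s 2) n m k c (reals s 15) (\<lambda>i. reals s 16 i 0)"
  shows "ach Q column_prog s (n * (n * (12 * m + 23) + 19) + 20)
    (\<lambda>s'. keep {21, 22, 25} {16, 17, 18, 20, 31, 32, 33, 34, 35} s s' \<and>
      (\<forall>i<n. \<forall>j<n. reals s' 17 i j = rest (reals s 2) n (Suc c) i j) \<and>
      signs_inv (reals s 2) n m k (Suc c) (reals s 15) (\<lambda>i. reals s' 16 i 0))"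
proof -
  let ?v = "reals s 2"
  let ?NA = "{21, 22, 25} :: nat set" and ?RA = "{16, 17, 18, 20, 31, 32, 33, 34, 35} :: nat set"
  define pt where "pt \<sigma> = potential (exp_approx m) ?v n k (Suc c) (reals s 15)
      (\<lambda>i j. reals s 16 i 0 - reals s 16 j 0 + \<sigma> * (?v i c - ?v j c))" for \<sigma>
  let ?c1 = "For 21 num_verts (For 22 num_verts (RSet 17 (NV 21) (NV 22) (RMinus (entry 17)
        (RTimes (RMinus (RGet 2 (NV 21) (NV 24)) (RGet 2 (NV 22) (NV 24)))
                (RMinus (RGet 2 (NV 21) (NV 24)) (RGet 2 (NV 22) (NV 24)))))))"
  let ?c7 = "For 21 num_verts (RSet 16 (NV 21) NZ (RPlus (RGet 16 (NV 21) NZ) (RTimes (RV 18) (RGet 2 (NV 21) (NV 24)))))"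
  let ?c6 = "Cond (RLess (RV 20) (RV 35)) Skip (RSet 18 NZ NZ (RC 1))"
  let ?R = "\<lambda>s'. keep ?NA ?RA s s' \<and>
    (\<forall>i<n. \<forall>j<n. reals s' 17 i j = rest ?v n (Suc c) i j) \<and>
    signs_inv ?v n m k (Suc c) (reals s 15) (\<lambda>i. reals s' 16 i 0)"
  define G where "G s' \<longleftrightarrow> keep ?NA ?RA s s' \<and> (\<forall>i<n. \<forall>j<n. reals s' 17 i j = rest ?v n (Suc c) i j) \<and>
      reals s' 16 = reals s 16" for s'
  have Gn: "nats s' 0 0 0 = n" "nats s' 10 0 0 = m" "nats s' 11 0 0 = 2 ^ m" "nats s' 23 0 0 = k" "nats s' 24 0 0 = c"
      "reals s' 2 = ?v" "reals s' 10 = reals s 10" "reals s' 15 = reals s 15" "reals s' 16 = reals s 16" if "G s'" for s'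
    using that n m kc unfolding G_def by (auto simp: keep_nats keep_reals)
  have G_keep: "G s''" if "G s'" "keep ?NA {18, 20, 31, 32, 33, 34, 35} s' s''" for s' s''
    using that unfolding G_def by (auto intro: keep_trans simp: keep_reals)
  have 1: "ach Q ?c1 s (n * (n * 3 + 4) + 2) G"
  proof (rule ach_conseq[OF ach_fill2_real[where NB = "{}" and RB = "{17}" and NA = "{21, 22}" and RA = "{17}" and N = n and M = n and T = 1]])
    fix i j s' assume ks: "keep {21, 22} {17} s s'" and x: "nats s' 21 0 0 = i" and y: "nats s' 22 0 0 = j"
      and old: "reals s' 17 i j = reals s 17 i j" and ij: "i < n" "j < n"
    show "ach Q (RSet 17 (NV 21) (NV 22) (RMinus (entry 17)
        (RTimes (RMinus (RGet 2 (NV 21) (NV 24)) (RGet 2 (NV 22) (NV 24)))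
                (RMinus (RGet 2 (NV 21) (NV 24)) (RGet 2 (NV 22) (NV 24)))))) s' 1
        (\<lambda>s''. keep {} {17} s' s'' \<and> reals s'' 17 = (reals s' 17)(i := (reals s' 17 i)(j := rest ?v n (Suc c) i j)))"
    proof (rule ach_RSet, intro conjI)
      show "keep {} {17} s' (rset s' 17 (nval (NV 21) s') (nval (NV 22) s') (rval (RMinus (entry 17)
        (RTimes (RMinus (RGet 2 (NV 21) (NV 24)) (RGet 2 (NV 22) (NV 24)))
                (RMinus (RGet 2 (NV 21) (NV 24)) (RGet 2 (NV 22) (NV 24))))) s'))"
        by (intro keep_rset) auto
      have "rest ?v n (Suc c) i j = reals s 17 i j - (?v i c - ?v j c) * (?v i c - ?v j c)"
        unfolding R[OF ij] rest_Suc[OF c] power2_eq_square by simp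
      moreover have "nats s' 24 = nats s 24" "reals s' 2 = ?v" using keep_nats[OF ks] keep_reals[OF ks] by auto
      ultimately show "reals (rset s' 17 (nval (NV 21) s') (nval (NV 22) s') (rval (RMinus (entry 17)
        (RTimes (RMinus (RGet 2 (NV 21) (NV 24)) (RGet 2 (NV 22) (NV 24)))
                (RMinus (RGet 2 (NV 21) (NV 24)) (RGet 2 (NV 22) (NV 24))))) s')) 17 =
          (reals s' 17)(i := (reals s' 17 i)(j := rest ?v n (Suc c) i j))"
        by (simp add: x y old entry_def kc)
    qed
  next
    fix s' assume *: "keep {21, 22} {17} s s' \<and>
      reals s' 17 = (\<lambda>k l. if k < n \<and> l < n then rest ?v n (Suc c) k l else reals s 17 k l)"
    then have k: "keep {21, 22} {17} s s'" by blast
    then have "keep ?NA ?RA s s'" by (rule keep_weaken) auto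
    moreover have "reals s' 16 = reals s 16" using keep_reals[OF k] by simp
    ultimately show "G s'" using * unfolding G_def by simp
  qed (auto simp: n keep_nats)
  let ?G = "\<lambda>s'. G s' \<and> (\<exists>\<sigma>. (\<sigma> = 1 \<or> \<sigma> = -1) \<and> reals s' 18 0 0 = \<sigma> \<and> pt \<sigma> \<le> pt (- \<sigma>))"
  let ?T = "n * (n * (6 * m + 10) + 6) + 3"
  have pot: "ach Q potential_prog (rset s' 18 0 0 \<sigma>) ?T
      (\<lambda>s''. G s'' \<and> reals s'' 18 0 0 = \<sigma> \<and> reals s'' 20 0 0 = pt \<sigma> \<and> reals s'' 35 = reals s' 35)"
    if g: "G s'" for s' \<sigma>
  proof (rule ach_conseq[OF ach_potential[where n = n and m = m and k = k and c = c]], goal_cases)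
    case (8 s'')
    then have k8: "keep {21, 22, 25} {20, 31, 32, 33, 34} (rset s' 18 0 0 \<sigma>) s''" by blast
    have "keep ?NA {18, 20, 31, 32, 33, 34, 35} s' s''"
      by (rule keep_trans[OF keep_rset[OF keep_refl, of 18 "{18}" "{}"] k8]) auto
    then have "G s''" by (rule G_keep[OF g])
    then show ?case using 8 keep_reals[OF k8] Gn[OF g] by (simp add: pt_def)
  qed (use g Gn[OF g] D in \<open>auto simp: G_def\<close>)
  have 7: "ach Q ?c7 s' (n * 3 + 2) ?R"
    if H: "G s' \<and> (\<exists>\<sigma>. (\<sigma> = 1 \<or> \<sigma> = -1) \<and> reals s' 18 0 0 = \<sigma> \<and> pt \<sigma> \<le> pt (- \<sigma>))" for s'
  proof -
    from H obtain \<sigma> where g: "G s'" and \<sigma>: "\<sigma> = 1 \<or> \<sigma> = -1" "reals s' 18 0 0 = \<sigma>" "pt \<sigma> \<le> pt (- \<sigma>)" by blast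
    have "ach Q ?c7 s' (n * (1 + 2) + 2) (\<lambda>s''. keep {21} {16} s' s'' \<and>
        reals s'' 16 = (\<lambda>i l. if i < n \<and> l = 0 then reals s 16 i 0 + \<sigma> * ?v i c else reals s' 16 i l))"
    proof (rule ach_fill1_real[where NB = "{}" and RB = "{16}"])
      fix i s'' assume ks: "keep {21} {16} s' s''" and x: "nats s'' 21 0 0 = i" and old: "reals s'' 16 i 0 = reals s' 16 i 0"
      show "ach Q (RSet 16 (NV 21) NZ (RPlus (RGet 16 (NV 21) NZ) (RTimes (RV 18) (RGet 2 (NV 21) (NV 24))))) s'' 1
        (\<lambda>s3. keep {} {16} s'' s3 \<and> reals s3 16 = (reals s'' 16)(i := (reals s'' 16 i)(0 := reals s 16 i 0 + \<sigma> * ?v i c)))"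
        by (rule ach_RSet) (simp add: x old Gn[OF g] \<sigma>(2) keep_nats[OF ks] keep_reals[OF ks] keep_rset)
    qed (auto simp: Gn[OF g] keep_nats)
    then show ?thesis
    proof (rule ach_conseq, elim conjE, intro conjI)
      fix s'' assume ks: "keep {21} {16} s' s''"
        and v: "reals s'' 16 = (\<lambda>i l. if i < n \<and> l = 0 then reals s 16 i 0 + \<sigma> * ?v i c else reals s' 16 i l)"
      have "keep ?NA ?RA s s'" using g by (simp add: G_def)
      then show "keep ?NA ?RA s s''" by (rule keep_trans[OF _ ks]) auto
      show "\<forall>i<n. \<forall>j<n. reals s'' 17 i j = rest ?v n (Suc c) i j"
        using g keep_reals[OF ks, of 17] by (simp add: G_def)
      show "signs_inv ?v n m k (Suc c) (reals s 15) (\<lambda>i. reals s'' 16 i 0)"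
        by (rule sign_choice.signs_inv_column[OF sc inv k c \<sigma>(1) _ \<sigma>(3)[unfolded pt_def]]) (simp add: v)
    qed simp
  qed
  have 6: "ach Q ?c6 s' 2 ?G"
    if H: "G s' \<and> reals s' 18 0 0 = -1 \<and> reals s' 20 0 0 = pt (-1) \<and> reals s' 35 0 0 = pt 1" for s'
  proof (rule ach_cond[where ?T1.0 = 1])
    assume "bval (RLess (RV 20) (RV 35)) s'"
    then have b: "pt (- 1) \<le> pt (- (- 1))" using H by simp
    show "ach Q Skip s' 1 ?G"
    proof (rule ach_Skip)
      show "G s' \<and> (\<exists>\<sigma>. (\<sigma> = 1 \<or> \<sigma> = -1) \<and> reals s' 18 0 0 = \<sigma> \<and> pt \<sigma> \<le> pt (- \<sigma>))"
        using H b by blast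
    qed
  next
    assume "\<not> bval (RLess (RV 20) (RV 35)) s'"
    then have b: "pt 1 \<le> pt (- 1)" using H by simp
    have "G (rset s' 18 0 0 1)"
      by (rule G_keep[of s'], use H in blast, rule keep_rset[OF keep_refl]) simp
    moreover have "reals (rset s' 18 0 0 1) 18 0 0 = 1" by simp
    ultimately have "G (rset s' 18 0 0 1) \<and> (\<exists>\<sigma>. (\<sigma> = 1 \<or> \<sigma> = -1) \<and> reals (rset s' 18 0 0 1) 18 0 0 = \<sigma> \<and> pt \<sigma> \<le> pt (- \<sigma>))"
      using b by blast
    then show "ach Q (RSet 18 NZ NZ (RC 1)) s' 1 ?G"
      by (intro ach_RSet) (simp only: nval.simps rval.simps of_nat_1)
  qed simp
  have 5: "ach Q (Seq (RSet 18 NZ NZ (RMinus (RC 0) (RC 1))) (Seq potential_prog (Seq ?c6 ?c7))) s' (?T + (n * 3 + 5))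
     ?R"
    if H: "G s' \<and> reals s' 35 0 0 = pt 1" for s'
  proof (rule ach_RSet_seq)
    have p: "ach Q potential_prog (rset s' 18 0 0 (-1)) ?T
        (\<lambda>s''. G s'' \<and> reals s'' 18 0 0 = -1 \<and> reals s'' 20 0 0 = pt (-1) \<and> reals s'' 35 0 0 = pt 1)"
      by (rule ach_conseq[OF pot]) (use H in auto)
    have "ach Q (Seq potential_prog (Seq ?c6 ?c7)) (rset s' 18 0 0 (-1)) (?T + (n * 3 + 4))
      ?R"
      by (rule ach_seq[OF p], rule ach_seq[OF 6 7], assumption, assumption, rule order_refl, simp)
    then show "ach Q (Seq potential_prog (Seq ?c6 ?c7))
       (rset s' 18 (nval NZ s') (nval NZ s') (rval (RMinus (RC 0) (RC 1)) s')) (?T + (n * 3 + 4))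
      ?R"
      by simp
  qed simp
  have 35: "ach Q (RSet 35 NZ NZ (RV 20)) s' 1 (\<lambda>s'. G s' \<and> reals s' 35 0 0 = pt 1)"
    if H: "G s' \<and> reals s' 18 0 0 = 1 \<and> reals s' 20 0 0 = pt 1 \<and> X s'" for s' X
    by (rule ach_RSet) (use H in \<open>auto intro!: G_keep[of s'] keep_rset\<close>)
  have 2: "ach Q (Seq (RSet 18 NZ NZ (RC 1)) (Seq potential_prog (Seq (RSet 35 NZ NZ (RV 20))
     (Seq (RSet 18 NZ NZ (RMinus (RC 0) (RC 1))) (Seq potential_prog (Seq ?c6 ?c7)))))) s' (2 * ?T + (n * 3 + 7))
     ?R"
    if H: "G s'" for s'
    by (rule ach_RSet_seq, simp only: nval.simps rval.simps of_nat_1, rule ach_seq[OF pot[OF H]],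
        rule ach_seq[OF 35 5], assumption, assumption, rule order_refl, rule order_refl, simp)
  show ?thesis
    unfolding column_prog_def by (rule ach_seq[OF 1 2]) (simp_all add: algebra_simps)
qed

definition row_prog :: prog where
  "row_prog = Seq (For 21 num_verts (RSet 16 (NV 21) NZ (RC 0)))
     (Seq (For 21 num_verts (For 22 num_verts (RSet 17 (NV 21) (NV 22) (entry 10))))
     (Seq (For 24 num_verts column_prog)
     (Seq (For 21 num_verts (For 22 num_verts (RSet 15 (NV 21) (NV 22) (RPlus (entry 15)
        (RTimes (RMinus (RGet 16 (NV 21) NZ) (RGet 16 (NV 22) NZ)) (RMinus (RGet 16 (NV 21) NZ) (RGet 16 (NV 22) NZ)))))))
     (For 21 num_verts (RSet 11 (NV 23) (NV 21) (RGet 16 (NV 21) NZ))))))"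

lemma signs_inv_cong:
  assumes "\<And>i. i < n \<Longrightarrow> q i = q' i"
  shows "signs_inv v n m k c X q \<longleftrightarrow> signs_inv v n m k c X q'"
proof -
  have "potential exp v n k c X (\<lambda>i j. q i - q j) = potential exp v n k c X (\<lambda>i j. q' i - q' j)"
    by (rule potential_cong) (auto simp: assms)
  then show ?thesis using assms by (auto simp: signs_inv_def)
qed

definition column_time :: "nat \<Rightarrow> nat \<Rightarrow> nat" where
  "column_time n m = n * (n * (12 * m + 23) + 19) + 20"

definition row_time :: "nat \<Rightarrow> nat \<Rightarrow> nat" where
  "row_time n m = n * (column_time n m + 2) + 2 + 2 * (n * (n * 3 + 4) + 2) + 2 * (n * 3 + 2)"

text \<open>The new row appears as an existential \<open>q\<close> that both extends array 11 and
  explains the growth of array 15. This lets the outer loop identify array 15 with the sums of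
  squares over the stored rows.\<close>

lemma ach_row:
  assumes sc: "sign_choice n m L" and k: "k < m"
    and n: "nats s 0 0 0 = n" and m: "nats s 10 0 0 = m" "nats s 11 0 0 = 2 ^ m" and k23: "nats s 23 0 0 = k"
    and D: "\<And>i j. i < n \<Longrightarrow> j < n \<Longrightarrow> reals s 10 i j = rest (reals s 2) n 0 i j"
    and inv: "signs_inv (reals s 2) n m k 0 (reals s 15) (\<lambda>i. 0)"
  shows "ach Q row_prog s (row_time n m)
    (\<lambda>s'. keep {21, 22, 24, 25} {11, 15, 16, 17, 18, 20, 31, 32, 33, 34, 35} s s' \<and>
      signs_inv (reals s 2) n m (Suc k) 0 (reals s' 15) (\<lambda>i. 0) \<and>
      (\<exists>q. (\<forall>i<n. \<forall>j<n. reals s' 15 i j = reals s 15 i j + (q i - q j)\<^sup>2) \<and>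
         reals s' 11 = (\<lambda>a l. if a = k \<and> l < n then q l else reals s 11 a l)))"
proof -
  let ?v = "reals s 2"
  let ?RA = "{16, 17, 18, 20, 31, 32, 33, 34, 35} :: nat set"
  let ?c4 = "For 21 num_verts (For 22 num_verts (RSet 15 (NV 21) (NV 22) (RPlus (entry 15)
        (RTimes (RMinus (RGet 16 (NV 21) NZ) (RGet 16 (NV 22) NZ)) (RMinus (RGet 16 (NV 21) NZ) (RGet 16 (NV 22) NZ))))))"
  let ?c5 = "For 21 num_verts (RSet 11 (NV 23) (NV 21) (RGet 16 (NV 21) NZ))"
  let ?R = "\<lambda>s'. keep {21, 22, 24, 25} {11, 15, 16, 17, 18, 20, 31, 32, 33, 34, 35} s s' \<and>
      signs_inv ?v n m (Suc k) 0 (reals s' 15) (\<lambda>i. 0) \<and>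
      (\<exists>q. (\<forall>i<n. \<forall>j<n. reals s' 15 i j = reals s 15 i j + (q i - q j)\<^sup>2) \<and>
         reals s' 11 = (\<lambda>a l. if a = k \<and> l < n then q l else reals s 11 a l))"
  have 1: "ach Q (For 21 num_verts (RSet 16 (NV 21) NZ (RC 0))) s (n * (1 + 2) + 2)
      (\<lambda>s'. keep {21} {16} s s' \<and> reals s' 16 = (\<lambda>a l. if a < n \<and> l = 0 then 0 else reals s 16 a l))"
  proof (rule ach_fill1_real[where NB = "{}" and RB = "{16}"])
    fix i and s' :: store assume "nats s' 21 0 0 = i"
    then show "ach Q (RSet 16 (NV 21) NZ (RC 0)) s' 1
      (\<lambda>s''. keep {} {16} s' s'' \<and> reals s'' 16 = (reals s' 16)(i := (reals s' 16 i)(0 := 0)))"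
      by (intro ach_RSet conjI keep_rset) simp_all
  qed (auto simp: n keep_nats)
  have 2: "ach Q (For 21 num_verts (For 22 num_verts (RSet 17 (NV 21) (NV 22) (entry 10)))) s1 (n * (n * (1 + 2) + 4) + 2)
      (\<lambda>s'. keep {21, 22} {16, 17} s s' \<and> (\<forall>i<n. \<forall>j<n. reals s' 17 i j = rest ?v n 0 i j) \<and>
        signs_inv ?v n m k 0 (reals s 15) (\<lambda>i. reals s' 16 i 0))"
    if H: "keep {21} {16} s s1 \<and> reals s1 16 = (\<lambda>a l. if a < n \<and> l = 0 then 0 else reals s 16 a l)" for s1
  proof -
    have k1: "keep {21} {16} s s1" using H by blast
    have "ach Q (For 21 num_verts (For 22 num_verts (RSet 17 (NV 21) (NV 22) (entry 10)))) s1 (n * (n * (1 + 2) + 4) + 2)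
      (\<lambda>s'. keep {21, 22} {17} s1 s' \<and> reals s' 17 = (\<lambda>a l. if a < n \<and> l < n then reals s 10 a l else reals s1 17 a l))"
    proof (rule ach_fill2_real[where NB = "{}" and RB = "{17}"])
      fix i j s' assume ks: "keep {21, 22} {17} s1 s'" and "nats s' 21 0 0 = i" "nats s' 22 0 0 = j"
      then show "ach Q (RSet 17 (NV 21) (NV 22) (entry 10)) s' 1
        (\<lambda>s''. keep {} {17} s' s'' \<and> reals s'' 17 = (reals s' 17)(i := (reals s' 17 i)(j := reals s 10 i j)))"
        by (intro ach_RSet conjI keep_rset) (simp_all add: entry_def keep_reals[OF ks] keep_reals[OF k1])
    qed (auto simp: n keep_nats keep_nats[OF k1])
    then show ?thesis
    proof (rule ach_conseq, elim conjE, intro conjI)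
      fix s' assume ks: "keep {21, 22} {17} s1 s'"
        and a: "reals s' 17 = (\<lambda>a l. if a < n \<and> l < n then reals s 10 a l else reals s1 17 a l)"
      show "keep {21, 22} {16, 17} s s'" by (rule keep_trans[OF k1 ks]) auto
      show "\<forall>i<n. \<forall>j<n. reals s' 17 i j = rest ?v n 0 i j" by (simp add: a D)
      have "reals s' 16 = (\<lambda>a l. if a < n \<and> l = 0 then 0 else reals s 16 a l)"
        using H keep_reals[OF ks] by simp
      then have "reals s' 16 i 0 = 0" if "i < n" for i using that by simp
      then show "signs_inv ?v n m k 0 (reals s 15) (\<lambda>i. reals s' 16 i 0)"
        using inv signs_inv_cong[of n "\<lambda>i. reals s' 16 i 0" "\<lambda>i. 0"] by blast
    qed simp
  qed
  have 3: "ach Q (For 24 num_verts column_prog) s1 (n * (column_time n m + 2) + 2)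
      (\<lambda>s'. keep {21, 22, 24, 25} ?RA s s' \<and> signs_inv ?v n m k n (reals s 15) (\<lambda>i. reals s' 16 i 0))"
    if H: "keep {21, 22} {16, 17} s s1 \<and> (\<forall>i<n. \<forall>j<n. reals s1 17 i j = rest ?v n 0 i j) \<and>
        signs_inv ?v n m k 0 (reals s 15) (\<lambda>i. reals s1 16 i 0)" for s1
  proof -
    have k1: "keep {21, 22} {16, 17} s s1" using H by blast
    have "ach Q (For 24 num_verts column_prog) s1 (n * (column_time n m + 2) + 2)
      (\<lambda>s'. keep {21, 22, 24, 25} ?RA s1 s' \<and> ((\<forall>i<n. \<forall>j<n. reals s' 17 i j = rest ?v n n i j) \<and>
        signs_inv ?v n m k n (reals s 15) (\<lambda>i. reals s' 16 i 0)))"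
    proof (rule ach_For[where J = "\<lambda>c s'. (\<forall>i<n. \<forall>j<n. reals s' 17 i j = rest ?v n c i j) \<and>
        signs_inv ?v n m k c (reals s 15) (\<lambda>i. reals s' 16 i 0)"])
      fix c s' assume c: "c < n" and ks: "keep {21, 22, 24, 25} ?RA s1 s'" and x: "nats s' 24 0 0 = c"
        and J: "(\<forall>i<n. \<forall>j<n. reals s' 17 i j = rest ?v n c i j) \<and> signs_inv ?v n m k c (reals s 15) (\<lambda>i. reals s' 16 i 0)"
      have e: "nats s' 0 = nats s 0" "nats s' 10 = nats s 10" "nats s' 11 = nats s 11" "nats s' 23 = nats s 23"
        "reals s' 2 = ?v" "reals s' 10 = reals s 10" "reals s' 15 = reals s 15"
        using keep_nats[OF ks] keep_reals[OF ks] keep_nats[OF k1] keep_reals[OF k1] by simp_all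
      have "ach Q column_prog s' (column_time n m)
        (\<lambda>s''. keep {21, 22, 25} ?RA s' s'' \<and>
          (\<forall>i<n. \<forall>j<n. reals s'' 17 i j = rest (reals s' 2) n (Suc c) i j) \<and>
          signs_inv (reals s' 2) n m k (Suc c) (reals s' 15) (\<lambda>i. reals s'' 16 i 0))"
        unfolding column_time_def
        by (rule ach_column[OF sc c k]) (use e n m k23 x J D in auto)
      then show "ach Q column_prog s' (column_time n m) (\<lambda>s''. keep {21, 22, 24, 25} ?RA s1 s'' \<and>
         ((\<forall>i<n. \<forall>j<n. reals s'' 17 i j = rest ?v n (Suc c) i j) \<and>
          signs_inv ?v n m k (Suc c) (reals s 15) (\<lambda>i. reals s'' 16 i 0)) \<and> nats s'' 24 0 0 = c)"
      proof (rule ach_conseq, elim conjE, intro conjI)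
        fix s'' assume k3: "keep {21, 22, 25} ?RA s' s''"
        show "keep {21, 22, 24, 25} ?RA s1 s''" by (rule keep_trans[OF ks k3]) auto
        show "nats s'' 24 0 0 = c" using keep_nats[OF k3] x by simp
      qed (simp_all only: e)
    qed (use H k1 n in \<open>auto simp: keep_nats\<close>)
    then show ?thesis
    proof (rule ach_conseq, elim conjE, intro conjI)
      fix s' assume "keep {21, 22, 24, 25} ?RA s1 s'"
      then show "keep {21, 22, 24, 25} ?RA s s'" by (rule keep_trans[OF k1]) auto
    qed simp_all
  qed
  have 4: "ach Q ?c4 s1 (n * (n * (1 + 2) + 4) + 2)
      (\<lambda>s'. keep {21, 22, 24, 25} (insert 15 ?RA) s s' \<and> signs_inv ?v n m (Suc k) 0 (reals s' 15) (\<lambda>i. 0) \<and>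
        (\<forall>i<n. \<forall>j<n. reals s' 15 i j = reals s 15 i j + (reals s' 16 i 0 - reals s' 16 j 0)\<^sup>2))"
    if H: "keep {21, 22, 24, 25} ?RA s s1 \<and> signs_inv ?v n m k n (reals s 15) (\<lambda>i. reals s1 16 i 0)" for s1
  proof -
    have k1: "keep {21, 22, 24, 25} ?RA s s1" using H by blast
    let ?val = "\<lambda>i j. reals s 15 i j + (reals s1 16 i 0 - reals s1 16 j 0) * (reals s1 16 i 0 - reals s1 16 j 0)"
    have "ach Q ?c4 s1 (n * (n * (1 + 2) + 4) + 2)
      (\<lambda>s'. keep {21, 22} {15} s1 s' \<and> reals s' 15 = (\<lambda>a l. if a < n \<and> l < n then ?val a l else reals s1 15 a l))"
    proof (rule ach_fill2_real[where NB = "{}" and RB = "{15}"])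
      fix i j s' assume ks: "keep {21, 22} {15} s1 s'" and x: "nats s' 21 0 0 = i" "nats s' 22 0 0 = j"
        and old: "reals s' 15 i j = reals s1 15 i j"
      show "ach Q (RSet 15 (NV 21) (NV 22) (RPlus (entry 15)
        (RTimes (RMinus (RGet 16 (NV 21) NZ) (RGet 16 (NV 22) NZ)) (RMinus (RGet 16 (NV 21) NZ) (RGet 16 (NV 22) NZ))))) s' 1
        (\<lambda>s''. keep {} {15} s' s'' \<and> reals s'' 15 = (reals s' 15)(i := (reals s' 15 i)(j := ?val i j)))"
        by (intro ach_RSet conjI keep_rset) (simp_all add: entry_def x old keep_reals[OF ks] keep_reals[OF k1, of 15])
    qed (auto simp: n keep_nats keep_nats[OF k1])
    then show ?thesis
    proof (rule ach_conseq, elim conjE, intro conjI)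
      fix s' assume ks: "keep {21, 22} {15} s1 s'"
        and a: "reals s' 15 = (\<lambda>a l. if a < n \<and> l < n then ?val a l else reals s1 15 a l)"
      show "keep {21, 22, 24, 25} (insert 15 ?RA) s s'" by (rule keep_trans[OF k1 ks]) auto
      show "signs_inv ?v n m (Suc k) 0 (reals s' 15) (\<lambda>i. 0)"
        by (rule sign_choice.signs_inv_row[OF sc conjunct2[OF H]]) (simp_all add: a)
      show "\<forall>i<n. \<forall>j<n. reals s' 15 i j = reals s 15 i j + (reals s' 16 i 0 - reals s' 16 j 0)\<^sup>2"
        using keep_reals[OF ks, of 16] by (simp add: a power2_eq_square)
    qed simp
  qed
  have 5: "ach Q ?c5 s1 (n * (1 + 2) + 2) ?R"
    if H: "keep {21, 22, 24, 25} (insert 15 ?RA) s s1 \<and> signs_inv ?v n m (Suc k) 0 (reals s1 15) (\<lambda>i. 0) \<and>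
        (\<forall>i<n. \<forall>j<n. reals s1 15 i j = reals s 15 i j + (reals s1 16 i 0 - reals s1 16 j 0)\<^sup>2)" for s1
  proof -
    have k1: "keep {21, 22, 24, 25} (insert 15 ?RA) s s1" using H by blast
    have "ach Q ?c5 s1 (n * (1 + 2) + 2)
      (\<lambda>s'. keep {21} {11} s1 s' \<and> reals s' 11 = (\<lambda>a l. if a = k \<and> l < n then reals s1 16 l 0 else reals s1 11 a l))"
    proof (rule ach_For[where J = "\<lambda>i s'. reals s' 11 = (\<lambda>a l. if a = k \<and> l < i then reals s1 16 l 0 else reals s1 11 a l)"])
      fix i s' assume ks: "keep {21} {11} s1 s'" and x: "nats s' 21 0 0 = i"
        and J: "reals s' 11 = (\<lambda>a l. if a = k \<and> l < i then reals s1 16 l 0 else reals s1 11 a l)"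
      have e: "nats s' 23 0 0 = k" "reals s' 16 = reals s1 16"
        using keep_nats[OF ks] keep_nats[OF k1] keep_reals[OF ks] k23 by simp_all
      show "ach Q (RSet 11 (NV 23) (NV 21) (RGet 16 (NV 21) NZ)) s' 1 (\<lambda>s''. keep {21} {11} s1 s'' \<and>
          reals s'' 11 = (\<lambda>a l. if a = k \<and> l < Suc i then reals s1 16 l 0 else reals s1 11 a l) \<and> nats s'' 21 0 0 = i)"
      proof (intro ach_RSet conjI keep_rset ks)
        show "reals (rset s' 11 (nval (NV 23) s') (nval (NV 21) s') (rval (RGet 16 (NV 21) NZ) s')) 11 =
          (\<lambda>a l. if a = k \<and> l < Suc i then reals s1 16 l 0 else reals s1 11 a l)"
          by (intro ext) (simp add: e x J less_Suc_eq)
      qed (simp_all add: x)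
    qed (auto simp: n keep_nats keep_nats[OF k1])
    then show ?thesis
    proof (rule ach_conseq, elim conjE)
      fix s' assume ks: "keep {21} {11} s1 s'"
        and a: "reals s' 11 = (\<lambda>a l. if a = k \<and> l < n then reals s1 16 l 0 else reals s1 11 a l)"
      have "keep {21, 22, 24, 25} {11, 15, 16, 17, 18, 20, 31, 32, 33, 34, 35} s s'"
        by (rule keep_trans[OF k1 ks]) auto
      moreover have "reals s' 15 = reals s1 15" using keep_reals[OF ks] by simp
      moreover have "reals s' 11 = (\<lambda>a l. if a = k \<and> l < n then reals s1 16 l 0 else reals s 11 a l)"
        unfolding a using keep_reals[OF k1, of 11] by (intro ext) simp
      ultimately show "?R s'" using H by (intro conjI exI[of _ "\<lambda>i. reals s1 16 i 0"]) simp_all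
    qed simp
  qed
  show ?thesis
    unfolding row_prog_def
    by (rule ach_seq[OF 1], rule ach_seq[OF 2], assumption, rule ach_seq[OF 3], assumption,
        rule ach_seq[OF 4 5], assumption, assumption, (rule order_refl)+)
       (simp add: row_time_def algebra_simps)
qed

definition jl_prog :: prog where
  "jl_prog = For 23 (NV 10) row_prog"

lemma ach_jl:
  assumes sc: "sign_choice n m L"
    and n: "nats s 0 0 0 = n" and m: "nats s 10 0 0 = m" "nats s 11 0 0 = 2 ^ m"
    and D: "\<And>i j. i < n \<Longrightarrow> j < n \<Longrightarrow> reals s 10 i j = rest (reals s 2) n 0 i j"
    and X: "reals s 15 = (\<lambda>i j. 0)"
  shows "ach Q jl_prog s (m * (row_time n m + 2) + 2)
    (\<lambda>s'. keep {21, 22, 23, 24, 25} {11, 15, 16, 17, 18, 20, 31, 32, 33, 34, 35} s s' \<and>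
      (\<forall>i<n. \<forall>j<n. real m / 5 * rest (reals s 2) n 0 i j \<le> (\<Sum>k<m. (reals s' 11 k i - reals s' 11 k j)\<^sup>2) \<and>
        (\<Sum>k<m. (reals s' 11 k i - reals s' 11 k j)\<^sup>2) \<le> 3 * real m * rest (reals s 2) n 0 i j))"
proof -
  let ?v = "reals s 2"
  let ?NA = "{21, 22, 23, 24, 25} :: nat set" and ?RA = "{11, 15, 16, 17, 18, 20, 31, 32, 33, 34, 35} :: nat set"
  let ?J = "\<lambda>k s'. signs_inv ?v n m k 0 (reals s' 15) (\<lambda>i. 0) \<and>
    (\<forall>i<n. \<forall>j<n. reals s' 15 i j = (\<Sum>k'<k. (reals s' 11 k' i - reals s' 11 k' j)\<^sup>2))"
  have "ach Q jl_prog s (m * (row_time n m + 2) + 2) (\<lambda>s'. keep ?NA ?RA s s' \<and> ?J m s')"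
    unfolding jl_prog_def
  proof (rule ach_For[where J = ?J])
    fix k s' assume k: "k < m" and ks: "keep ?NA ?RA s s'" and x: "nats s' 23 0 0 = k" and J: "?J k s'"
    have e: "nats s' 0 = nats s 0" "nats s' 10 = nats s 10" "nats s' 11 = nats s 11"
        "reals s' 2 = ?v" "reals s' 10 = reals s 10"
      using keep_nats[OF ks] keep_reals[OF ks] by simp_all
    have "ach Q row_prog s' (row_time n m)
      (\<lambda>s''. keep {21, 22, 24, 25} ?RA s' s'' \<and>
        signs_inv (reals s' 2) n m (Suc k) 0 (reals s'' 15) (\<lambda>i. 0) \<and>
        (\<exists>q. (\<forall>i<n. \<forall>j<n. reals s'' 15 i j = reals s' 15 i j + (q i - q j)\<^sup>2) \<and>
           reals s'' 11 = (\<lambda>a l. if a = k \<and> l < n then q l else reals s' 11 a l)))"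
      by (rule ach_row[OF sc k]) (use e n m x D J in auto)
    then show "ach Q row_prog s' (row_time n m)
      (\<lambda>s''. keep ?NA ?RA s s'' \<and> ?J (Suc k) s'' \<and> nats s'' 23 0 0 = k)"
    proof (rule ach_conseq, elim conjE exE, intro conjI)
      fix s'' q assume k2: "keep {21, 22, 24, 25} ?RA s' s''"
        and inv: "signs_inv (reals s' 2) n m (Suc k) 0 (reals s'' 15) (\<lambda>i. 0)"
        and q: "\<forall>i<n. \<forall>j<n. reals s'' 15 i j = reals s' 15 i j + (q i - q j)\<^sup>2"
          "reals s'' 11 = (\<lambda>a l. if a = k \<and> l < n then q l else reals s' 11 a l)"
      show "keep ?NA ?RA s s''" by (rule keep_trans[OF ks k2]) auto
      show "signs_inv ?v n m (Suc k) 0 (reals s'' 15) (\<lambda>i. 0)" using inv e by simp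
      show "nats s'' 23 0 0 = k" using keep_nats[OF k2] x by simp
      show "\<forall>i<n. \<forall>j<n. reals s'' 15 i j = (\<Sum>k'<Suc k. (reals s'' 11 k' i - reals s'' 11 k' j)\<^sup>2)"
        using q(1) J by (simp add: q(2))
    qed simp
  next
    show "?J 0 s" using sign_choice.signs_inv_start[OF sc] by (simp add: X)
  qed (use m in \<open>auto simp: keep_nats\<close>)
  then show ?thesis
  proof (rule ach_conseq, elim conjE, intro conjI allI impI)
    fix s' i j assume "keep ?NA ?RA s s'" and inv: "signs_inv ?v n m m 0 (reals s' 15) (\<lambda>i. 0)"
      and X: "\<forall>i<n. \<forall>j<n. reals s' 15 i j = (\<Sum>k'<m. (reals s' 11 k' i - reals s' 11 k' j)\<^sup>2)" and ij: "i < n" "j < n"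
    note f = sign_choice.signs_inv_final[OF sc inv refl ij]
    show "real m / 5 * rest ?v n 0 i j \<le> (\<Sum>k<m. (reals s' 11 k i - reals s' 11 k j)\<^sup>2)"
      "(\<Sum>k<m. (reals s' 11 k i - reals s' 11 k j)\<^sup>2) \<le> 3 * real m * rest ?v n 0 i j"
      using f X ij by simp_all
  qed simp_all
qed

section \<open>The table of directions\<close>

definition table_step :: prog where
  "table_step = For 22 (NV 18) (For 21 num_verts (Seq
     (RSet 12 (NPlus (NV 22) (NV 18)) (NV 21) (RMinus (RGet 12 (NV 22) (NV 21)) (RGet 11 (NV 23) (NV 21))))
     (RSet 12 (NV 22) (NV 21) (RPlus (RGet 12 (NV 22) (NV 21)) (RGet 11 (NV 23) (NV 21))))))"

definition table_prog :: prog where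
  "table_prog = Seq (For 21 num_verts (RSet 12 NZ (NV 21) (RC 0))) (Seq (NSet 18 NZ NZ (NConst 1))
     (For 23 (NV 10) (Seq table_step (NSet 18 NZ NZ (NPlus (NV 18) (NV 18))))))"

text \<open>Both descendants of row \<open>j\<close> come from its old value, so row
  \<open>j + w\<close> is written before row \<open>j\<close> is overwritten. The upper half
  subtracts, so that a new binary digit 1 stands for a minus sign.\<close>

lemma ach_table_step:
  assumes n: "nats s 0 0 0 = n" and w: "nats s 18 0 0 = w" and k: "nats s 23 0 0 = k"
  shows "ach Q table_step s (w * (n * 4 + 4) + 2) (\<lambda>s'. keep {21, 22} {12} s s' \<and>
    (\<forall>j<w. \<forall>i<n. reals s' 12 j i = reals s 12 j i + reals s 11 k i \<and>
      reals s' 12 (j + w) i = reals s 12 j i - reals s 11 k i))"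
proof -
  let ?T = "reals s 12" and ?P = "reals s 11 k"
  let ?J = "\<lambda>j s'. reals s' 12 = (\<lambda>a l. if l < n then (if a < j then ?T a l + ?P l
      else if w \<le> a \<and> a < w + j then ?T (a - w) l - ?P l else ?T a l) else ?T a l)"
  let ?b = "Seq (RSet 12 (NPlus (NV 22) (NV 18)) (NV 21) (RMinus (RGet 12 (NV 22) (NV 21)) (RGet 11 (NV 23) (NV 21))))
     (RSet 12 (NV 22) (NV 21) (RPlus (RGet 12 (NV 22) (NV 21)) (RGet 11 (NV 23) (NV 21))))"
  have "ach Q table_step s (w * ((n * (2 + 2) + 2) + 2) + 2) (\<lambda>s'. keep {21, 22} {12} s s' \<and> ?J w s')"
    unfolding table_step_def
  proof (rule ach_For[where J = ?J])
    fix j s1 assume j: "j < w" and k1: "keep {21, 22} {12} s s1" and x: "nats s1 22 0 0 = j" and J: "?J j s1"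
    let ?T1 = "reals s1 12"
    have T1: "?T1 j = ?T j" using j by (intro ext) (simp add: J)
    let ?J2 = "\<lambda>i s'. reals s' 12 = (\<lambda>a l. if l < i then (if a = j then ?T j l + ?P l
      else if a = j + w then ?T j l - ?P l else ?T1 a l) else ?T1 a l)"
    have "ach Q (For 21 num_verts ?b) s1 (n * (2 + 2) + 2) (\<lambda>s'. keep {21} {12} s1 s' \<and> ?J2 n s')"
    proof (rule ach_For[where J = ?J2])
      fix i s2 assume i: "i < n" and k2: "keep {21} {12} s1 s2" and y: "nats s2 21 0 0 = i" and J2: "?J2 i s2"
      have e: "nats s2 22 0 0 = j" "nats s2 18 0 0 = w" "nats s2 23 0 0 = k" "reals s2 11 = reals s 11"
        using keep_nats[OF k1] keep_nats[OF k2] keep_reals[OF k1] keep_reals[OF k2] x w k by simp_all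
      have v: "reals s2 12 j i = ?T j i" using T1 by (simp add: J2)
      show "ach Q ?b s2 2 (\<lambda>s3. keep {21} {12} s1 s3 \<and> ?J2 (Suc i) s3 \<and> nats s3 21 0 0 = i)"
      proof (rule ach_RSet_seq, rule ach_RSet, intro conjI keep_rset k2)
        let ?s3 = "rset s2 12 (nval (NPlus (NV 22) (NV 18)) s2) (nval (NV 21) s2)
            (rval (RMinus (RGet 12 (NV 22) (NV 21)) (RGet 11 (NV 23) (NV 21))) s2)"
        show "?J2 (Suc i) (rset ?s3 12 (nval (NV 22) ?s3) (nval (NV 21) ?s3)
            (rval (RPlus (RGet 12 (NV 22) (NV 21)) (RGet 11 (NV 23) (NV 21))) ?s3))"
          using j fun_cong[OF T1, of i] by (intro ext) (auto simp: e y v J2 less_Suc_eq)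
      qed (simp_all add: y)
    qed (use n in \<open>auto simp: keep_nats keep_nats[OF k1]\<close>)
    then show "ach Q (For 21 num_verts ?b) s1 (n * (2 + 2) + 2) (\<lambda>s'. keep {21, 22} {12} s s' \<and> ?J (Suc j) s' \<and> nats s' 22 0 0 = j)"
    proof (rule ach_conseq, elim conjE, intro conjI)
      fix s' assume k2: "keep {21} {12} s1 s'" and J2: "?J2 n s'"
      show "keep {21, 22} {12} s s'" by (rule keep_trans[OF k1 k2]) auto
      show "nats s' 22 0 0 = j" using keep_nats[OF k2] x by simp
      show "?J (Suc j) s'"
        unfolding J2 J using j by (intro ext) (auto simp: less_Suc_eq)
    qed simp
  next
    show "?J 0 s" by (intro ext) simp
  qed (use n w in \<open>auto simp: keep_nats\<close>)
  then show ?thesis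
    by (rule ach_conseq) (auto simp: algebra_simps)
qed

text \<open>Row \<open>j\<close> of the table belongs to the direction whose minus signs are at the positions
  \<open>set_decode j\<close> of the one bits of \<open>j\<close>.\<close>

lemma set_decode_bound:
  assumes "j < 2 ^ k"
  shows "set_decode j \<subseteq> {..<k}" "set_decode (j + 2 ^ k) = insert k (set_decode j)"
proof -
  have "i < k" if "i \<in> set_decode j" for i
  proof (rule ccontr)
    assume "\<not> i < k"
    then have "(2::nat) ^ k \<le> 2 ^ i" by (intro power_increasing) auto
    with assms have "j < 2 ^ i" by (rule less_le_trans)
    then have "j div 2 ^ i = 0" by (rule div_less)
    then show False using that by (simp add: set_decode_def)
  qed
  then show 1: "set_decode j \<subseteq> {..<k}" by auto
  then have "k \<notin> set_decode j" by auto
  then show "set_decode (j + 2 ^ k) = insert k (set_decode j)"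
    using set_decode_plus_power_2[of k j] by (simp add: add.commute)
qed

lemma bij_betw_set_decode: "bij_betw set_decode {..<2 ^ k} (Pow {..<k})"
proof -
  have inj: "inj_on set_decode {..<2 ^ k}"
    by (metis inj_onI set_decode_inverse)
  moreover have "set_decode ` {..<2 ^ k} = Pow {..<k}"
  proof (rule card_subset_eq)
    show "set_decode ` {..<2 ^ k} \<subseteq> Pow {..<k}" using set_decode_bound(1) by auto
    show "card (set_decode ` {..<2 ^ k}) = card (Pow {..<k})"
      using inj by (simp add: card_image card_Pow)
  qed simp
  ultimately show ?thesis by (simp add: bij_betw_def)
qed

definition table_time :: "nat \<Rightarrow> nat \<Rightarrow> nat" where
  "table_time n m = n * 3 + 2 + 1 + (m * (2 ^ m * (n * 4 + 4) + 2 + 1 + 2) + 2)"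

lemma ach_table:
  assumes n: "nats s 0 0 0 = n" and m: "nats s 10 0 0 = m"
  shows "ach Q table_prog s (table_time n m) (\<lambda>s'. keep {18, 21, 22, 23} {12} s s' \<and>
    (\<forall>j<2 ^ m. \<forall>i<n. reals s' 12 j i = dirval (reals s 11) m (set_decode j) i))"
proof -
  let ?P = "reals s 11"
  let ?J = "\<lambda>k s'. nats s' 18 0 0 = 2 ^ k \<and> (\<forall>j<2 ^ k. \<forall>i<n. reals s' 12 j i = dirval ?P k (set_decode j) i)"
  have 1: "ach Q (For 21 num_verts (RSet 12 NZ (NV 21) (RC 0))) s (n * (1 + 2) + 2)
      (\<lambda>s'. keep {21} {12} s s' \<and> (\<forall>i<n. reals s' 12 0 i = 0))"
  proof (rule ach_For[where J = "\<lambda>k s'. \<forall>i<k. reals s' 12 0 i = 0"])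
    fix i s' assume "keep {21} {12} s s'" "\<forall>i'<i. reals s' 12 0 i' = 0" "nats s' 21 0 0 = i"
    then show "ach Q (RSet 12 NZ (NV 21) (RC 0)) s' 1
        (\<lambda>s''. keep {21} {12} s s'' \<and> (\<forall>i'<Suc i. reals s'' 12 0 i' = 0) \<and> nats s'' 21 0 0 = i)"
      by (intro ach_RSet) (auto intro!: keep_rset simp: less_Suc_eq)
  qed (use n in \<open>auto simp: keep_nats\<close>)
  have 3: "ach Q (For 23 (NV 10) (Seq table_step (NSet 18 NZ NZ (NPlus (NV 18) (NV 18))))) s1
      (m * (2 ^ m * (n * 4 + 4) + 2 + 1 + 2) + 2) (\<lambda>s'. keep {18, 21, 22, 23} {12} s s' \<and> ?J m s')"
    if k1: "keep {18, 21, 22, 23} {12} s s1" and J0: "?J 0 s1" for s1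
  proof -
    have "ach Q (For 23 (NV 10) (Seq table_step (NSet 18 NZ NZ (NPlus (NV 18) (NV 18))))) s1
      (m * (2 ^ m * (n * 4 + 4) + 2 + 1 + 2) + 2) (\<lambda>s'. keep {18, 21, 22, 23} {12} s1 s' \<and> ?J m s')"
    proof (rule ach_For[where J = ?J])
      fix k s2 assume k: "k < m" and k2: "keep {18, 21, 22, 23} {12} s1 s2" and J: "?J k s2" and x: "nats s2 23 0 0 = k"
      have e: "nats s2 0 0 0 = n" "reals s2 11 = ?P"
        using keep_nats[OF k1] keep_nats[OF k2] keep_reals[OF k1] keep_reals[OF k2] n by simp_all
      have s: "ach Q table_step s2 (2 ^ m * (n * 4 + 4) + 2) (\<lambda>s3. keep {21, 22} {12} s2 s3 \<and>
          (\<forall>j<2 ^ k. \<forall>i<n. reals s3 12 j i = reals s2 12 j i + ?P k i \<and>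
            reals s3 12 (j + 2 ^ k) i = reals s2 12 j i - ?P k i))"
      proof (rule ach_conseq[OF ach_table_step[where w = "2 ^ k" and n = n and k = k]], goal_cases)
        case (5)
        have "(2::nat) ^ k \<le> 2 ^ m" using k by (intro power_increasing) auto
        then show ?case by (intro add_right_mono mult_right_mono) auto
      qed (use e x J in auto)
      show "ach Q (Seq table_step (NSet 18 NZ NZ (NPlus (NV 18) (NV 18)))) s2 (2 ^ m * (n * 4 + 4) + 2 + 1)
        (\<lambda>s3. keep {18, 21, 22, 23} {12} s1 s3 \<and> ?J (Suc k) s3 \<and> nats s3 23 0 0 = k)"
      proof (rule ach_seq_NSet, rule ach_conseq[OF s _ order_refl], elim conjE, intro conjI)
        fix s3 assume k3: "keep {21, 22} {12} s2 s3" and T: "\<forall>j<2 ^ k. \<forall>i<n. reals s3 12 j i = reals s2 12 j i + ?P k i \<and>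
            reals s3 12 (j + 2 ^ k) i = reals s2 12 j i - ?P k i"
        let ?s4 = "nset s3 18 (nval NZ s3) (nval NZ s3) (nval (NPlus (NV 18) (NV 18)) s3)"
        show "keep {18, 21, 22, 23} {12} s1 ?s4"
          by (intro keep_nset keep_trans[OF k2 k3]) auto
        show "nats ?s4 18 0 0 = 2 ^ Suc k" using J keep_nats[OF k3, of 18] by simp
        show "nats ?s4 23 0 0 = k" using x keep_nats[OF k3, of 23] by simp
        show "\<forall>j<2 ^ Suc k. \<forall>i<n. reals ?s4 12 j i = dirval ?P (Suc k) (set_decode j) i"
        proof (intro allI impI)
          fix j i :: nat assume j: "j < 2 ^ Suc k" and i: "i < n"
          show "reals ?s4 12 j i = dirval ?P (Suc k) (set_decode j) i"
          proof (cases "j < 2 ^ k")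
            case True
            have "k \<notin> set_decode j" using set_decode_bound(1)[OF True] by auto
            then show ?thesis using T J True i by (simp add: dirval_def signed_sum_Suc sg_def)
          next
            case False
            define j' where "j' = j - 2 ^ k"
            have j': "j' < 2 ^ k" "j = j' + 2 ^ k" using False j by (auto simp: j'_def)
            show ?thesis
              using T J j'(1) i unfolding j'(2) set_decode_bound(2)[OF j'(1)]
              by (simp add: dirval_def signed_sum_Suc signed_sum_insert) (simp add: sg_def)
          qed
        qed
      qed simp_all
    qed (use k1 J0 m in \<open>auto simp: keep_nats\<close>)
    then show ?thesis
      by (rule ach_conseq) (auto intro: keep_trans[OF k1])
  qed
  have 2: "ach Q (Seq (NSet 18 NZ NZ (NConst 1)) (For 23 (NV 10) (Seq table_step (NSet 18 NZ NZ (NPlus (NV 18) (NV 18)))))) s1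
      (1 + (m * (2 ^ m * (n * 4 + 4) + 2 + 1 + 2) + 2)) (\<lambda>s'. keep {18, 21, 22, 23} {12} s s' \<and> ?J m s')"
    if H: "keep {21} {12} s s1 \<and> (\<forall>i<n. reals s1 12 0 i = 0)" for s1
  proof (rule ach_NSet_seq, rule 3)
    show "keep {18, 21, 22, 23} {12} s (nset s1 18 (nval NZ s1) (nval NZ s1) (nval (NConst 1) s1))"
      using H by (intro keep_nset) (auto intro: keep_weaken)
  qed (use H in \<open>simp_all add: dirval_def signed_sum_def\<close>)
  show ?thesis
    unfolding table_prog_def
    by (rule ach_seq[OF 1], rule ach_conseq[OF 2], assumption, blast, rule order_refl)
       (simp add: table_time_def)
qed

section \<open>The program: search over candidate cuts\<close>

definition edge_prog :: prog where
  "edge_prog = Seq (Query 36 (NV 39) 13) (Seq (Query 37 (NV 39) 14)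
     (Cond (RLess (RV 37) (RV 36)) (RSet 38 NZ NZ (RV 37)) (RSet 38 NZ NZ (RV 36))))"

text \<open>The nested negations encode a disjunction: no cut was found before, or the stored ratio
  is larger. The test of the balance guards against a quotient with default value 0.\<close>

definition update_prog :: prog where
  "update_prog = Cond (BAnd (RLess (RC 0) (RV 23)) (BNot (BAnd (NLess NZ (NV 12)) (BNot (RLess (RV 24) (RV 19))))))
     (Seq (NSet 12 NZ NZ (NConst 1)) (Seq (RSet 19 NZ NZ (RV 24))
        (For 37 num_verts (NSet 2 (NV 37) NZ (NGet 13 (NV 37) NZ))))) Skip"

definition eval_prog :: prog where
  "eval_prog = Seq (sum_prog 39 20 num_edges edge_prog (RTimes (RGet 0 (NV 39) NZ) (RV 38)))
     (Seq (sum_prog 37 21 num_verts Skip (RTimes (RGet 1 (NV 37) NZ) (ROfNat (NGet 13 (NV 37) NZ))))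
     (Seq (sum_prog 37 22 num_verts Skip (RTimes (RGet 1 (NV 37) NZ) (ROfNat (NGet 14 (NV 37) NZ))))
     (Seq (Cond (RLess (RV 22) (RV 21)) (RSet 23 NZ NZ (RV 22)) (RSet 23 NZ NZ (RV 21)))
     (Seq (RSet 24 NZ NZ (RDivide (RV 20) (RV 23))) update_prog))))"

definition cut_prog :: prog where
  "cut_prog = Seq (For 37 num_verts (Seq (NSet 16 NZ NZ NZ) (Seq (For 38 num_verts
        (Cond (BAnd (NLess NZ (NGet 15 (NV 38) NZ))
                 (BNot (RLess (RGet 10 (NV 35) (NV 36)) (RGet 10 (NV 37) (NV 38)))))
           (NSet 16 NZ NZ (NConst 1)) Skip))
        (NSet 13 (NV 37) NZ (NV 16)))))
     (Seq (For 37 num_verts (NSet 14 (NV 37) NZ (NMinus (NConst 1) (NGet 13 (NV 37) NZ)))) eval_prog)"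

definition seed_prog :: prog where
  "seed_prog = For 35 num_verts (For 36 num_verts cut_prog)"

definition gain_prog :: prog where
  "gain_prog = For 37 num_verts (Seq (RSet 25 NZ NZ (RC 0)) (Seq (For 38 num_verts
      (Cond (BAnd (BNot (RLess (RGet 10 (NV 30) (NV 31)) (RGet 10 (NV 37) (NV 38))))
                  (RLess (RV 25) (RMinus (RGet 12 (NV 32) (NV 38)) (RGet 12 (NV 32) (NV 37)))))
         (RSet 25 NZ NZ (RMinus (RGet 12 (NV 32) (NV 38)) (RGet 12 (NV 32) (NV 37)))) Skip))
      (RSet 13 (NV 37) NZ (RV 25))))"

text \<open>Both branches write, since array 15 may still hold the flags of the previous
  seed.\<close>

definition fill_prog :: "bexp \<Rightarrow> prog" where
  "fill_prog b = For 37 num_verts (Cond b (NSet 15 (NV 37) NZ (NConst 1)) (NSet 15 (NV 37) NZ NZ))"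

definition not_less :: "rexp \<Rightarrow> rexp \<Rightarrow> bexp" where
  "not_less a b = BNot (RLess b a)"

definition direction_prog :: prog where
  "direction_prog = For 33 num_verts (For 34 num_verts (Seq
     (fill_prog (BAnd (not_less (RGet 12 (NV 32) (NV 33)) (RGet 12 (NV 32) (NV 37)))
                      (not_less (RGet 13 (NV 34) NZ) (RGet 13 (NV 37) NZ)))) seed_prog))"

definition mean_prog :: prog where
  "mean_prog = For 34 num_verts (Seq (fill_prog (not_less (RGet 14 (NV 34) NZ) (RGet 14 (NV 37) NZ))) seed_prog)"

text \<open>For a fixed radius the gains of one direction at a time are kept. They are added to
  array 14 before the seeds of that direction are tested, and the mean seeds follow when the sums
  over all directions are complete.\<close>

definition radius_prog :: prog where
  "radius_prog = Seq (For 37 num_verts (RSet 14 (NV 37) NZ (RC 0)))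
     (Seq (For 32 (NV 11) (Seq gain_prog
        (Seq (For 37 num_verts (RSet 14 (NV 37) NZ (RPlus (RGet 14 (NV 37) NZ) (RGet 13 (NV 37) NZ)))) direction_prog)))
     mean_prog)"

text \<open>Equality of indices, expressed by two failed comparisons, serves to list the
  singletons.\<close>

definition search_prog :: prog where
  "search_prog = Seq (For 30 num_verts (For 31 num_verts radius_prog))
     (For 33 num_verts (Seq (fill_prog (BAnd (BNot (NLess (NV 33) (NV 37))) (BNot (NLess (NV 37) (NV 33))))) seed_prog))"

section \<open>Comparing cuts with the best one found\<close>

locale cut_search =
  fixes G :: "nat hypergraph" and es :: "nat set list" and D Tab :: "nat \<Rightarrow> nat \<Rightarrow> real" and n J :: nat
  assumes G: "submodular_hypergraph G" and V: "verts G = {..<n}" and es: "distinct es" "set es = hedges G"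
begin

abbreviation "Q \<equiv> value_oracle G es"

definition env :: "store \<Rightarrow> bool" where
  "env s \<longleftrightarrow> nats s 0 0 0 = n \<and> nats s 0 0 1 = length es \<and> nats s 11 0 0 = J \<and>
     (\<forall>e<length es. reals s 0 e 0 = weight G (es ! e)) \<and> (\<forall>i<n. reals s 1 i 0 = meas G i) \<and>
     (\<forall>i<n. \<forall>j<n. reals s 10 i j = D i j) \<and> (\<forall>j<J. \<forall>i<n. reals s 12 j i = Tab j i)"

definition valid :: "store \<Rightarrow> bool" where
  "valid s \<longleftrightarrow> (nats s 12 0 0 \<noteq> 0 \<longrightarrow> 0 < balance G (output_cut G s) \<and> reals s 19 0 0 = Psi G (output_cut G s))"

text \<open>Cuts without balance count as beaten, as their ratio has no meaning.\<close>

definition beats :: "store \<Rightarrow> nat set \<Rightarrow> bool" where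
  "beats s S \<longleftrightarrow> (0 < balance G S \<longrightarrow> nats s 12 0 0 \<noteq> 0 \<and> Psi G (output_cut G s) \<le> Psi G S)"

text \<open>Cuts once beaten stay beaten, so the families tested by successive stages add up to
  their union. This makes the relation compose along sequences and loops.\<close>

definition improve :: "store \<Rightarrow> store \<Rightarrow> nat set set \<Rightarrow> bool" where
  "improve s s' F \<longleftrightarrow> valid s' \<and> (\<forall>S. beats s S \<longrightarrow> beats s' S) \<and> (\<forall>S\<in>F. beats s' S)"

lemma env_keep:
  assumes "env s" "keep NA RA s s'" "0 \<notin> NA" "11 \<notin> NA" "0 \<notin> RA" "1 \<notin> RA" "10 \<notin> RA" "12 \<notin> RA"
  shows "env s'"
  using assms unfolding env_def keep_def by metis

lemma improve_keep:
  assumes "valid s" "keep NA RA s s'" "2 \<notin> NA" "12 \<notin> NA" "19 \<notin> RA"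
  shows "improve s s' {}"
proof -
  have "nats s' 2 = nats s 2" "nats s' 12 = nats s 12" "reals s' 19 = reals s 19"
    using assms by (auto simp: keep_def)
  then show ?thesis using assms(1) by (simp add: improve_def valid_def beats_def output_cut_def)
qed

lemma improve_trans: "improve s s' F \<Longrightarrow> improve s' s'' F' \<Longrightarrow> improve s s'' (F \<union> F')"
  unfolding improve_def by blast

lemma improve_trans_keep:
  assumes "valid s" "keep NA RA s s'" "2 \<notin> NA" "12 \<notin> NA" "19 \<notin> RA" "improve s' s'' F"
  shows "improve s s'' F"
  using improve_trans[OF improve_keep[OF assms(1-5)] assms(6)] by simp

lemma valid_keep: "valid s \<Longrightarrow> keep NA RA s s' \<Longrightarrow> 2 \<notin> NA \<Longrightarrow> 12 \<notin> NA \<Longrightarrow> 19 \<notin> RA \<Longrightarrow> valid s'"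
  using improve_keep unfolding improve_def by blast

lemma improve_valid: "improve s s' F \<Longrightarrow> valid s'"
  by (simp add: improve_def)

text \<open>The invariant \<open>K\<close> carries side information from round to round, such as the
  partial sums of gains that are collected while cuts are being tested.\<close>

lemma ach_For_improve:
  assumes x: "x \<in> NA" "x \<noteq> 2" "x \<noteq> 12" "x \<notin> NB" "NB \<subseteq> NA" "RB \<subseteq> RA"
    and valid: "valid s"
    and body: "\<And>i s'. i < N \<Longrightarrow> keep NA RA s s' \<Longrightarrow> valid s' \<Longrightarrow> nats s' x 0 0 = i \<Longrightarrow> K i s' \<Longrightarrow>
      ach Q c s' T (\<lambda>s''. keep NB RB s' s'' \<and> improve s' s'' (F i) \<and> K (Suc i) s'')"
    and K: "K 0 s" "\<And>i s' y. K i s' \<Longrightarrow> K i (nset s' x 0 0 y)"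
    and bound: "\<And>s'. keep NA RA s s' \<Longrightarrow> nval e s' = N"
  shows "ach Q (For x e c) s (N * (T + 2) + 2) (\<lambda>s'. keep NA RA s s' \<and> improve s s' (\<Union>i<N. F i) \<and> K N s')"
proof -
  have "ach Q (For x e c) s (N * (T + 2) + 2) (\<lambda>s'. keep NA RA s s' \<and> (improve s s' (\<Union>i<N. F i) \<and> K N s'))"
  proof (rule ach_For[where J = "\<lambda>i s'. improve s s' (\<Union>i<i. F i) \<and> K i s'"])
    fix i s' assume i: "i < N" and k: "keep NA RA s s'" and J: "improve s s' (\<Union>i<i. F i) \<and> K i s'" and xi: "nats s' x 0 0 = i"
    have v: "valid s'" using J by (simp add: improve_def)
    show "ach Q c s' T (\<lambda>s''. keep NA RA s s'' \<and> (improve s s'' (\<Union>i<Suc i. F i) \<and> K (Suc i) s'') \<and> nats s'' x 0 0 = i)"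
    proof (rule ach_conseq[OF body[OF i k v xi conjunct2[OF J]]], elim conjE, intro conjI)
      fix s'' assume k2: "keep NB RB s' s''" and im: "improve s' s'' (F i)"
      show "keep NA RA s s''" by (rule keep_trans[OF k k2]) (use x in auto)
      show "nats s'' x 0 0 = i" using xi keep_nats[OF k2 x(4)] by simp
      show "improve s s'' (\<Union>i<Suc i. F i)"
        using improve_trans[OF conjunct1[OF J] im] by (simp add: lessThan_Suc Un_commute)
    qed simp_all
  next
    show "improve s s (\<Union>i<0. F i) \<and> K 0 s" using valid K by (simp add: improve_def)
  next
    fix i s' y assume J: "improve s s' (\<Union>i<i. F i) \<and> K i s'"
    have "improve s' (nset s' x 0 0 y) {}"
      using J x by (intro improve_keep[of _ "{x}" "{}"] keep_nset) (auto simp: improve_def)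
    then show "improve s (nset s' x 0 0 y) (\<Union>i<i. F i) \<and> K i (nset s' x 0 0 y)"
      using improve_trans[of s s' _ "nset s' x 0 0 y" "{}"] J K by auto
  qed (use x bound in auto)
  then show ?thesis .
qed

lemma edges_sub: "e < length es \<Longrightarrow> es ! e \<subseteq> {..<n}"
  using G es(2) V nth_mem[of e es] unfolding submodular_hypergraph_def by fastforce

lemma ach_eval:
  assumes env: "env s" and valid: "valid s" and S: "S \<subseteq> {..<n}"
    and f: "\<And>i. i < n \<Longrightarrow> nats s 13 i 0 = of_bool (i \<in> S)" "\<And>i. i < n \<Longrightarrow> nats s 14 i 0 = of_bool (i \<notin> S)"
  shows "ach Q eval_prog s (length es * 8 + n * 11 + 20)
    (\<lambda>s'. keep {2, 12, 37, 39} {19, 20, 21, 22, 23, 24, 36, 37, 38} s s' \<and> improve s s' {S})"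
proof -
  let ?M = "length es"
  note e0 = env[unfolded env_def]
  have 1: "ach Q (sum_prog 39 20 num_edges edge_prog (RTimes (RGet 0 (NV 39) NZ) (RV 38))) s (?M * (5 + 3) + 3)
      (\<lambda>s'. keep {39} {20, 36, 37, 38} s s' \<and> reals s' 20 0 0 = (\<Sum>e<?M. weight G (es ! e) * cut_function G (es ! e) (S \<inter> es ! e)))"
  proof (rule ach_sum[where NB = "{}" and RB = "{36, 37, 38}"])
    fix e s' assume e: "e < ?M" and k: "keep {39} {20, 36, 37, 38} s s'" and x: "nats s' 39 0 0 = e"
    let ?h = "es ! e"
    let ?a = "subf G ?h (S \<inter> ?h)" and ?b = "subf G ?h (?h - S \<inter> ?h)"
    have n13: "nats s' 13 = nats s 13" "nats s' 14 = nats s 14" "reals s' 0 = reals s 0"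
      using keep_nats[OF k] keep_reals[OF k] by simp_all
    \<comment> \<open>The oracle intersects its argument with the hyperedge, so the flags of the
      complement in \<open>V\<close> produce the complement within \<open>es ! e\<close>.\<close>
    have "{i. nats s 13 i 0 \<noteq> 0} \<inter> ?h = S \<inter> ?h" "{i. nats s 14 i 0 \<noteq> 0} \<inter> ?h = ?h - S \<inter> ?h"
      using edges_sub[OF e] f by fastforce+
    then have q: "Q e {i. nats s 13 i 0 \<noteq> 0} = ?a" "Q e {i. nats s 14 i 0 \<noteq> 0} = ?b"
      using e by (simp_all add: value_oracle_def)
    have 1: "ach Q (Query 36 (NV 39) 13) s' 1 (\<lambda>s''. s'' = rset s' 36 0 0 ?a)"
      by (rule ach_Query) (simp only: nval.simps store_set_simps x n13 q)
    have 2: "ach Q (Query 37 (NV 39) 14) (rset s' 36 0 0 ?a) 1 (\<lambda>s''. s'' = rset (rset s' 36 0 0 ?a) 37 0 0 ?b)"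
      by (rule ach_Query) (simp only: nval.simps store_set_simps x n13 q)
    have 3: "ach Q (Cond (RLess (RV 37) (RV 36)) (RSet 38 NZ NZ (RV 37)) (RSet 38 NZ NZ (RV 36)))
        (rset (rset s' 36 0 0 ?a) 37 0 0 ?b) 2
        (\<lambda>s''. keep {} {36, 37, 38} s' s'' \<and> reals s'' 38 0 0 = min ?a ?b \<and> nats s'' = nats s' \<and> reals s'' 0 = reals s' 0)"
      by (rule ach_cond[where ?T1.0 = 1]; (rule ach_RSet)?) (auto intro!: keep_rset simp: min_def)
    have "ach Q edge_prog s' 5
        (\<lambda>s''. keep {} {36, 37, 38} s' s'' \<and> reals s'' 38 0 0 = min ?a ?b \<and> nats s'' = nats s' \<and> reals s'' 0 = reals s' 0)"
      unfolding edge_prog_def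
      by (rule ach_seq[OF 1], simp only:, rule ach_seq[OF 2], simp only:, rule 3, rule order_refl, simp)
    then show "ach Q edge_prog s' 5 (\<lambda>s''. keep {} {36, 37, 38} s' s'' \<and>
        rval (RTimes (RGet 0 (NV 39) NZ) (RV 38)) s'' = weight G ?h * cut_function G ?h (S \<inter> ?h))"
      by (rule ach_conseq) (use e0 e in \<open>auto simp: x n13 cut_function_def\<close>)
  qed (use e0 in \<open>auto simp: keep_nats\<close>)
  have cw: "(\<Sum>e<?M. weight G (es ! e) * cut_function G (es ! e) (S \<inter> es ! e)) = cut_weight G S"
    unfolding cut_weight_def es(2)[symmetric]
    by (rule sum.reindex_bij_betw[OF bij_betw_nth[OF es(1) refl refl]])
  have vs: "ach Q (sum_prog 37 acc num_verts Skip (RTimes (RGet 1 (NV 37) NZ) (ROfNat (NGet a (NV 37) NZ)))) s' (n * (1 + 3) + 3)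
      (\<lambda>s''. keep {37} {acc} s' s'' \<and> reals s'' acc 0 0 = total_meas G A)"
    if env': "env s'" and A: "A \<subseteq> {..<n}" "\<And>i. i < n \<Longrightarrow> nats s' a i 0 = of_bool (i \<in> A)" and a: "a \<noteq> 37" "acc \<noteq> 1" for s' a acc A
  proof -
    have "(\<Sum>i<n. meas G i * of_bool (i \<in> A)) = (\<Sum>i<n. if i \<in> A then meas G i else 0)"
      by (rule sum.cong) auto
    also have "\<dots> = total_meas G A"
      using A(1) by (simp add: sum.If_cases total_meas_def Int_absorb1)
    finally have tm: "(\<Sum>i<n. meas G i * of_bool (i \<in> A)) = total_meas G A" .
    have "ach Q (sum_prog 37 acc num_verts Skip (RTimes (RGet 1 (NV 37) NZ) (ROfNat (NGet a (NV 37) NZ)))) s' (n * (1 + 3) + 3)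
      (\<lambda>s''. keep {37} {acc} s' s'' \<and> reals s'' acc 0 0 = (\<Sum>i<n. meas G i * of_bool (i \<in> A)))"
    proof (rule ach_sum[where NB = "{}" and RB = "{}"])
      fix i s'' assume i: "i < n" and k: "keep {37} {acc} s' s''" and x: "nats s'' 37 0 0 = i"
      have k1: "reals s'' 1 = reals s' 1" "nats s'' a = nats s' a"
        using keep_reals[OF k, of 1] keep_nats[OF k, of a] a by simp_all
      show "ach Q Skip s'' 1 (\<lambda>s3. keep {} {} s'' s3 \<and>
          rval (RTimes (RGet 1 (NV 37) NZ) (ROfNat (NGet a (NV 37) NZ))) s3 = meas G i * of_bool (i \<in> A))"
        by (rule ach_Skip) (use env' i k1 in \<open>simp add: x A(2)[OF i] env_def\<close>)
    qed (use env' in \<open>auto simp: env_def keep_nats\<close>)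
    then show ?thesis unfolding tm .
  qed
  let ?R = "\<lambda>s'. keep {2, 12, 37, 39} {19, 20, 21, 22, 23, 24, 36, 37, 38} s s' \<and> improve s s' {S}"
  let ?X = "\<lambda>s1. keep {37, 39} {20, 21, 22, 23, 24, 36, 37, 38} s s1"
  have X: "env s1 \<and> valid s1 \<and> nats s1 13 = nats s 13 \<and> nats s1 14 = nats s 14" if "?X s1" for s1
    using that env_keep[OF env that] valid_keep[OF valid that] keep_nats[OF that] by simp
  have 2: "ach Q (sum_prog 37 21 num_verts Skip (RTimes (RGet 1 (NV 37) NZ) (ROfNat (NGet 13 (NV 37) NZ)))) s1 (n * (1 + 3) + 3)
      (\<lambda>s1. ?X s1 \<and> reals s1 20 0 0 = cut_weight G S \<and> reals s1 21 0 0 = total_meas G S)"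
    if H: "keep {39} {20, 36, 37, 38} s s1 \<and> reals s1 20 0 0 = (\<Sum>e<?M. weight G (es ! e) * cut_function G (es ! e) (S \<inter> es ! e))" for s1
  proof -
    have k: "?X s1" by (rule keep_weaken[OF conjunct1[OF H]]) auto
    show ?thesis
    proof (rule ach_conseq[OF vs[where A = S]], goal_cases)
      case (6 s2)
      have k2: "keep {37} {21} s1 s2" using 6 by blast
      have "?X s2" by (rule keep_trans[OF k k2]) auto
      then show ?case using 6 H cw keep_reals[OF k2, of 20] by simp
    qed (use X[OF k] S f in auto)
  qed
  have 3: "ach Q (sum_prog 37 22 num_verts Skip (RTimes (RGet 1 (NV 37) NZ) (ROfNat (NGet 14 (NV 37) NZ)))) s1 (n * (1 + 3) + 3)
      (\<lambda>s1. ?X s1 \<and> reals s1 20 0 0 = cut_weight G S \<and> reals s1 21 0 0 = total_meas G S \<and> reals s1 22 0 0 = total_meas G ({..<n} - S))"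
    if H: "?X s1 \<and> reals s1 20 0 0 = cut_weight G S \<and> reals s1 21 0 0 = total_meas G S" for s1
  proof -
    have k: "?X s1" using H by blast
    show ?thesis
    proof (rule ach_conseq[OF vs[where A = "{..<n} - S"]], goal_cases)
      case (6 s2)
      have k2: "keep {37} {22} s1 s2" using 6 by blast
      have "?X s2" by (rule keep_trans[OF k k2]) auto
      then show ?case using 6 H keep_reals[OF k2, of 20] keep_reals[OF k2, of 21] by simp
    qed (use X[OF k] f in auto)
  qed
  have 4: "ach Q (Cond (RLess (RV 22) (RV 21)) (RSet 23 NZ NZ (RV 22)) (RSet 23 NZ NZ (RV 21))) s1 2
      (\<lambda>s1. ?X s1 \<and> reals s1 20 0 0 = cut_weight G S \<and> reals s1 23 0 0 = balance G S)"
    if H: "?X s1 \<and> reals s1 20 0 0 = cut_weight G S \<and> reals s1 21 0 0 = total_meas G S \<and> reals s1 22 0 0 = total_meas G ({..<n} - S)" for s1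
    by (rule ach_cond[where ?T1.0 = 1]; (rule ach_RSet)?)
       (use H in \<open>auto intro!: keep_rset simp: balance_def V min_def\<close>)
  have 5: "ach Q (RSet 24 NZ NZ (RDivide (RV 20) (RV 23))) s1 1
      (\<lambda>s1. ?X s1 \<and> reals s1 23 0 0 = balance G S \<and> reals s1 24 0 0 = Psi G S)"
    if H: "?X s1 \<and> reals s1 20 0 0 = cut_weight G S \<and> reals s1 23 0 0 = balance G S" for s1
    by (rule ach_RSet) (use H in \<open>auto intro!: keep_rset simp: Psi_eq\<close>)
  have 6: "ach Q update_prog s1 (n * 3 + 5)
      ?R"
    if H: "?X s1 \<and> reals s1 23 0 0 = balance G S \<and> reals s1 24 0 0 = Psi G S" for s1
  proof -
    have k: "?X s1" using H by blast
    have im: "improve s s1 {}" by (rule improve_keep[OF valid k]) auto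
    note X1 = X[OF k]
    show ?thesis
      unfolding update_prog_def
    proof (rule ach_cond[where ?T1.0 = "n * 3 + 4"])
      assume b: "bval (BAnd (RLess (RC 0) (RV 23)) (BNot (BAnd (NLess NZ (NV 12)) (BNot (RLess (RV 24) (RV 19)))))) s1"
      let ?s2 = "rset (nset s1 12 0 0 1) 19 0 0 (Psi G S)"
      have k2: "keep {12} {19} s1 ?s2" by (intro keep_rset keep_nset) auto
      have "ach Q (For 37 num_verts (NSet 2 (NV 37) NZ (NGet 13 (NV 37) NZ))) ?s2 (n * (1 + 2) + 2)
          (\<lambda>s'. keep {2, 37} {} ?s2 s' \<and> nats s' 2 = (\<lambda>k l. if k < n \<and> l = 0 then of_bool (k \<in> S) else nats ?s2 2 k l))"
      proof (rule ach_fill1_nat[where NB = "{2}" and RB = "{}"])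
        fix i s' assume i: "i < n" and ks: "keep {2, 37} {} ?s2 s'" and x: "nats s' 37 0 0 = i"
        have "nats s' 13 = nats s 13" using keep_nats[OF ks, of 13] X1 by simp
        then show "ach Q (NSet 2 (NV 37) NZ (NGet 13 (NV 37) NZ)) s' 1
          (\<lambda>s''. keep {2} {} s' s'' \<and> nats s'' 2 = (nats s' 2)(i := (nats s' 2 i)(0 := of_bool (i \<in> S))))"
          by (intro ach_NSet conjI keep_nset) (simp_all add: x f(1)[OF i])
      qed (use X1 in \<open>auto simp: keep_nats env_def\<close>)
      then have F: "ach Q (For 37 num_verts (NSet 2 (NV 37) NZ (NGet 13 (NV 37) NZ))) ?s2 (n * 3 + 2)
        ?R"
      proof (rule ach_conseq, elim conjE, intro conjI)
        fix s' assume ks: "keep {2, 37} {} ?s2 s'"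
          and a: "nats s' 2 = (\<lambda>k l. if k < n \<and> l = 0 then of_bool (k \<in> S) else nats ?s2 2 k l)"
        have "keep {12, 37, 39} {19, 20, 21, 22, 23, 24, 36, 37, 38} s ?s2" by (rule keep_trans[OF k k2]) auto
        then show "keep {2, 12, 37, 39} {19, 20, 21, 22, 23, 24, 36, 37, 38} s s'" by (rule keep_trans[OF _ ks]) auto
        have out: "output_cut G s' = S" using S by (auto simp: output_cut_def V a)
        have fd: "nats s' 12 0 0 = 1" "reals s' 19 0 0 = Psi G S"
          using keep_nats[OF ks, of 12] keep_reals[OF ks, of 19] by simp_all
        have pos: "0 < balance G S" using b H by simp
        have better: "nats s1 12 0 0 \<noteq> 0 \<Longrightarrow> Psi G S < reals s1 19 0 0" using b H by auto
        show "improve s s' {S}"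
          unfolding improve_def
        proof (intro conjI allI impI ballI)
          show "valid s'" using out fd pos by (simp add: valid_def)
          \<comment> \<open>A stored cut is replaced only by one of smaller ratio, so whatever it
            beat remains beaten by transitivity.\<close>
          fix A assume "beats s A"
          then have "beats s1 A" using im by (simp add: improve_def)
          then show "beats s' A"
            using out fd better im unfolding beats_def improve_def valid_def by fastforce
        next
          fix A assume "A \<in> {S}"
          then show "beats s' A" using out fd by (simp add: beats_def)
        qed
      qed simp
      have e: "rval (RV 24) (nset s1 12 0 0 1) = Psi G S" using H by simp
      show "ach Q (Seq (NSet 12 NZ NZ (NConst 1)) (Seq (RSet 19 NZ NZ (RV 24))
          (For 37 num_verts (NSet 2 (NV 37) NZ (NGet 13 (NV 37) NZ))))) s1 (n * 3 + 4)
        ?R"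
        by (rule ach_NSet_seq, simp only: nval.simps, rule ach_RSet_seq, simp only: nval.simps e, rule F, rule order_refl, simp)
    next
      assume nb: "\<not> bval (BAnd (RLess (RC 0) (RV 23)) (BNot (BAnd (NLess NZ (NV 12)) (BNot (RLess (RV 24) (RV 19)))))) s1"
      \<comment> \<open>Without an update either the balance is not positive or the stored cut is at
        least as good.\<close>
      have "beats s1 S"
        unfolding beats_def using nb H improve_valid[OF im] by (auto simp: valid_def)
      then have "improve s s1 {S}" using im by (simp add: improve_def)
      moreover have "keep {2, 12, 37, 39} {19, 20, 21, 22, 23, 24, 36, 37, 38} s s1" by (rule keep_weaken[OF k]) auto
      ultimately show "ach Q Skip s1 (n * 3 + 4)
        ?R"
        by (intro ach_time[OF ach_Skip]) auto
    qed simp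
  qed
  show ?thesis
    unfolding eval_prog_def
    by (rule ach_seq[OF 1], rule ach_seq[OF 2], assumption, rule ach_seq[OF 3], assumption, rule ach_seq[OF 4], assumption,
        rule ach_seq[OF 5 6], assumption, assumption, (rule order_refl)+) simp
qed

end

section \<open>Running times of the nested loops\<close>

definition cut_time :: "nat \<Rightarrow> nat \<Rightarrow> nat" where
  "cut_time n M = n * (n * 4 + 6) + 2 + (n * 3 + 2) + (M * 8 + n * 11 + 20)"

definition seed_time :: "nat \<Rightarrow> nat \<Rightarrow> nat" where
  "seed_time n M = n * (n * (cut_time n M + 2) + 2 + 2) + 2"

definition mean_time :: "nat \<Rightarrow> nat \<Rightarrow> nat" where
  "mean_time n M = n * (n * 4 + 2 + seed_time n M + 2) + 2"

definition direction_time :: "nat \<Rightarrow> nat \<Rightarrow> nat" where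
  "direction_time n M = n * (mean_time n M + 2) + 2"

definition gain_time :: "nat \<Rightarrow> nat" where
  "gain_time n = n * (n * 4 + 6) + 2"

definition radius_time :: "nat \<Rightarrow> nat \<Rightarrow> nat \<Rightarrow> nat" where
  "radius_time n M J = n * 3 + 2 + (J * (gain_time n + (n * 3 + 2 + direction_time n M) + 2) + 2 + mean_time n M)"

definition search_time :: "nat \<Rightarrow> nat \<Rightarrow> nat \<Rightarrow> nat" where
  "search_time n M J = n * (n * (radius_time n M J + 2) + 2 + 2) + 2 + mean_time n M"

lemma gain_step:
  fixes t :: "nat \<Rightarrow> real"
  shows "Max (insert 0 ((\<lambda>z. t z - t x) ` {z. z < Suc i \<and> D x z \<le> r})) =
    (if D x i \<le> r \<and> Max (insert 0 ((\<lambda>z. t z - t x) ` {z. z < i \<and> D x z \<le> r})) < t i - t x then t i - t x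
     else Max (insert 0 ((\<lambda>z. t z - t x) ` {z. z < i \<and> D x z \<le> r})))"
proof -
  define g where "g i = Max (insert 0 ((\<lambda>z. t z - t x) ` {z. z < i \<and> D x z \<le> r}))" for i
  have fin: "finite {z. z < i \<and> D x z \<le> r}" by simp
  have "g (Suc i) = (if D x i \<le> r \<and> g i < t i - t x then t i - t x else g i)"
  proof (cases "D x i \<le> r")
    case True
    then have "{z. z < Suc i \<and> D x z \<le> r} = insert i {z. z < i \<and> D x z \<le> r}" by (auto simp: less_Suc_eq)
    then have "g (Suc i) = Max (insert (t i - t x) (insert 0 ((\<lambda>z. t z - t x) ` {z. z < i \<and> D x z \<le> r})))"
      by (simp add: g_def insert_commute)
    also have "\<dots> = max (t i - t x) (g i)" using fin by (simp add: g_def)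
    finally show ?thesis using True by (simp add: max_def)
  next
    case False
    then have "{z. z < Suc i \<and> D x z \<le> r} = {z. z < i \<and> D x z \<le> r}" by (auto simp: less_Suc_eq)
    then show ?thesis using False by (simp add: g_def)
  qed
  then show ?thesis by (simp only: g_def)
qed

section \<open>From single cuts to families of seeds\<close>

locale metric_cut_search = cut_search +
  assumes D_same: "\<And>x. D x x = 0" and D_nonneg: "\<And>x y. 0 \<le> D x y"
begin

abbreviation "M \<equiv> length es"

definition cuts :: "nat set \<Rightarrow> nat set set" where
  "cuts A = (\<Union>a<n. \<Union>b<n. {nbhd D n A (D a b)})"

abbreviation cutN :: "nat set" where "cutN \<equiv> {2, 12, 13, 14, 16, 37, 38, 39}"
abbreviation seedN :: "nat set" where "seedN \<equiv> {2, 12, 13, 14, 16, 35, 36, 37, 38, 39}"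
abbreviation dirN :: "nat set" where "dirN \<equiv> {2, 12, 13, 14, 15, 16, 33, 34, 35, 36, 37, 38, 39}"
abbreviation cutR :: "nat set" where "cutR \<equiv> {19, 20, 21, 22, 23, 24, 36, 37, 38}"

lemma ach_cut:
  assumes env: "env s" and valid: "valid s" and A: "A \<subseteq> {..<n}"
    and f: "\<And>i. i < n \<Longrightarrow> nats s 15 i 0 = of_bool (i \<in> A)"
    and ab: "nats s 35 0 0 = a" "nats s 36 0 0 = b" "a < n" "b < n"
  shows "ach Q cut_prog s (cut_time n M) (\<lambda>s'. keep cutN cutR s s' \<and> improve s s' {nbhd D n A (D a b)})"
proof -
  let ?S = "nbhd D n A (D a b)"
  let ?test = "BAnd (NLess NZ (NGet 15 (NV 38) NZ)) (BNot (RLess (RGet 10 (NV 35) (NV 36)) (RGet 10 (NV 37) (NV 38))))"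
  let ?in = "For 38 num_verts (Cond ?test (NSet 16 NZ NZ (NConst 1)) Skip)"
  let ?c1 = "For 37 num_verts (Seq (NSet 16 NZ NZ NZ) (Seq ?in (NSet 13 (NV 37) NZ (NV 16))))"
  let ?c2 = "For 37 num_verts (NSet 14 (NV 37) NZ (NMinus (NConst 1) (NGet 13 (NV 37) NZ)))"
  note e0 = env[unfolded env_def]
  have 1: "ach Q ?c1 s (n * (n * 4 + 4 + 2) + 2)
      (\<lambda>s'. keep {13, 16, 37, 38} {} s s' \<and> nats s' 13 = (\<lambda>k l. if k < n \<and> l = 0 then of_bool (k \<in> ?S) else nats s 13 k l))"
  proof (rule ach_fill1_nat[where NB = "{13, 16, 38}" and RB = "{}"])
    fix x s' assume x: "x < n" and k: "keep {13, 16, 37, 38} {} s s'" and nx: "nats s' 37 0 0 = x"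
    let ?s1 = "nset s' 16 0 0 0"
    let ?P = "\<lambda>i. \<exists>y<i. y \<in> A \<and> D x y \<le> D a b"
    have k1: "keep {16} {} s' ?s1" by (intro keep_nset) auto
    have I: "ach Q ?in ?s1 (n * (2 + 2) + 2) (\<lambda>s''. keep {16, 38} {} ?s1 s'' \<and> nats s'' 16 0 0 = of_bool (?P n))"
    proof (rule ach_For[where J = "\<lambda>i s''. nats s'' 16 0 0 = of_bool (?P i)"])
      fix i s'' assume i: "i < n" and k2: "keep {16, 38} {} ?s1 s''" and J: "nats s'' 16 0 0 = of_bool (?P i)" and y: "nats s'' 38 0 0 = i"
      have e: "nats s'' 15 = nats s 15" "nats s'' 35 = nats s 35" "nats s'' 36 = nats s 36" "nats s'' 37 0 0 = x" "reals s'' 10 = reals s 10"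
        using keep_nats[OF k2] keep_reals[OF k2] keep_nats[OF k] keep_reals[OF k] nx by simp_all
      have t: "bval ?test s'' \<longleftrightarrow> i \<in> A \<and> D x i \<le> D a b"
        using e0 x i ab by (auto simp: e y f)
      show "ach Q (Cond ?test (NSet 16 NZ NZ (NConst 1)) Skip) s'' 2
          (\<lambda>s3. keep {16, 38} {} ?s1 s3 \<and> nats s3 16 0 0 = of_bool (?P (Suc i)) \<and> nats s3 38 0 0 = i)"
      proof (rule ach_cond[where ?T1.0 = 1])
        assume "bval ?test s''"
        then have "?P (Suc i)" using t by auto
        then show "ach Q (NSet 16 NZ NZ (NConst 1)) s'' 1
          (\<lambda>s3. keep {16, 38} {} ?s1 s3 \<and> nats s3 16 0 0 = of_bool (?P (Suc i)) \<and> nats s3 38 0 0 = i)"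
          using k2 y by (intro ach_NSet conjI keep_nset) simp_all
      next
        assume "\<not> bval ?test s''"
        then have "?P (Suc i) \<longleftrightarrow> ?P i" using t by (auto simp: less_Suc_eq)
        then show "ach Q Skip s'' 1
          (\<lambda>s3. keep {16, 38} {} ?s1 s3 \<and> nats s3 16 0 0 = of_bool (?P (Suc i)) \<and> nats s3 38 0 0 = i)"
          using k2 y J by (intro ach_Skip) simp
      qed simp
    qed (use e0 in \<open>auto simp: keep_nats keep_nats[OF k]\<close>)
    have xS: "of_bool (?P n) = (of_bool (x \<in> ?S) :: nat)" using x by (simp add: nbhd_def)
    have "ach Q (Seq ?in (NSet 13 (NV 37) NZ (NV 16))) ?s1 (n * 4 + 3)
      (\<lambda>s''. keep {13, 16, 38} {} s' s'' \<and> nats s'' 13 = (nats s' 13)(x := (nats s' 13 x)(0 := of_bool (x \<in> ?S))))"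
    proof (rule ach_seq_NSet, rule ach_conseq[OF I _ order_refl], elim conjE, intro conjI)
      fix s2 assume k2: "keep {16, 38} {} ?s1 s2" and v: "nats s2 16 0 0 = of_bool (?P n)"
      show "keep {13, 16, 38} {} s' (nset s2 13 (nval (NV 37) s2) (nval NZ s2) (nval (NV 16) s2))"
        by (intro keep_nset keep_trans[OF k1 k2]) auto
      have "nats s2 37 0 0 = x" "nats s2 13 = nats s' 13" using keep_nats[OF k2] nx by simp_all
      then show "nats (nset s2 13 (nval (NV 37) s2) (nval NZ s2) (nval (NV 16) s2)) 13 =
          (nats s' 13)(x := (nats s' 13 x)(0 := of_bool (x \<in> ?S)))"
        using v unfolding xS by simp
    qed simp
    then show "ach Q (Seq (NSet 16 NZ NZ NZ) (Seq ?in (NSet 13 (NV 37) NZ (NV 16)))) s' (n * 4 + 4)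
      (\<lambda>s''. keep {13, 16, 38} {} s' s'' \<and> nats s'' 13 = (nats s' 13)(x := (nats s' 13 x)(0 := of_bool (x \<in> ?S))))"
      by (intro ach_NSet_seq[where ?T1.0 = "n * 4 + 3"]) simp_all
  qed (use e0 in \<open>auto simp: keep_nats\<close>)
  have 2: "ach Q ?c2 s1 (n * (1 + 2) + 2) (\<lambda>s'. keep {13, 14, 16, 37, 38} {} s s' \<and>
      (\<forall>i<n. nats s' 13 i 0 = of_bool (i \<in> ?S)) \<and> (\<forall>i<n. nats s' 14 i 0 = of_bool (i \<notin> ?S)))"
    if H: "keep {13, 16, 37, 38} {} s s1 \<and> nats s1 13 = (\<lambda>k l. if k < n \<and> l = 0 then of_bool (k \<in> ?S) else nats s 13 k l)" for s1
  proof -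
    have k1: "keep {13, 16, 37, 38} {} s s1" using H by blast
    have "ach Q ?c2 s1 (n * (1 + 2) + 2) (\<lambda>s'. keep {14, 37} {} s1 s' \<and>
        nats s' 14 = (\<lambda>k l. if k < n \<and> l = 0 then of_bool (k \<notin> ?S) else nats s1 14 k l))"
    proof (rule ach_fill1_nat[where NB = "{14}" and RB = "{}"])
      fix x s' assume x: "x < n" and k: "keep {14, 37} {} s1 s'" and nx: "nats s' 37 0 0 = x"
      have v: "nats s' 13 x 0 = of_bool (x \<in> ?S)" using keep_nats[OF k, of 13] H x by simp
      show "ach Q (NSet 14 (NV 37) NZ (NMinus (NConst 1) (NGet 13 (NV 37) NZ))) s' 1
         (\<lambda>s''. keep {14} {} s' s'' \<and> nats s'' 14 = (nats s' 14)(x := (nats s' 14 x)(0 := of_bool (x \<notin> ?S))))"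
        by (intro ach_NSet conjI keep_nset) (simp_all add: nx v)
    qed (use e0 in \<open>auto simp: keep_nats keep_nats[OF k1]\<close>)
    then show ?thesis
    proof (rule ach_conseq, elim conjE, intro conjI)
      fix s' assume k: "keep {14, 37} {} s1 s'" and a: "nats s' 14 = (\<lambda>k l. if k < n \<and> l = 0 then of_bool (k \<notin> ?S) else nats s1 14 k l)"
      show "keep {13, 14, 16, 37, 38} {} s s'" by (rule keep_trans[OF k1 k]) auto
      show "\<forall>i<n. nats s' 13 i 0 = of_bool (i \<in> ?S)" using keep_nats[OF k, of 13] H by simp
      show "\<forall>i<n. nats s' 14 i 0 = of_bool (i \<notin> ?S)" using a by simp
    qed simp
  qed
  have 3: "ach Q eval_prog s1 (M * 8 + n * 11 + 20) (\<lambda>s'. keep cutN cutR s s' \<and> improve s s' {?S})"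
    if H: "keep {13, 14, 16, 37, 38} {} s s1 \<and>
      (\<forall>i<n. nats s1 13 i 0 = of_bool (i \<in> ?S)) \<and> (\<forall>i<n. nats s1 14 i 0 = of_bool (i \<notin> ?S))" for s1
  proof -
    have k1: "keep {13, 14, 16, 37, 38} {} s s1" using H by blast
    have v1: "env s1" "valid s1" using env_keep[OF env k1] valid_keep[OF valid k1] by simp_all
    show ?thesis
    proof (rule ach_conseq[OF ach_eval[OF v1, of ?S]], goal_cases)
      case (4 s')
      have "keep cutN cutR s s'" by (rule keep_trans[OF k1 conjunct1[OF 4]]) auto
      then show ?case using improve_trans_keep[OF valid k1 _ _ _ conjunct2[OF 4]] by simp
    qed (use H in \<open>auto simp: nbhd_def\<close>)
  qed
  show ?thesis
    unfolding cut_prog_def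
    by (rule ach_seq[OF 1], rule ach_seq[OF 2 3], assumption, assumption, rule order_refl)
       (simp add: cut_time_def algebra_simps)
qed

lemma ach_seed:
  assumes env: "env s" and valid: "valid s" and A: "A \<subseteq> {..<n}"
    and f: "\<And>i. i < n \<Longrightarrow> nats s 15 i 0 = of_bool (i \<in> A)"
  shows "ach Q seed_prog s (seed_time n M) (\<lambda>s'. keep seedN cutR s s' \<and> improve s s' (cuts A))"
proof -
  have "ach Q seed_prog s (seed_time n M) (\<lambda>s'. keep seedN cutR s s' \<and> improve s s' (cuts A) \<and> True)"
    unfolding seed_prog_def seed_time_def cuts_def
  proof (rule ach_For_improve[where NB = "insert 36 cutN" and RB = cutR and K = "\<lambda>_ _. True", OF _ _ _ _ _ _ valid])
    fix a s1 assume a: "a < n" and k1: "keep seedN cutR s s1" and v1: "valid s1" and xa: "nats s1 35 0 0 = a"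
    show "ach Q (For 36 num_verts cut_prog) s1 (n * (cut_time n M + 2) + 2) (\<lambda>s'. keep (insert 36 cutN) cutR s1 s' \<and>
        improve s1 s' (\<Union>b<n. {nbhd D n A (D a b)}) \<and> True)"
    proof (rule ach_For_improve[where NB = cutN and RB = cutR and K = "\<lambda>_ _. True", OF _ _ _ _ _ _ v1])
      fix b s2 assume b: "b < n" and k2: "keep (insert 36 cutN) cutR s1 s2" and v2: "valid s2" and xb: "nats s2 36 0 0 = b"
      have k: "keep seedN cutR s s2" by (rule keep_trans[OF k1 k2]) auto
      have e2: "env s2" using env_keep[OF env k] by simp
      have "nats s2 15 = nats s 15" "nats s2 35 0 0 = a" using keep_nats[OF k] keep_nats[OF k2] xa by simp_all
      then show "ach Q cut_prog s2 (cut_time n M) (\<lambda>s'. keep cutN cutR s2 s' \<and> improve s2 s' {nbhd D n A (D a b)} \<and> True)"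
        using ach_cut[OF e2 v2 A _ _ xb, of a] f a b by simp
    qed (use env_keep[OF env k1] in \<open>auto simp: env_def keep_nats\<close>)
  qed (use env in \<open>auto simp: env_def keep_nats\<close>)
  then show ?thesis by simp
qed

lemma ach_fill:
  assumes env: "env s"
    and b: "\<And>x s'. x < n \<Longrightarrow> keep {15, 37} {} s s' \<Longrightarrow> nats s' 37 0 0 = x \<Longrightarrow> bval b s' \<longleftrightarrow> x \<in> A"
  shows "ach Q (fill_prog b) s (n * 4 + 2) (\<lambda>s'. keep {15, 37} {} s s' \<and> (\<forall>x<n. nats s' 15 x 0 = of_bool (x \<in> A)))"
proof -
  have "ach Q (fill_prog b) s (n * (2 + 2) + 2)
    (\<lambda>s'. keep {15, 37} {} s s' \<and> nats s' 15 = (\<lambda>k l. if k < n \<and> l = 0 then of_bool (k \<in> A) else nats s 15 k l))"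
    unfolding fill_prog_def
  proof (rule ach_fill1_nat[where NB = "{15}" and RB = "{}"])
    fix x s' assume x: "x < n" and k: "keep {15, 37} {} s s'" and nx: "nats s' 37 0 0 = x"
    note bx = b[OF x k nx]
    show "ach Q (Cond b (NSet 15 (NV 37) NZ (NConst 1)) (NSet 15 (NV 37) NZ NZ)) s' 2
      (\<lambda>s''. keep {15} {} s' s'' \<and> nats s'' 15 = (nats s' 15)(x := (nats s' 15 x)(0 := of_bool (x \<in> A))))"
      by (rule ach_cond[where ?T1.0 = 1]; (rule ach_NSet)?)
         (auto simp: bx nx intro!: keep_nset)
  qed (use env in \<open>auto simp: env_def keep_nats\<close>)
  then show ?thesis by (rule ach_conseq) auto
qed

lemma ach_fill_seed:
  assumes env: "env s" and valid: "valid s" and A: "A \<subseteq> {..<n}"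
    and b: "\<And>x s'. x < n \<Longrightarrow> keep {15, 37} {} s s' \<Longrightarrow> nats s' 37 0 0 = x \<Longrightarrow> bval b s' \<longleftrightarrow> x \<in> A"
  shows "ach Q (Seq (fill_prog b) seed_prog) s (n * 4 + 2 + seed_time n M)
    (\<lambda>s'. keep (insert 15 seedN) cutR s s' \<and> improve s s' (cuts A))"
proof (rule ach_seq[OF ach_fill[OF env b]])
  fix s1 assume H: "keep {15, 37} {} s s1 \<and> (\<forall>x<n. nats s1 15 x 0 = of_bool (x \<in> A))"
  have k1: "keep {15, 37} {} s s1" using H by blast
  have v1: "env s1" "valid s1" using env_keep[OF env k1] valid_keep[OF valid k1] by simp_all
  show "ach Q seed_prog s1 (seed_time n M) (\<lambda>s'. keep (insert 15 seedN) cutR s s' \<and> improve s s' (cuts A))"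
  proof (rule ach_conseq[OF ach_seed[OF v1 A]], goal_cases)
    case (2 s')
    have "keep (insert 15 seedN) cutR s s'" by (rule keep_trans[OF k1 conjunct1[OF 2]]) auto
    then show ?case using improve_trans_keep[OF valid k1 _ _ _ conjunct2[OF 2]] by simp
  qed (use H in auto)
qed simp_all

lemma ach_gain:
  assumes env: "env s" and ab: "nats s 30 0 0 = a" "nats s 31 0 0 = b" "a < n" "b < n" and j: "nats s 32 0 0 = j" "j < J"
  shows "ach Q gain_prog s (gain_time n) (\<lambda>s'. keep {37, 38} {13, 25} s s' \<and>
    (\<forall>x<n. reals s' 13 x 0 = gain D n (D a b) (Tab j) x))"
proof -
  let ?diff = "RMinus (RGet 12 (NV 32) (NV 38)) (RGet 12 (NV 32) (NV 37))"
  let ?test = "BAnd (BNot (RLess (RGet 10 (NV 30) (NV 31)) (RGet 10 (NV 37) (NV 38)))) (RLess (RV 25) ?diff)"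
  let ?in = "For 38 num_verts (Cond ?test (RSet 25 NZ NZ ?diff) Skip)"
  let ?t = "Tab j"
  note e0 = env[unfolded env_def]
  have "ach Q gain_prog s (n * (n * 4 + 4 + 2) + 2) (\<lambda>s'. keep {37, 38} {13, 25} s s' \<and>
    reals s' 13 = (\<lambda>k l. if k < n \<and> l = 0 then gain D n (D a b) ?t k else reals s 13 k l))"
    unfolding gain_prog_def
  proof (rule ach_fill1_real[where NB = "{38}" and RB = "{13, 25}"])
    fix x s' assume x: "x < n" and k: "keep {37, 38} {13, 25} s s'" and nx: "nats s' 37 0 0 = x"
    let ?s1 = "rset s' 25 0 0 0"
    let ?g = "\<lambda>i. Max (insert 0 ((\<lambda>z. ?t z - ?t x) ` {z. z < i \<and> D x z \<le> D a b}))"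
    have k1: "keep {} {25} s' ?s1" by (intro keep_rset) auto
    have I: "ach Q ?in ?s1 (n * (2 + 2) + 2) (\<lambda>s''. keep {38} {25} ?s1 s'' \<and> reals s'' 25 0 0 = ?g n)"
    proof (rule ach_For[where J = "\<lambda>i s''. reals s'' 25 0 0 = ?g i"])
      fix i s'' assume i: "i < n" and k2: "keep {38} {25} ?s1 s''" and J: "reals s'' 25 0 0 = ?g i" and y: "nats s'' 38 0 0 = i"
      have e: "nats s'' 30 = nats s 30" "nats s'' 31 = nats s 31" "nats s'' 32 = nats s 32" "nats s'' 37 0 0 = x"
          "reals s'' 10 = reals s 10" "reals s'' 12 = reals s 12"
        using keep_nats[OF k2] keep_reals[OF k2] keep_nats[OF k] keep_reals[OF k] nx by simp_all
      have d: "rval ?diff s'' = ?t i - ?t x" using e0 x i j by (simp add: e y)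
      have t: "bval ?test s'' \<longleftrightarrow> D x i \<le> D a b \<and> ?g i < ?t i - ?t x"
        using e0 x i ab d J by (auto simp: e y)
      note g = gain_step[of ?t x i D "D a b"]
      show "ach Q (Cond ?test (RSet 25 NZ NZ ?diff) Skip) s'' 2
          (\<lambda>s3. keep {38} {25} ?s1 s3 \<and> reals s3 25 0 0 = ?g (Suc i) \<and> nats s3 38 0 0 = i)"
      proof (rule ach_cond[where ?T1.0 = 1])
        assume b: "bval ?test s''"
        have "?g (Suc i) = ?t i - ?t x" unfolding g if_P[OF b[unfolded t]] ..
        then show "ach Q (RSet 25 NZ NZ ?diff) s'' 1
          (\<lambda>s3. keep {38} {25} ?s1 s3 \<and> reals s3 25 0 0 = ?g (Suc i) \<and> nats s3 38 0 0 = i)"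
          using k2 y d by (intro ach_RSet conjI keep_rset) simp_all
      next
        assume b: "\<not> bval ?test s''"
        have "?g (Suc i) = ?g i" unfolding g if_not_P[OF b[unfolded t]] ..
        then show "ach Q Skip s'' 1
          (\<lambda>s3. keep {38} {25} ?s1 s3 \<and> reals s3 25 0 0 = ?g (Suc i) \<and> nats s3 38 0 0 = i)"
          using k2 y J by (intro ach_Skip) simp
      qed simp
    qed (use e0 in \<open>auto simp: keep_nats keep_nats[OF k]\<close>)
    \<comment> \<open>The running maximum starts at 0; this value is attained at
      \<open>z = x\<close>, which lies in the ball because \<open>D x x = 0\<close>.\<close>
    have gx: "?g n = gain D n (D a b) ?t x"
    proof -
      have "x \<in> {z. z < n \<and> D x z \<le> D a b}" using x D_same[of x] D_nonneg[of a b] by simp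
      then have "?t x - ?t x \<in> (\<lambda>z. ?t z - ?t x) ` {z. z < n \<and> D x z \<le> D a b}" by (rule imageI)
      then have "0 \<in> (\<lambda>z. ?t z - ?t x) ` {z. z < n \<and> D x z \<le> D a b}" by simp
      then show ?thesis unfolding gain_def by (simp only: insert_absorb)
    qed
    have "ach Q (Seq ?in (RSet 13 (NV 37) NZ (RV 25))) ?s1 (n * 4 + 3)
      (\<lambda>s''. keep {38} {13, 25} s' s'' \<and> reals s'' 13 = (reals s' 13)(x := (reals s' 13 x)(0 := gain D n (D a b) ?t x)))"
    proof (rule ach_seq_RSet, rule ach_conseq[OF I _ order_refl], elim conjE, intro conjI)
      fix s2 assume k2: "keep {38} {25} ?s1 s2" and v: "reals s2 25 0 0 = ?g n"
      show "keep {38} {13, 25} s' (rset s2 13 (nval (NV 37) s2) (nval NZ s2) (rval (RV 25) s2))"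
        by (intro keep_rset keep_trans[OF k1 k2]) auto
      have "nats s2 37 0 0 = x" "reals s2 13 = reals s' 13" using keep_nats[OF k2] keep_reals[OF k2] nx by simp_all
      then show "reals (rset s2 13 (nval (NV 37) s2) (nval NZ s2) (rval (RV 25) s2)) 13 =
          (reals s' 13)(x := (reals s' 13 x)(0 := gain D n (D a b) ?t x))"
        using v unfolding gx by simp
    qed simp
    then show "ach Q (Seq (RSet 25 NZ NZ (RC 0)) (Seq ?in (RSet 13 (NV 37) NZ (RV 25)))) s' (n * 4 + 4)
      (\<lambda>s''. keep {38} {13, 25} s' s'' \<and> reals s'' 13 = (reals s' 13)(x := (reals s' 13 x)(0 := gain D n (D a b) ?t x)))"
      by (intro ach_RSet_seq[where ?T1.0 = "n * 4 + 3"]) simp_all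
  qed (use e0 in \<open>auto simp: keep_nats\<close>)
  then show ?thesis by (rule ach_conseq) (auto simp: gain_time_def)
qed

lemma ach_mean:
  assumes env: "env s" and valid: "valid s" and g: "\<And>x. x < n \<Longrightarrow> reals s 14 x 0 = g x"
  shows "ach Q mean_prog s (mean_time n M) (\<lambda>s'. keep dirN cutR s s' \<and>
    improve s s' (\<Union>x2<n. cuts {x. x < n \<and> g x2 \<le> g x}))"
proof -
  have "ach Q mean_prog s (mean_time n M) (\<lambda>s'. keep dirN cutR s s' \<and>
    improve s s' (\<Union>x2<n. cuts {x. x < n \<and> g x2 \<le> g x}) \<and> True)"
    unfolding mean_prog_def mean_time_def
  proof (rule ach_For_improve[where NB = "insert 15 seedN" and RB = cutR and K = "\<lambda>_ _. True", OF _ _ _ _ _ _ valid])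
    fix x2 s1 assume x2: "x2 < n" and k1: "keep dirN cutR s s1" and v1: "valid s1" and xx: "nats s1 34 0 0 = x2"
    have e1: "env s1" using env_keep[OF env k1] by simp
    show "ach Q (Seq (fill_prog (not_less (RGet 14 (NV 34) NZ) (RGet 14 (NV 37) NZ))) seed_prog) s1 (n * 4 + 2 + seed_time n M)
      (\<lambda>s'. keep (insert 15 seedN) cutR s1 s' \<and> improve s1 s' (cuts {x. x < n \<and> g x2 \<le> g x}) \<and> True)"
      unfolding simp_thms
    proof (rule ach_fill_seed[OF e1 v1])
      fix x s2 assume x: "x < n" and k2: "keep {15, 37} {} s1 s2" and nx: "nats s2 37 0 0 = x"
      have "reals s2 14 = reals s 14" "nats s2 34 0 0 = x2"
        using keep_reals[OF k1] keep_reals[OF k2] keep_nats[OF k2] xx by simp_all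
      then show "bval (not_less (RGet 14 (NV 34) NZ) (RGet 14 (NV 37) NZ)) s2 \<longleftrightarrow> x \<in> {x. x < n \<and> g x2 \<le> g x}"
        using x x2 nx by (auto simp: not_less_def g)
    qed auto
  qed (use env in \<open>auto simp: env_def keep_nats\<close>)
  then show ?thesis by simp
qed

lemma ach_direction:
  assumes env: "env s" and valid: "valid s" and g: "\<And>x. x < n \<Longrightarrow> reals s 13 x 0 = gain D n r (Tab j) x"
    and j: "nats s 32 0 0 = j" "j < J"
  shows "ach Q direction_prog s (direction_time n M) (\<lambda>s'. keep dirN cutR s s' \<and>
    improve s s' (\<Union>x1<n. \<Union>x2<n. cuts (direction_seed D n r (Tab j) x1 x2)))"
proof -
  let ?b = "BAnd (not_less (RGet 12 (NV 32) (NV 33)) (RGet 12 (NV 32) (NV 37)))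
                      (not_less (RGet 13 (NV 34) NZ) (RGet 13 (NV 37) NZ))"
  have "ach Q direction_prog s (direction_time n M) (\<lambda>s'. keep dirN cutR s s' \<and>
    improve s s' (\<Union>x1<n. \<Union>x2<n. cuts (direction_seed D n r (Tab j) x1 x2)) \<and> True)"
    unfolding direction_prog_def direction_time_def mean_time_def
  proof (rule ach_For_improve[where NB = "{2, 12, 13, 14, 15, 16, 34, 35, 36, 37, 38, 39}" and RB = cutR and K = "\<lambda>_ _. True", OF _ _ _ _ _ _ valid])
    fix x1 s0 assume x1: "x1 < n" and k0: "keep dirN cutR s s0" and v0: "valid s0" and xx1: "nats s0 33 0 0 = x1"
    show "ach Q (For 34 num_verts (Seq (fill_prog ?b) seed_prog)) s0 (n * (n * 4 + 2 + seed_time n M + 2) + 2)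
      (\<lambda>s'. keep {2, 12, 13, 14, 15, 16, 34, 35, 36, 37, 38, 39} cutR s0 s' \<and>
        improve s0 s' (\<Union>x2<n. cuts (direction_seed D n r (Tab j) x1 x2)) \<and> True)"
    proof (rule ach_For_improve[where NB = "insert 15 seedN" and RB = cutR and K = "\<lambda>_ _. True", OF _ _ _ _ _ _ v0])
      fix x2 s1 assume x2: "x2 < n" and k1: "keep {2, 12, 13, 14, 15, 16, 34, 35, 36, 37, 38, 39} cutR s0 s1"
        and v1: "valid s1" and xx2: "nats s1 34 0 0 = x2"
      have k: "keep dirN cutR s s1" by (rule keep_trans[OF k0 k1]) auto
      have e1: "env s1" using env_keep[OF env k] by simp
      show "ach Q (Seq (fill_prog ?b) seed_prog) s1 (n * 4 + 2 + seed_time n M)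
        (\<lambda>s'. keep (insert 15 seedN) cutR s1 s' \<and> improve s1 s' (cuts (direction_seed D n r (Tab j) x1 x2)) \<and> True)"
        unfolding simp_thms
      proof (rule ach_fill_seed[OF e1 v1])
        fix x s2 assume x: "x < n" and k2: "keep {15, 37} {} s1 s2" and nx: "nats s2 37 0 0 = x"
        have "reals s2 13 = reals s 13" "reals s2 12 = reals s 12" "nats s2 34 0 0 = x2" "nats s2 33 0 0 = x1" "nats s2 32 0 0 = j"
          using keep_reals[OF k] keep_reals[OF k2] keep_nats[OF k2] keep_nats[OF k] keep_nats[OF k1] xx1 xx2 j by simp_all
        then show "bval ?b s2 \<longleftrightarrow> x \<in> direction_seed D n r (Tab j) x1 x2"
          using x x1 x2 nx j env[unfolded env_def] by (auto simp: not_less_def g direction_seed_def)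
      qed (auto simp: direction_seed_def)
    qed (use env_keep[OF env k0] in \<open>auto simp: env_def keep_nats\<close>)
  qed (use env in \<open>auto simp: env_def keep_nats\<close>)
  then show ?thesis by simp
qed

end

section \<open>Assembling the search over radii\<close>

context metric_cut_search
begin

definition sum_gain :: "real \<Rightarrow> nat \<Rightarrow> real" where
  "sum_gain r x = (\<Sum>j<J. gain D n r (Tab j) x)"

definition direction_cuts :: "real \<Rightarrow> nat \<Rightarrow> nat set set" where
  "direction_cuts r j = (\<Union>x1<n. \<Union>x2<n. cuts (direction_seed D n r (Tab j) x1 x2))"

definition mean_cuts :: "real \<Rightarrow> nat set set" where
  "mean_cuts r = (\<Union>x2<n. cuts {x. x < n \<and> sum_gain r x2 \<le> sum_gain r x})"

lemma ach_radius:
  assumes env: "env s" and valid: "valid s" and ab: "nats s 30 0 0 = a" "nats s 31 0 0 = b" "a < n" "b < n"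
  shows "ach Q radius_prog s (radius_time n M J) (\<lambda>s'. keep (insert 32 dirN) ({13, 14, 25} \<union> cutR) s s' \<and>
    improve s s' ((\<Union>j<J. direction_cuts (D a b) j) \<union> mean_cuts (D a b)))"
proof -
  let ?r = "D a b"
  let ?add = "For 37 num_verts (RSet 14 (NV 37) NZ (RPlus (RGet 14 (NV 37) NZ) (RGet 13 (NV 37) NZ)))"
  let ?RA = "{13, 14, 25} \<union> cutR"
  note e0 = env[unfolded env_def]
  have 1: "ach Q (For 37 num_verts (RSet 14 (NV 37) NZ (RC 0))) s (n * (1 + 2) + 2)
      (\<lambda>s'. keep {37} {14} s s' \<and> reals s' 14 = (\<lambda>k l. if k < n \<and> l = 0 then 0 else reals s 14 k l))"
  proof (rule ach_fill1_real[where NB = "{}" and RB = "{14}"])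
    fix x and s' :: store assume "nats s' 37 0 0 = x"
    then show "ach Q (RSet 14 (NV 37) NZ (RC 0)) s' 1
      (\<lambda>s''. keep {} {14} s' s'' \<and> reals s'' 14 = (reals s' 14)(x := (reals s' 14 x)(0 := 0)))"
      by (intro ach_RSet conjI keep_rset) simp_all
  qed (use e0 in \<open>auto simp: keep_nats\<close>)
  \<comment> \<open>The real array 14 accumulates the sums for \<open>mean_prog\<close> across the
    tests of cuts, which write only the natural array of the same number.\<close>
  let ?K = "\<lambda>j s'. \<forall>x<n. reals s' 14 x 0 = (\<Sum>j'<j. gain D n ?r (Tab j') x)"
  have 2: "ach Q (For 32 (NV 11) (Seq gain_prog (Seq ?add direction_prog))) s1
      (J * (gain_time n + (n * 3 + 2 + direction_time n M) + 2) + 2)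
      (\<lambda>s'. keep (insert 32 dirN) ?RA s s' \<and> improve s s' (\<Union>j<J. direction_cuts ?r j) \<and> ?K J s')"
    if H: "keep {37} {14} s s1 \<and> reals s1 14 = (\<lambda>k l. if k < n \<and> l = 0 then 0 else reals s 14 k l)" for s1
  proof -
    have k1: "keep {37} {14} s s1" using H by blast
    have v1: "env s1" "valid s1" using env_keep[OF env k1] valid_keep[OF valid k1] by simp_all
    have "ach Q (For 32 (NV 11) (Seq gain_prog (Seq ?add direction_prog))) s1
      (J * (gain_time n + (n * 3 + 2 + direction_time n M) + 2) + 2)
      (\<lambda>s'. keep (insert 32 dirN) ?RA s1 s' \<and> improve s1 s' (\<Union>j<J. direction_cuts ?r j) \<and> ?K J s')"
    proof (rule ach_For_improve[where NB = dirN and RB = ?RA and K = ?K, OF _ _ _ _ _ _ v1(2)])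
      fix j s2 assume j: "j < J" and k2: "keep (insert 32 dirN) ?RA s1 s2" and v2: "valid s2"
        and xj: "nats s2 32 0 0 = j" and K: "?K j s2"
      have k: "keep (insert 32 dirN) ?RA s s2" by (rule keep_trans[OF k1 k2]) auto
      have e2: "env s2" using env_keep[OF env k] by simp
      have ab2: "nats s2 30 0 0 = a" "nats s2 31 0 0 = b" using keep_nats[OF k] ab by simp_all
      note g = ach_gain[OF e2 ab2 ab(3,4) xj j]
      have add: "ach Q ?add s3 (n * 3 + 2) (\<lambda>s4. keep {37, 38} {13, 14, 25} s2 s4 \<and>
          (\<forall>x<n. reals s4 13 x 0 = gain D n ?r (Tab j) x) \<and> ?K (Suc j) s4)"
        if H3: "keep {37, 38} {13, 25} s2 s3 \<and> (\<forall>x<n. reals s3 13 x 0 = gain D n ?r (Tab j) x)" for s3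
      proof -
        have k3: "keep {37, 38} {13, 25} s2 s3" using H3 by blast
        have e3: "env s3" using env_keep[OF e2 k3] by simp
        have "ach Q ?add s3 (n * (1 + 2) + 2) (\<lambda>s4. keep {37} {14} s3 s4 \<and>
          reals s4 14 = (\<lambda>k l. if k < n \<and> l = 0 then (\<Sum>j'<Suc j. gain D n ?r (Tab j') k) else reals s3 14 k l))"
        proof (rule ach_fill1_real[where NB = "{}" and RB = "{14}"])
          fix x s4 assume x: "x < n" and k4: "keep {37} {14} s3 s4" and nx: "nats s4 37 0 0 = x"
            and old: "reals s4 14 x 0 = reals s3 14 x 0"
          have "reals s4 14 x 0 + reals s4 13 x 0 = (\<Sum>j'<Suc j. gain D n ?r (Tab j') x)"
            using old keep_reals[OF k3, of 14] keep_reals[OF k4, of 13] K H3 x by simp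
          then show "ach Q (RSet 14 (NV 37) NZ (RPlus (RGet 14 (NV 37) NZ) (RGet 13 (NV 37) NZ))) s4 1
            (\<lambda>s''. keep {} {14} s4 s'' \<and> reals s'' 14 = (reals s4 14)(x := (reals s4 14 x)(0 := \<Sum>j'<Suc j. gain D n ?r (Tab j') x)))"
            by (intro ach_RSet conjI keep_rset) (simp_all add: nx)
        qed (use e3 in \<open>auto simp: keep_nats env_def\<close>)
        then show ?thesis
        proof (rule ach_conseq, elim conjE, intro conjI)
          fix s4 assume k4: "keep {37} {14} s3 s4"
            and a: "reals s4 14 = (\<lambda>k l. if k < n \<and> l = 0 then (\<Sum>j'<Suc j. gain D n ?r (Tab j') k) else reals s3 14 k l)"
          show "keep {37, 38} {13, 14, 25} s2 s4" by (rule keep_trans[OF k3 k4]) auto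
          show "\<forall>x<n. reals s4 13 x 0 = gain D n ?r (Tab j) x" using H3 keep_reals[OF k4, of 13] by simp
          show "?K (Suc j) s4" unfolding a by simp
        qed simp
      qed
      have dir: "ach Q direction_prog s4 (direction_time n M) (\<lambda>s5. keep dirN ?RA s2 s5 \<and>
          improve s2 s5 (direction_cuts ?r j) \<and> ?K (Suc j) s5)"
        if H4: "keep {37, 38} {13, 14, 25} s2 s4 \<and> (\<forall>x<n. reals s4 13 x 0 = gain D n ?r (Tab j) x) \<and> ?K (Suc j) s4" for s4
      proof -
        have k4: "keep {37, 38} {13, 14, 25} s2 s4" using H4 by blast
        have v4: "env s4" "valid s4" using env_keep[OF e2 k4] valid_keep[OF v2 k4] by simp_all
        have j4: "nats s4 32 0 0 = j" using keep_nats[OF k4] xj by simp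
        have g4: "reals s4 13 x 0 = gain D n ?r (Tab j) x" if "x < n" for x using H4 that by blast
        show ?thesis
        proof (rule ach_conseq[OF ach_direction[OF v4 g4 j4 j]], assumption, elim conjE, intro conjI)
          fix s5 assume k5: "keep dirN cutR s4 s5"
            and im: "improve s4 s5 (\<Union>x1<n. \<Union>x2<n. cuts (direction_seed D n ?r (Tab j) x1 x2))"
          show "keep dirN ?RA s2 s5" by (rule keep_trans[OF k4 k5]) auto
          show "improve s2 s5 (direction_cuts ?r j)"
            unfolding direction_cuts_def by (rule improve_trans_keep[OF v2 k4 _ _ _ im]) auto
          show "?K (Suc j) s5" using H4 keep_reals[OF k5, of 14] by simp
        qed simp
      qed
      show "ach Q (Seq gain_prog (Seq ?add direction_prog)) s2 (gain_time n + (n * 3 + 2 + direction_time n M))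
        (\<lambda>s''. keep dirN ?RA s2 s'' \<and> improve s2 s'' (direction_cuts ?r j) \<and> ?K (Suc j) s'')"
        by (rule ach_seq[OF g], rule ach_seq[OF add dir], assumption, assumption, (rule order_refl)+)
    next
      show "?K 0 s1" using H by simp
    qed (use v1 in \<open>auto simp: env_def keep_nats\<close>)
    then show ?thesis
    proof (rule ach_conseq, elim conjE, intro conjI)
      fix s' assume k2: "keep (insert 32 dirN) ?RA s1 s'" and im: "improve s1 s' (\<Union>j<J. direction_cuts ?r j)"
      show "keep (insert 32 dirN) ?RA s s'" by (rule keep_trans[OF k1 k2]) auto
      show "improve s s' (\<Union>j<J. direction_cuts ?r j)" by (rule improve_trans_keep[OF valid k1 _ _ _ im]) auto
    qed simp_all
  qed
  have 3: "ach Q mean_prog s1 (mean_time n M) (\<lambda>s'. keep (insert 32 dirN) ?RA s s' \<and>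
      improve s s' ((\<Union>j<J. direction_cuts ?r j) \<union> mean_cuts ?r))"
    if H: "keep (insert 32 dirN) ?RA s s1 \<and> improve s s1 (\<Union>j<J. direction_cuts ?r j) \<and> ?K J s1" for s1
  proof -
    have k1: "keep (insert 32 dirN) ?RA s s1" using H by blast
    have v1: "env s1" "valid s1" using env_keep[OF env k1] H improve_valid by auto
    have g1: "reals s1 14 x 0 = sum_gain ?r x" if "x < n" for x using H that unfolding sum_gain_def by blast
    show ?thesis
    proof (rule ach_conseq[OF ach_mean[OF v1 g1]], assumption, elim conjE, intro conjI)
      fix s' assume k2: "keep dirN cutR s1 s'" and im: "improve s1 s' (\<Union>x2<n. cuts {x. x < n \<and> sum_gain ?r x2 \<le> sum_gain ?r x})"
      show "keep (insert 32 dirN) ?RA s s'" by (rule keep_trans[OF k1 k2]) auto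
      show "improve s s' ((\<Union>j<J. direction_cuts ?r j) \<union> mean_cuts ?r)"
        unfolding mean_cuts_def by (rule improve_trans[OF _ im]) (use H in blast)
    qed simp
  qed
  show ?thesis
    unfolding radius_prog_def
    by (rule ach_seq[OF 1], rule ach_seq[OF 2 3], assumption, assumption, rule order_refl) (simp add: radius_time_def)
qed

theorem ach_search:
  assumes env: "env s" and valid: "valid s"
  shows "ach Q search_prog s (search_time n M J) (\<lambda>s'. improve s s'
    ((\<Union>a<n. \<Union>b<n. (\<Union>j<J. direction_cuts (D a b) j) \<union> mean_cuts (D a b)) \<union> (\<Union>x<n. cuts {x})))"
proof -
  let ?RA = "{13, 14, 25} \<union> cutR"
  let ?NA = "{30, 31, 32} \<union> dirN"
  let ?F = "\<lambda>a b. (\<Union>j<J. direction_cuts (D a b) j) \<union> mean_cuts (D a b)"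
  let ?b = "BAnd (BNot (NLess (NV 33) (NV 37))) (BNot (NLess (NV 37) (NV 33)))"
  have 1: "ach Q (For 30 num_verts (For 31 num_verts radius_prog)) s (n * (n * (radius_time n M J + 2) + 2 + 2) + 2)
     (\<lambda>s'. keep ?NA ?RA s s' \<and> improve s s' (\<Union>a<n. \<Union>b<n. ?F a b) \<and> True)"
  proof (rule ach_For_improve[where NB = "{31, 32} \<union> dirN" and RB = ?RA and K = "\<lambda>_ _. True", OF _ _ _ _ _ _ valid])
    fix a s1 assume a: "a < n" and k1: "keep ?NA ?RA s s1" and v1: "valid s1" and xa: "nats s1 30 0 0 = a"
    show "ach Q (For 31 num_verts radius_prog) s1 (n * (radius_time n M J + 2) + 2)
       (\<lambda>s'. keep ({31, 32} \<union> dirN) ?RA s1 s' \<and> improve s1 s' (\<Union>b<n. ?F a b) \<and> True)"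
    proof (rule ach_For_improve[where NB = "insert 32 dirN" and RB = ?RA and K = "\<lambda>_ _. True", OF _ _ _ _ _ _ v1])
      fix b s2 assume b: "b < n" and k2: "keep ({31, 32} \<union> dirN) ?RA s1 s2" and v2: "valid s2" and xb: "nats s2 31 0 0 = b"
      have k: "keep ?NA ?RA s s2" by (rule keep_trans[OF k1 k2]) auto
      have e2: "env s2" using env_keep[OF env k] by simp
      have "nats s2 30 0 0 = a" using keep_nats[OF k2] xa by simp
      then show "ach Q radius_prog s2 (radius_time n M J) (\<lambda>s'. keep (insert 32 dirN) ?RA s2 s' \<and> improve s2 s' (?F a b) \<and> True)"
        unfolding simp_thms by (rule ach_radius[OF e2 v2 _ xb a b])
    qed (use env_keep[OF env k1] in \<open>auto simp: env_def keep_nats\<close>)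
  qed (use env in \<open>auto simp: env_def keep_nats\<close>)
  have 2: "ach Q (For 33 num_verts (Seq (fill_prog ?b) seed_prog)) s1 (mean_time n M)
      (\<lambda>s'. improve s s' ((\<Union>a<n. \<Union>b<n. ?F a b) \<union> (\<Union>x<n. cuts {x})))"
    if H: "keep ?NA ?RA s s1 \<and> improve s s1 (\<Union>a<n. \<Union>b<n. ?F a b) \<and> True" for s1
  proof -
    have k1: "keep ?NA ?RA s s1" using H by blast
    have v1: "env s1" "valid s1" using env_keep[OF env k1] H improve_valid by auto
    have "ach Q (For 33 num_verts (Seq (fill_prog ?b) seed_prog)) s1 (mean_time n M)
      (\<lambda>s'. keep dirN cutR s1 s' \<and> improve s1 s' (\<Union>x<n. cuts {x}) \<and> True)"
      unfolding mean_time_def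
    proof (rule ach_For_improve[where NB = "insert 15 seedN" and RB = cutR and K = "\<lambda>_ _. True", OF _ _ _ _ _ _ v1(2)])
      fix x0 s2 assume x0: "x0 < n" and k2: "keep dirN cutR s1 s2" and v2: "valid s2" and xx: "nats s2 33 0 0 = x0"
      have e2: "env s2" using env_keep[OF v1(1) k2] by simp
      show "ach Q (Seq (fill_prog ?b) seed_prog) s2 (n * 4 + 2 + seed_time n M)
        (\<lambda>s'. keep (insert 15 seedN) cutR s2 s' \<and> improve s2 s' (cuts {x0}) \<and> True)"
        unfolding simp_thms
      proof (rule ach_fill_seed[OF e2 v2])
        fix x s3 assume x: "x < n" and k3: "keep {15, 37} {} s2 s3" and nx: "nats s3 37 0 0 = x"
        have "nats s3 33 0 0 = x0" using keep_nats[OF k3] xx by simp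
        then show "bval ?b s3 \<longleftrightarrow> x \<in> {x0}" using nx by auto
      qed (use x0 in auto)
    qed (use v1 in \<open>auto simp: env_def keep_nats\<close>)
    then show ?thesis
      by (rule ach_conseq) (use H improve_trans in blast)+
  qed
  show ?thesis
    unfolding search_prog_def by (rule ach_seq[OF 1 2]) (simp_all add: search_time_def)
qed

end

section \<open>Main theorem\<close>

definition main_prog :: prog where
  "main_prog = Seq dist_prog (Seq log_prog (Seq jl_prog (Seq table_prog search_prog)))"

definition total_time :: "nat \<Rightarrow> nat \<Rightarrow> nat \<Rightarrow> nat \<Rightarrow> nat" where
  "total_time n M m J = n * (n * (n * 4 + 6) + 4) + 2 + (n * 6 + 128 * n * 3 + 8) + (m * (row_time n m + 2) + 2) +
     (n * 3 + 2 + 1 + (m * (J * (n * 4 + 4) + 2 + 1 + 2) + 2)) + search_time n M J"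

text \<open>\<open>2 ^ m\<close> enters as the separate argument \<open>J\<close>, which leaves an
  expression built from sums and products of its arguments.\<close>

lemma total_time_mono:
  assumes "n \<le> n'" "M \<le> M'" "m \<le> m'" "J \<le> J'"
  shows "total_time n M m J \<le> total_time n' M' m' J'"
  unfolding total_time_def row_time_def column_time_def search_time_def radius_time_def direction_time_def
    mean_time_def seed_time_def cut_time_def gain_time_def
  by (intro add_mono mult_le_mono assms order_refl)

section \<open>Polynomial bound on the running time\<close>

definition is_poly :: "(nat \<Rightarrow> nat) \<Rightarrow> bool" where
  "is_poly f \<longleftrightarrow> (\<exists>p. \<forall>x. f x = poly p x)"

lemma is_poly_intros:
  "is_poly (\<lambda>x. c)" "is_poly (\<lambda>x. x)"
  "is_poly f \<Longrightarrow> is_poly g \<Longrightarrow> is_poly (\<lambda>x. f x + g x)"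
  "is_poly f \<Longrightarrow> is_poly g \<Longrightarrow> is_poly (\<lambda>x. f x * g x)"
  "is_poly f \<Longrightarrow> is_poly (\<lambda>x. f x ^ k)"
proof -
  show "is_poly (\<lambda>x. c)" unfolding is_poly_def by (intro exI[of _ "[:c:]"]) simp
  show "is_poly (\<lambda>x. x)" unfolding is_poly_def by (intro exI[of _ "[:0, 1:]"]) simp
  show "is_poly f \<Longrightarrow> is_poly g \<Longrightarrow> is_poly (\<lambda>x. f x + g x)" unfolding is_poly_def by (metis poly_add)
  show "is_poly f \<Longrightarrow> is_poly g \<Longrightarrow> is_poly (\<lambda>x. f x * g x)" unfolding is_poly_def by (metis poly_mult)
  show "is_poly f \<Longrightarrow> is_poly (\<lambda>x. f x ^ k)" unfolding is_poly_def by (metis poly_power)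
qed

text \<open>The arguments come from \<open>L \<le> 2 * n\<close>, which bounds \<open>m\<close> by
  \<open>256 * x\<close>, and from \<open>2 ^ L \<le> 2 * n\<close>, which bounds
  \<open>2 ^ m\<close> by \<open>(2 * x) ^ 128\<close>.\<close>

lemma total_time_poly: "is_poly (\<lambda>x. total_time x x (256 * x) ((2 * x) ^ 128))"
  unfolding total_time_def row_time_def column_time_def search_time_def radius_time_def direction_time_def
    mean_time_def seed_time_def cut_time_def gain_time_def
  by (intro is_poly_intros)

text \<open>Allows the factor of the objective in the final bound to be enlarged.\<close>

lemma rc_objective_nonneg:
  assumes G: "submodular_hypergraph G"
  shows "0 \<le> rc_objective G l"
  unfolding rc_objective_def
proof (intro sum_nonneg mult_nonneg_nonneg)
  fix h assume h: "h \<in> hedges G"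
  show "0 \<le> weight G h" using G h by (auto simp: submodular_hypergraph_def less_imp_le)
  have "finite h" using G h by (auto simp: submodular_hypergraph_def intro: finite_subset)
  then interpret cut_function_edge h "subf G h"
    using G h by (auto simp: submodular_hypergraph_def cut_function_edge_def)
  show "0 \<le> F_norm h (subf G h) (l h)"
    unfolding integral_tail[symmetric] by (rule Bochner_Integration.integral_nonneg) (rule tail_nonneg)
qed

text \<open>With fewer than two vertices the sum in constraint (a) is empty. Two vertices make
  \<open>ln n\<close> positive, so that a bound in terms of it is possible.\<close>

lemma rc_feasible_card:
  fixes G :: "nat hypergraph"
  assumes "rc_feasible G l v" "verts G = {..<n}"
  shows "2 \<le> n"
proof (rule ccontr)
  assume "\<not> 2 \<le> n"
  then have e: "{(i, j). i \<in> verts G \<and> j \<in> verts G \<and> i < j} = {}" using assms(2) by auto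
  have "1 \<le> (\<Sum>(i, j)\<in>{(i, j). i \<in> verts G \<and> j \<in> verts G \<and> i < j}.
      meas G i * meas G j / total_meas G (verts G) * sqdist G v i j)"
    using assms(1) unfolding rc_feasible_def by blast
  then show False unfolding e by simp
qed

lemma ach_main:
  assumes G: "submodular_hypergraph G" and en: "enumerated G es" and feas: "rc_feasible G l v"
  defines "n \<equiv> card (verts G)"
  shows "\<exists>L. 2 ^ L \<le> 2 * n \<and> ach (value_oracle G es) main_prog (input_store G es l v)
    (total_time n (length es) (128 * L) (2 ^ (128 * L)))
    (\<lambda>s. 0 < balance G (output_cut G s) \<and>
      Psi G (output_cut G s) \<le> rc_objective G l * (2 * 10 ^ 22 * sqrt (real (128 * L))))"
proof -
  let ?Q = "value_oracle G es" and ?D = "sqdist G v" and ?M = "length es"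
  have V: "verts G = {..<n}" and es: "distinct es" "set es = hedges G"
    using en unfolding enumerated_def n_def by auto
  have n2: "2 \<le> n" by (rule rc_feasible_card[OF feas V])
  define s0 where "s0 = input_store G es l v"
  have i0: "nats s0 0 0 0 = n" "nats s0 0 0 1 = ?M" "nats s0 12 0 0 = 0" "reals s0 15 = (\<lambda>i j. 0)"
      "\<And>e. e < ?M \<Longrightarrow> reals s0 0 e 0 = weight G (es ! e)" "\<And>i. i < n \<Longrightarrow> reals s0 1 i 0 = meas G i"
      "\<And>i j. i < n \<Longrightarrow> j < n \<Longrightarrow> reals s0 2 i j = v i j"
    unfolding s0_def input_store_def n_def by (simp_all add: Let_def fun_eq_iff)
  have D_eq: "rest (reals s0 2) n 0 i j = ?D i j" if "i < n" "j < n" for i j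
    unfolding sqdist_eq_rest n_def[symmetric] rest_def using that i0(7) by (intro sum.cong) auto
  \<comment> \<open>Collects what later phases read: input arrays, distances and the number of rows.
    It is handed from phase to phase by framing.\<close>
  define W where "W L s \<longleftrightarrow> 0 < L \<and> n \<le> 2 ^ L \<and> 2 ^ L \<le> 2 * n \<and> nats s 0 = nats s0 0 \<and> nats s 12 = nats s0 12 \<and>
      nats s 10 0 0 = 128 * L \<and> nats s 11 0 0 = 2 ^ (128 * L) \<and> reals s 0 = reals s0 0 \<and> reals s 1 = reals s0 1 \<and>
      reals s 2 = reals s0 2 \<and> (\<forall>i<n. \<forall>j<n. reals s 10 i j = ?D i j)" for L and s :: store
  have W_keep: "W L s'" if "W L s" "keep NA RA s s'" "0 \<notin> NA" "12 \<notin> NA" "10 \<notin> NA" "11 \<notin> NA"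
      "0 \<notin> RA" "1 \<notin> RA" "2 \<notin> RA" "10 \<notin> RA" for L s s' NA RA
    using that unfolding W_def by (simp add: keep_def)
  have 1: "ach ?Q dist_prog s0 (n * (n * (n * 4 + 6) + 4) + 2) (\<lambda>s'. keep {20, 21, 22} {10, 30} s0 s' \<and>
    reals s' 10 = (\<lambda>i j. if i < n \<and> j < n then rest (reals s0 2) n 0 i j else reals s0 10 i j))"
    by (rule ach_dist[OF i0(1)])
  \<comment> \<open>The phases are unpacked one by one, since \<open>L\<close> is known only after
    the second and all later bounds, as well as the locale interpretation, depend on it.\<close>
  then obtain t1 s1 where r1: "run ?Q dist_prog s0 t1 s1" "t1 \<le> n * (n * (n * 4 + 6) + 4) + 2"
      and k1: "keep {20, 21, 22} {10, 30} s0 s1"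
      and D1: "reals s1 10 = (\<lambda>i j. if i < n \<and> j < n then rest (reals s0 2) n 0 i j else reals s0 10 i j)"
    unfolding ach_def by blast
  have n1: "nats s1 0 0 0 = n" using keep_nats[OF k1, of 0] i0 by simp
  obtain t2 s2 L where r2: "run ?Q log_prog s1 t2 s2" "t2 \<le> n * 6 + 128 * n * 3 + 8"
      and k2: "keep {10, 11, 17, 20} {} s1 s2"
      and L: "0 < L" "n \<le> 2 ^ L" "2 ^ L \<le> 2 * n" "nats s2 10 0 0 = 128 * L" "nats s2 11 0 0 = 2 ^ (128 * L)"
    using ach_log[OF n1 n2, of ?Q] unfolding ach_def by blast
  define m where "m = 128 * L"
  have W2: "W L s2"
    unfolding W_def using L D1 D_eq by (simp add: keep_nats[OF k1] keep_nats[OF k2] keep_reals[OF k1] keep_reals[OF k2])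
  have X2: "reals s2 15 = (\<lambda>i j. 0)" using i0 by (simp add: keep_reals[OF k1] keep_reals[OF k2])
  have sc: "sign_choice n m L" unfolding sign_choice_def m_def using L n2 by simp
  have D2: "reals s2 10 i j = rest (reals s2 2) n 0 i j" if "i < n" "j < n" for i j
    using W2 that D_eq unfolding W_def by simp
  have Wn: "nats s 0 0 0 = n" "nats s 10 0 0 = m" "nats s 11 0 0 = 2 ^ m" if "W L s" for s
    using that i0 unfolding W_def m_def by auto
  obtain t3 s3 where r3: "run ?Q jl_prog s2 t3 s3" "t3 \<le> m * (row_time n m + 2) + 2"
      and k3: "keep {21, 22, 23, 24, 25} {11, 15, 16, 17, 18, 20, 31, 32, 33, 34, 35} s2 s3"
      and P: "\<forall>i<n. \<forall>j<n. real m / 5 * rest (reals s2 2) n 0 i j \<le> (\<Sum>k<m. (reals s3 11 k i - reals s3 11 k j)\<^sup>2) \<and>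
        (\<Sum>k<m. (reals s3 11 k i - reals s3 11 k j)\<^sup>2) \<le> 3 * real m * rest (reals s2 2) n 0 i j"
    using ach_jl[OF sc Wn[OF W2] D2 X2, of ?Q] unfolding ach_def by blast
  have W3: "W L s3" by (rule W_keep[OF W2 k3]) auto
  define P' where "P' = reals s3 11"
  have P1: "real m / 5 * ?D x y \<le> (\<Sum>k<m. (P' k x - P' k y)\<^sup>2)"
    and P2: "(\<Sum>k<m. (P' k x - P' k y)\<^sup>2) \<le> 3 * real m * ?D x y" if "x < n" "y < n" for x y
  proof -
    have "rest (reals s2 2) n 0 x y = ?D x y" using D_eq[OF that] W2 unfolding W_def by simp
    then show "real m / 5 * ?D x y \<le> (\<Sum>k<m. (P' k x - P' k y)\<^sup>2)"
      "(\<Sum>k<m. (P' k x - P' k y)\<^sup>2) \<le> 3 * real m * ?D x y"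
      using P that unfolding P'_def by metis+
  qed
  obtain t4 s4 where r4: "run ?Q table_prog s3 t4 s4" "t4 \<le> table_time n m"
      and k4: "keep {18, 21, 22, 23} {12} s3 s4"
      and Tab: "\<forall>j<2 ^ m. \<forall>i<n. reals s4 12 j i = dirval P' m (set_decode j) i"
    using ach_table[OF Wn(1,2)[OF W3], of ?Q] unfolding ach_def P'_def by blast
  have W4: "W L s4" by (rule W_keep[OF W3 k4]) auto
  let ?Tab = "\<lambda>j. dirval P' m (set_decode j)"
  interpret metric_cut_search G es ?D ?Tab n "2 ^ m"
    by unfold_locales (use G V es sqdist_nonneg in auto)
  have env: "env s4"
    unfolding env_def using W4 Tab i0 unfolding W_def m_def by simp
  have valid: "valid s4" unfolding valid_def using W4 i0 unfolding W_def by simp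
  obtain t5 s5 where r5: "run ?Q search_prog s4 t5 s5" "t5 \<le> search_time n ?M (2 ^ m)"
      and im: "improve s4 s5 ((\<Union>a<n. \<Union>b<n. (\<Union>j<2 ^ m. direction_cuts (?D a b) j) \<union> mean_cuts (?D a b)) \<union> (\<Union>x<n. cuts {x}))"
    using ach_search[OF env valid] unfolding ach_def by blast
  have m0: "0 < m" using L by (simp add: m_def)
  obtain A a b where cand: "candidate ?D n P' m A" and ab: "a < n" "b < n"
      and S: "0 < balance G (nbhd ?D n A (?D a b))"
        "Psi G (nbhd ?D n A (?D a b)) \<le> rc_objective G l * (2 * 10 ^ 22 * sqrt (real m))"
    using good_candidate[OF G V feas m0 P1 P2] by blast
  let ?S = "nbhd ?D n A (?D a b)"
  have S_cuts: "?S \<in> cuts A" unfolding cuts_def using ab by blast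
  \<comment> \<open>Each kind of candidate is matched with the part of the search that tests it; a
    direction \<open>C\<close> is found through its binary code \<open>j\<close>.\<close>
  have "beats s5 ?S"
    using cand unfolding candidate_def
  proof (elim disjE exE conjE)
    fix x assume "x < n" "A = {x}"
    then show ?thesis using im S_cuts unfolding improve_def by blast
  next
    fix C a' b' x1 x2
    assume C: "C \<subseteq> {..<m}" and n: "a' < n" "b' < n" "x1 < n" "x2 < n"
      and A: "A = direction_seed ?D n (?D a' b') (dirval P' m C) x1 x2"
    have "C \<in> set_decode ` {..<2 ^ m}"
      using bij_betw_imp_surj_on[OF bij_betw_set_decode[of m]] C by simp
    then obtain j where j: "j < 2 ^ m" "C = set_decode j" by auto
    have "?S \<in> direction_cuts (?D a' b') j"
      using S_cuts n unfolding direction_cuts_def A j(2) by blast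
    then show ?thesis using im n j(1) unfolding improve_def by blast
  next
    fix a' b' x2
    assume n: "a' < n" "b' < n" "x2 < n" and A: "A = mean_seed ?D n P' m (?D a' b') x2"
    have "gain_sum ?D n P' m r x = sum_gain r x" for r x
      unfolding gain_sum_def sum_gain_def
      by (rule sum.reindex_bij_betw[OF bij_betw_set_decode, symmetric])
    then have "?S \<in> mean_cuts (?D a' b')"
      using S_cuts n unfolding mean_cuts_def A mean_seed_def by auto
    then show ?thesis using im n unfolding improve_def by blast
  qed
  then have fin: "0 < balance G (output_cut G s5)" "Psi G (output_cut G s5) \<le> Psi G ?S"
    using S(1) improve_valid[OF im] unfolding beats_def valid_def by auto
  have "run ?Q main_prog s0 (t1 + (t2 + (t3 + (t4 + t5)))) s5"
    unfolding main_prog_def by (rule run_Seq[OF r1(1) run_Seq[OF r2(1) run_Seq[OF r3(1) run_Seq[OF r4(1) r5(1)]]]])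
  moreover have "t1 + (t2 + (t3 + (t4 + t5))) \<le> total_time n ?M m (2 ^ m)"
  proof -
    have "t1 + (t2 + (t3 + (t4 + t5))) \<le> n * (n * (n * 4 + 6) + 4) + 2 + (n * 6 + 128 * n * 3 + 8 +
        (m * (row_time n m + 2) + 2 + (table_time n m + search_time n ?M (2 ^ m))))"
      by (intro add_mono r1(2) r2(2) r3(2) r4(2) r5(2))
    also have "\<dots> = total_time n ?M m (2 ^ m)"
      unfolding total_time_def table_time_def by (simp only: add.assoc)
    finally show ?thesis .
  qed
  ultimately have "ach ?Q main_prog s0 (total_time n ?M m (2 ^ m)) (\<lambda>s. 0 < balance G (output_cut G s) \<and>
      Psi G (output_cut G s) \<le> rc_objective G l * (2 * 10 ^ 22 * sqrt (real m)))"
    unfolding ach_def using fin(1) order_trans[OF fin(2) S(2)] by blast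
  then show ?thesis using L(3) unfolding s0_def m_def by blast
qed

text \<open>\<open>L * ln 2 \<le> ln 2 + ln n \<le> 2 * ln n\<close> and
  \<open>ln 2 \<ge> 2/3\<close> give \<open>L \<le> 3 * ln n\<close>, and
  \<open>128 * 3 = 384\<close> is below \<open>20^2\<close>.\<close>

lemma log_factor:
  assumes n: "2 \<le> n" and L: "2 ^ L \<le> 2 * n"
  shows "sqrt (real (128 * L)) \<le> 20 * sqrt (ln (real n))"
proof -
  have ln2: "2 / 3 \<le> ln (2::real)" using ln2_ge_two_thirds .
  have "real L * ln 2 = ln (2 ^ L)" by (simp add: ln_realpow)
  also have "\<dots> \<le> ln (2 * real n)"
  proof -
    have "real (2 ^ L) \<le> real (2 * n)" using L by (rule of_nat_mono)
    then show ?thesis using n by simp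
  qed
  also have "\<dots> = ln 2 + ln (real n)" using n by (simp add: ln_mult)
  finally have 1: "real L * ln 2 \<le> ln 2 + ln (real n)" .
  have "ln 2 \<le> ln (real n)" using n by (subst ln_le_cancel_iff) auto
  then have "real L * ln 2 \<le> 2 * ln (real n)" using 1 by simp
  moreover have "real L * (2 / 3) \<le> real L * ln 2" using ln2 by (intro mult_left_mono) auto
  ultimately have "real (128 * L) \<le> 20\<^sup>2 * ln (real n)"
    using \<open>ln 2 \<le> ln (real n)\<close> ln2 by simp
  then have "sqrt (real (128 * L)) \<le> sqrt (20\<^sup>2 * ln (real n))" by (rule real_sqrt_le_mono)
  then show ?thesis by (simp add: real_sqrt_mult)
qed

theorem mainTheorem9:
  shows "\<exists>(c :: prog) (p :: nat poly) (g :: nat \<Rightarrow> real).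
    g \<in> O(\<lambda>n. sqrt (ln (real n))) \<and>
    (\<forall>(G :: nat hypergraph) (es :: nat set list)
       (l :: nat set \<Rightarrow> nat \<Rightarrow> real) (v :: nat \<Rightarrow> nat \<Rightarrow> real).
       submodular_hypergraph G \<longrightarrow> enumerated G es \<longrightarrow> rc_optimal G l v \<longrightarrow>
       (\<exists>t s. run (value_oracle G es) c (input_store G es l v) t s \<and>
          t \<le> poly p (card (verts G) + card (hedges G)) \<and>
          balance G (output_cut G s) > 0 \<and>
          Psi G (output_cut G s) \<le> rc_objective G l * g (card (verts G))))"
proof -
  obtain p where p: "\<And>x. total_time x x (256 * x) ((2 * x) ^ 128) = poly p x"
    using total_time_poly unfolding is_poly_def by blast
  \<comment> \<open>The factor 2 stems from the sweep, \<open>10^22\<close> from the spread of the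
    seed, and 20 from comparing \<open>sqrt m\<close> with \<open>sqrt (ln n)\<close>.\<close>
  define g where "g n = 2 * 10 ^ 22 * 20 * sqrt (ln (real n))" for n
  have "g \<in> O(\<lambda>n. sqrt (ln (real n)))"
    unfolding g_def by simp
  moreover have "\<exists>t s. run (value_oracle G es) main_prog (input_store G es l v) t s \<and>
      t \<le> poly p (card (verts G) + card (hedges G)) \<and> balance G (output_cut G s) > 0 \<and>
      Psi G (output_cut G s) \<le> rc_objective G l * g (card (verts G))"
    if G: "submodular_hypergraph G" and en: "enumerated G es" and opt: "rc_optimal G l v"
    for G :: "nat hypergraph" and es l v
  proof -
    let ?n = "card (verts G)" and ?x = "card (verts G) + card (hedges G)"
    have feas: "rc_feasible G l v" using opt by (simp add: rc_optimal_def)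
    obtain L t s where L: "2 ^ L \<le> 2 * ?n" and r: "run (value_oracle G es) main_prog (input_store G es l v) t s"
        and t: "t \<le> total_time ?n (length es) (128 * L) (2 ^ (128 * L))" and b: "0 < balance G (output_cut G s)"
        and psi: "Psi G (output_cut G s) \<le> rc_objective G l * (2 * 10 ^ 22 * sqrt (real (128 * L)))"
      using ach_main[OF G en feas] unfolding ach_def by blast
    have n2: "2 \<le> ?n" using rc_feasible_card[OF feas] en unfolding enumerated_def by blast
    have M: "length es = card (hedges G)" using en unfolding enumerated_def by (metis distinct_card)
    have "L \<le> 2 * ?n" using less_exp[of L] L by linarith
    then have "128 * L \<le> 256 * ?x" by simp
    moreover have "2 ^ (128 * L) \<le> (2 * ?x) ^ 128"
    proof -
      have "2 ^ (128 * L) = ((2::nat) ^ L) ^ 128" by (simp add: power_mult[symmetric] mult.commute)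
      also have "\<dots> \<le> (2 * ?x) ^ 128" using L by (intro power_mono) auto
      finally show ?thesis .
    qed
    ultimately have "total_time ?n (length es) (128 * L) (2 ^ (128 * L)) \<le> total_time ?x ?x (256 * ?x) ((2 * ?x) ^ 128)"
      unfolding M by (intro total_time_mono) auto
    then have "t \<le> poly p ?x" using t unfolding p by simp
    moreover have "Psi G (output_cut G s) \<le> rc_objective G l * g ?n"
    proof (rule order_trans[OF psi mult_left_mono])
      show "2 * 10 ^ 22 * sqrt (real (128 * L)) \<le> g ?n"
        using log_factor[OF n2 L] unfolding g_def by simp
    qed (rule rc_objective_nonneg[OF G])
    ultimately show ?thesis using r b by blast
  qed
  ultimately show ?thesis by blast
qed

end
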